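(* Let $R=k[x_1,\ldots,x_n]$ be a polynomial ring over a field $k$ with its standard grading, let $I\subseteq R$ be a homogeneous ideal, and let $\operatorname{in}(I)$ be its initial ideal with respect to the reverse lexicographic order. Let $t\in\{0,\ldots,n-1\}$ and assume that $x_n,x_{n-1},\ldots,x_{n-t}$ is a filter-regular sequence in $R/\operatorname{in}(I)$. Then (a) $\operatorname{reg}_t(I)=\operatorname{reg}_t(\operatorname{in}(I))$; (b) $a^*_t(I)=a^*_t(\operatorname{in}(I))$.
   Context: The monomial order is the graded reverse lexicographic order with $x_1>x_2>\cdots>x_n$. $R_+=(x_1,\ldots,x_n)$. For a finitely generated graded $R$-module $N$, $H^i_{R_+}(N)$ is the $i$-th (graded) local cohomology module of $N$ with respect to $R_+$, $a_i(N)=\sup\{r\mid H^i_{R_+}(N)_r\ne0\}$ (with value $-\infty$ if $H^i_{R_+}(N)=0$), $\operatorname{reg}_t(N)=\max\{a_i(N)+i\mid 0\le i\le t\}$ and $a_t^*(N)=\max\{a_i(N)\mid 0\le i\le t\}$; ideals are regarded as graded modules. A sequence of homogeneous elements $z_1,\ldots,z_m$ of $R$ is a filter-regular sequence in $N$ if, for $i=0,\ldots,m-1$, $\big(((z_1,\ldots,z_i)N:z_{i+1})/(z_1,\ldots,z_i)N\big)_r=0$ for $r\gg0$, where $N':z=\{e\in N\mid ze\in N'\}$ for a submodule $N'\subseteq N$. *)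

theory Defs
  imports "HOL-Algebra.Module" "HOL-Algebra.Ideal" "HOL-Library.Poly_Mapping" "HOL-Library.Extended_Real"
begin

subsection \<open>Graded modules\<close>

text \<open>
  A graded module is a module record together with its homogeneous components in all integer
  degrees. The ring fields \<open>monoid.mult\<close> and \<open>one\<close> of the library's module record play no role
  in the module structure; they are left unspecified where there is no natural multiplication.
\<close>

record ('a, 'b) graded_module = "('a, 'b) module" +
  component :: "int \<Rightarrow> 'b set"

definition submod :: "('a, 'b) graded_module \<Rightarrow> 'b set \<Rightarrow> ('a, 'b) graded_module" where
  "submod M H = M\<lparr>carrier := H, component := (\<lambda>r. H \<inter> component M r)\<rparr>"

definition quotmod :: "('a, 'b) graded_module \<Rightarrow> 'b set \<Rightarrow> ('a, 'b set) graded_module" where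
  "quotmod M H =
     \<lparr>carrier = a_rcosets\<^bsub>M\<^esub> H, monoid.mult = undefined, one = undefined,
      zero = H, add = set_add M,
      smult = (\<lambda>a X. \<Union>x\<in>X. H +>\<^bsub>M\<^esub> (a \<odot>\<^bsub>M\<^esub> x)),
      component = (\<lambda>r. (\<lambda>e. H +>\<^bsub>M\<^esub> e) ` component M r)\<rparr>"


subsection \<open>The polynomial ring\<close>

text \<open>
  Monomials are exponent vectors; the ring in the variables with indices \<open>1, \<dots>, n\<close> is the
  carrier of those polynomials in countably many variables that involve no other variable.
\<close>

type_synonym expvec = "nat \<Rightarrow>\<^sub>0 nat"
type_synonym 'k mpoly = "expvec \<Rightarrow>\<^sub>0 'k"

definition mdeg :: "expvec \<Rightarrow> nat" where
  "mdeg m = (\<Sum>i\<in>Poly_Mapping.keys m. Poly_Mapping.lookup m i)"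

definition indet :: "nat \<Rightarrow> 'k::field mpoly" where
  "indet i = Poly_Mapping.single (Poly_Mapping.single i 1) 1"

definition mpolys :: "nat \<Rightarrow> 'k::field mpoly set" where
  "mpolys n = {f. \<forall>m\<in>Poly_Mapping.keys f. Poly_Mapping.keys m \<subseteq> {1..n}}"

text \<open>The record below serves both as the ring and as the graded module over itself.\<close>

definition poly_ring :: "nat \<Rightarrow> ('k::field mpoly, 'k mpoly) graded_module" where
  "poly_ring n =
     \<lparr>carrier = mpolys n, monoid.mult = (*), one = 1, zero = 0, add = (+), smult = (*),
      component = (\<lambda>r. {f \<in> mpolys n. \<forall>m\<in>Poly_Mapping.keys f. int (mdeg m) = r})\<rparr>"

definition homogeneous_elements :: "nat \<Rightarrow> 'k::field mpoly set" where
  "homogeneous_elements n = (\<Union>r. component (poly_ring n) r)"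

definition homogeneous_ideal :: "nat \<Rightarrow> 'k::field mpoly set \<Rightarrow> bool" where
  "homogeneous_ideal n I \<longleftrightarrow>
     ideal I (poly_ring n) \<and> (\<exists>F \<subseteq> homogeneous_elements n. I = Idl\<^bsub>poly_ring n\<^esub> F)"

definition ideal_module :: "nat \<Rightarrow> 'k::field mpoly set \<Rightarrow> ('k mpoly, 'k mpoly) graded_module" where
  "ideal_module n I = submod (poly_ring n) I"


subsection \<open>Initial ideals for the graded reverse lexicographic order\<close>

definition grevlex_less :: "expvec \<Rightarrow> expvec \<Rightarrow> bool" where
  "grevlex_less u v \<longleftrightarrow>
     mdeg u < mdeg v \<or>
     mdeg u = mdeg v \<and>
       (\<exists>i. Poly_Mapping.lookup u i > Poly_Mapping.lookup v i \<and>
            (\<forall>j>i. Poly_Mapping.lookup u j = Poly_Mapping.lookup v j))"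

definition lead_monom :: "'k::field mpoly \<Rightarrow> expvec" where
  "lead_monom f =
     (THE m. m \<in> Poly_Mapping.keys f \<and> (\<forall>u\<in>Poly_Mapping.keys f. u \<noteq> m \<longrightarrow> grevlex_less u m))"

definition initial_ideal :: "nat \<Rightarrow> 'k::field mpoly set \<Rightarrow> 'k mpoly set" where
  "initial_ideal n I =
     Idl\<^bsub>poly_ring n\<^esub> {Poly_Mapping.single (lead_monom f) 1 | f. f \<in> I \<and> f \<noteq> 0}"


subsection \<open>Filter-regular sequences\<close>

definition ideal_mult :: "nat \<Rightarrow> 'k::field mpoly set \<Rightarrow> ('k mpoly, 'b) graded_module \<Rightarrow> 'b set" where
  "ideal_mult n A M =
     \<Inter>{H. submodule H (poly_ring n) M \<and> (\<forall>a\<in>A. \<forall>e\<in>carrier M. a \<odot>\<^bsub>M\<^esub> e \<in> H)}"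

definition colon :: "('a, 'b) graded_module \<Rightarrow> 'b set \<Rightarrow> 'a \<Rightarrow> 'b set" where
  "colon M H z = {e \<in> carrier M. z \<odot>\<^bsub>M\<^esub> e \<in> H}"

definition filter_regular ::
  "nat \<Rightarrow> ('k::field mpoly, 'b) graded_module \<Rightarrow> 'k mpoly list \<Rightarrow> bool" where
  "filter_regular n M zs \<longleftrightarrow>
     set zs \<subseteq> homogeneous_elements n \<and>
     (\<forall>i<length zs.
        let N = ideal_mult n (Idl\<^bsub>poly_ring n\<^esub> (set (take i zs))) M;
            Q = quotmod (submod M (colon M N (zs ! i))) N
        in \<exists>r0. \<forall>r\<ge>r0. component Q r = {\<zero>\<^bsub>Q\<^esub>})"


subsection \<open>Localization at a homogeneous element\<close>

text \<open>
  \<open>mfrac M s e k\<close> is the fraction \<open>e / s^k\<close>, as a class of pairs. Operations on fractions are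
  given as unions over all representatives; as they do not depend on the representatives, each
  such union is again a single class.
\<close>

definition frac_rel :: "('a::comm_ring_1, 'b) graded_module \<Rightarrow> 'a \<Rightarrow> (('b \<times> nat) \<times> ('b \<times> nat)) set" where
  "frac_rel M s =
     {((e, k), (f, l)). e \<in> carrier M \<and> f \<in> carrier M \<and>
        (\<exists>q. s ^ (q + l) \<odot>\<^bsub>M\<^esub> e = s ^ (q + k) \<odot>\<^bsub>M\<^esub> f)}"

definition mfrac :: "('a::comm_ring_1, 'b) graded_module \<Rightarrow> 'a \<Rightarrow> 'b \<Rightarrow> nat \<Rightarrow> ('b \<times> nat) set" where
  "mfrac M s e k = frac_rel M s `` {(e, k)}"

text \<open>The argument \<open>d\<close> is the degree of \<open>s\<close>.\<close>

definition localization ::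
  "('a::comm_ring_1, 'b) graded_module \<Rightarrow> 'a \<Rightarrow> nat \<Rightarrow> ('a, ('b \<times> nat) set) graded_module" where
  "localization M s d =
     \<lparr>carrier = {mfrac M s e k | e k. e \<in> carrier M}, monoid.mult = undefined, one = undefined,
      zero = mfrac M s \<zero>\<^bsub>M\<^esub> 0,
      add = (\<lambda>X Y. \<Union>(e, k)\<in>X. \<Union>(f, l)\<in>Y.
               mfrac M s (s ^ l \<odot>\<^bsub>M\<^esub> e \<oplus>\<^bsub>M\<^esub> s ^ k \<odot>\<^bsub>M\<^esub> f) (k + l)),
      smult = (\<lambda>a X. \<Union>(e, k)\<in>X. mfrac M s (a \<odot>\<^bsub>M\<^esub> e) k),
      component = (\<lambda>r. {mfrac M s e k | e k. e \<in> component M (r + int (k * d))})\<rparr>"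


subsection \<open>Local cohomology\<close>

text \<open>
  Local cohomology with support in \<open>(x\<^sub>1, \<dots>, x\<^sub>n)\<close> is the cohomology of the Cech complex on
  \<open>x\<^sub>1, \<dots>, x\<^sub>n\<close>. Its \<open>p\<close>-th term is the direct sum, over the \<open>p\<close>-element subsets \<open>S\<close> of
  \<open>{1..n}\<close>, of the localizations of the module at the product of the variables in \<open>S\<close>.
\<close>

definition cech_index :: "nat \<Rightarrow> nat \<Rightarrow> nat set set" where
  "cech_index n p = {S. S \<subseteq> {1..n} \<and> card S = p}"

definition indet_prod :: "nat set \<Rightarrow> 'k::field mpoly" where
  "indet_prod S = (\<Prod>i\<in>S. indet i)"

definition cech_loc ::
  "('k::field mpoly, 'b) graded_module \<Rightarrow> nat set \<Rightarrow> ('k mpoly, ('b \<times> nat) set) graded_module" where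
  "cech_loc M S = localization M (indet_prod S) (card S)"

definition cech ::
  "nat \<Rightarrow> ('k::field mpoly, 'b) graded_module \<Rightarrow> nat
     \<Rightarrow> ('k mpoly, nat set \<Rightarrow> ('b \<times> nat) set) graded_module" where
  "cech n M p =
     \<lparr>carrier = (\<Pi>\<^sub>E S\<in>cech_index n p. carrier (cech_loc M S)),
      monoid.mult = undefined, one = undefined,
      zero = (\<lambda>S\<in>cech_index n p. \<zero>\<^bsub>cech_loc M S\<^esub>),
      add = (\<lambda>b c. \<lambda>S\<in>cech_index n p. b S \<oplus>\<^bsub>cech_loc M S\<^esub> c S),
      smult = (\<lambda>a c. \<lambda>S\<in>cech_index n p. a \<odot>\<^bsub>cech_loc M S\<^esub> c S),
      component = (\<lambda>r. \<Pi>\<^sub>E S\<in>cech_index n p. component (cech_loc M S) r)\<rparr>"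

text \<open>
  For \<open>j \<in> T\<close>, the canonical map from the localization at \<open>T - {j}\<close> to the localization at \<open>T\<close>
  rewrites a fraction with denominator \<open>(\<Prod>i\<in>T - {j}. x\<^sub>i)^k\<close> by multiplying numerator and
  denominator by \<open>x\<^sub>j^k\<close>.
\<close>

definition cech_map ::
  "('k::field mpoly, 'b) graded_module \<Rightarrow> nat set \<Rightarrow> nat \<Rightarrow> ('b \<times> nat) set \<Rightarrow> ('b \<times> nat) set" where
  "cech_map M T j X = (\<Union>(e, k)\<in>X. mfrac M (indet_prod T) (indet j ^ k \<odot>\<^bsub>M\<^esub> e) k)"

definition cech_diff ::
  "nat \<Rightarrow> ('k::field mpoly, 'b) graded_module \<Rightarrow> nat
     \<Rightarrow> (nat set \<Rightarrow> ('b \<times> nat) set) \<Rightarrow> (nat set \<Rightarrow> ('b \<times> nat) set)" where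
  "cech_diff n M p c =
     (\<lambda>T\<in>cech_index n (Suc p).
        \<Oplus>\<^bsub>cech_loc M T\<^esub>j\<in>T.
          (if even (card {i\<in>T. i < j}) then cech_map M T j (c (T - {j}))
           else \<ominus>\<^bsub>cech_loc M T\<^esub> cech_map M T j (c (T - {j}))))"

definition cocycles ::
  "nat \<Rightarrow> ('k::field mpoly, 'b) graded_module \<Rightarrow> nat \<Rightarrow> (nat set \<Rightarrow> ('b \<times> nat) set) set" where
  "cocycles n M p = {c \<in> carrier (cech n M p). cech_diff n M p c = \<zero>\<^bsub>cech n M (Suc p)\<^esub>}"

definition coboundaries ::
  "nat \<Rightarrow> ('k::field mpoly, 'b) graded_module \<Rightarrow> nat \<Rightarrow> (nat set \<Rightarrow> ('b \<times> nat) set) set" where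
  "coboundaries n M p =
     (case p of 0 \<Rightarrow> {\<zero>\<^bsub>cech n M 0\<^esub>} | Suc q \<Rightarrow> cech_diff n M q ` carrier (cech n M q))"

definition local_cohomology ::
  "nat \<Rightarrow> nat \<Rightarrow> ('k::field mpoly, 'b) graded_module
     \<Rightarrow> ('k mpoly, (nat set \<Rightarrow> ('b \<times> nat) set) set) graded_module" where
  "local_cohomology n i M = quotmod (submod (cech n M i) (cocycles n M i)) (coboundaries n M i)"


subsection \<open>The invariants\<close>

text \<open>In the extended reals, the supremum of the empty set is \<open>-\<infinity>\<close> and \<open>-\<infinity> + i = -\<infinity>\<close>.\<close>

definition a_invariant :: "nat \<Rightarrow> nat \<Rightarrow> ('k::field mpoly, 'b) graded_module \<Rightarrow> ereal" where
  "a_invariant n i M =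
     Sup {ereal (of_int r) | r.
       component (local_cohomology n i M) r \<noteq> {\<zero>\<^bsub>local_cohomology n i M\<^esub>}}"

definition reg_upto :: "nat \<Rightarrow> nat \<Rightarrow> ('k::field mpoly, 'b) graded_module \<Rightarrow> ereal" where
  "reg_upto n t M = Max ((\<lambda>i. a_invariant n i M + ereal (of_nat i)) ` {0..t})"

definition a_star :: "nat \<Rightarrow> nat \<Rightarrow> ('k::field mpoly, 'b) graded_module \<Rightarrow> ereal" where
  "a_star n t M = Max ((\<lambda>i. a_invariant n i M) ` {0..t})"

end

(*
  A family of fractions over the products of the variables in S has a common denominator
  exponent k, so Cech cochains are families of polynomials e_S with a Koszul-type differential for
  x_1^k, ..., x_n^k, and the vanishing of H^p(A/B) in degree r becomes a statement about
  polynomials, for ideals B <= A.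

  If z = x_v is filter-regular on R/J, then H^p(R/(J+z))_r vanishes as soon as H^p(R/J)_r and
  H^(p+1)(R/J)_(r-1) do; conversely the vanishing of H^p(R/(J+z)) in all degrees > r makes z
  injective on H^(p+1)(R/J) in degrees >= r, where z acts nilpotently, so that
  H^(p+1)(R/J)_r = 0. By induction along x_n, x_(n-1), ..., bounds on a_i + i or on a_i for i < t are
  equivalent to conditions on the degrees in which (J_i : x_(n-i)) / J_i lives, where
  J_i = I + (x_n, ..., x_(n-i+1)). Applied to I = 0 this gives H^p(R) = 0 for p < n, and hence
  H^(p+1)(I) = H^p(R/I) for p + 1 < n.

  For the reverse lexicographic order, passing to initial ideals commutes with adding the last
  variables and with the colon by the next one, so the conditions for I and for in(I) agree
  degree by degree.
*)
theory Submission
  imports Defs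
begin

section \<open>Polynomials and their homogeneous parts\<close>

text \<open>The invariants a_i are never compared one by one. Multiplication by a variable relates
  H^p of the quotient in degree r to H^p in degree r and H^(p+1) in degree r - 1, so what passes
  along the sequence is vanishing at all pairs (p, r) above a line r + c p = \<rho>. Slope c = 1
  gives the regularity, c = 0 the maximum of the a_i, and one induction with parameter c serves
  both; each variable raises the threshold by 1 - c. The variables are filter-regular but need not
  be regular, so in every diagram chase a factor x_v cancels only up to elements killed by x_v.
  These disappear after enlarging the common denominator: a uniform power of the products of
  variables pushes them into degrees where the colon adds nothing. Filter-regularity is assumed for
  in(I); since the comparison of the colons holds in each single degree, it carries over to I. The
  bound t < n is what makes H^i(I) equal to H^(i-1)(R/I) for 1 <= i <= t.\<close>

lemma mdeg_superset:
  assumes "finite A" "Poly_Mapping.keys m \<subseteq> A"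
  shows "mdeg m = (\<Sum>i\<in>A. Poly_Mapping.lookup m i)"
  unfolding mdeg_def using assms by (intro sum.mono_neutral_left) (auto simp: in_keys_iff)

lemma keys_add_nat: "Poly_Mapping.keys (u + v) = Poly_Mapping.keys u \<union> Poly_Mapping.keys (v::expvec)"
  by (auto simp: in_keys_iff lookup_add)

lemma mdeg_add: "mdeg (u + v) = mdeg u + mdeg v"
proof -
  let ?A = "Poly_Mapping.keys u \<union> Poly_Mapping.keys v"
  have "mdeg (u + v) = (\<Sum>i\<in>?A. Poly_Mapping.lookup (u + v) i)"
    by (rule mdeg_superset) (auto simp: keys_add_nat)
  also have "\<dots> = (\<Sum>i\<in>?A. Poly_Mapping.lookup u i) + (\<Sum>i\<in>?A. Poly_Mapping.lookup v i)"
    by (simp add: lookup_add sum.distrib)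
  also have "\<dots> = mdeg u + mdeg v"
    by (simp add: mdeg_superset[where A = ?A])
  finally show ?thesis .
qed

lemma mdeg_zero [simp]: "mdeg 0 = 0"
  by (simp add: mdeg_def)

lemma mdeg_single [simp]: "mdeg (Poly_Mapping.single i c) = c"
  by (simp add: mdeg_def)

definition forms :: "nat \<Rightarrow> int \<Rightarrow> 'k::field mpoly set" where
  "forms n r = {f \<in> mpolys n. \<forall>m\<in>Poly_Mapping.keys f. int (mdeg m) = r}"

lemma component_poly_ring [simp]: "component (poly_ring n) r = forms n r"
  by (simp add: poly_ring_def forms_def)

lemma forms_mpolys: "f \<in> forms n r \<Longrightarrow> f \<in> mpolys n"
  by (simp add: forms_def)

lemma mpolys_zero [simp]: "0 \<in> mpolys n"
  by (simp add: mpolys_def)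

lemma mpolys_one [simp]: "1 \<in> mpolys n"
  by (simp add: mpolys_def)

lemma mpolys_add: "f \<in> mpolys n \<Longrightarrow> g \<in> mpolys n \<Longrightarrow> f + g \<in> mpolys n"
  using Poly_Mapping.keys_add[of f g] unfolding mpolys_def by blast

lemma mpolys_uminus: "f \<in> mpolys n \<Longrightarrow> - f \<in> mpolys n"
  by (auto simp: mpolys_def in_keys_iff)

lemma mpolys_diff: "f \<in> mpolys n \<Longrightarrow> g \<in> mpolys n \<Longrightarrow> f - g \<in> mpolys n"
  using mpolys_add[of f n "- g"] mpolys_uminus by force

lemma mpolys_mult: "f \<in> mpolys n \<Longrightarrow> g \<in> mpolys n \<Longrightarrow> f * g \<in> mpolys n"
  using keys_mult[of f g] unfolding mpolys_def by (fastforce simp: keys_add_nat)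

lemma forms_zero [simp]: "0 \<in> forms n r"
  by (simp add: forms_def)

lemma forms_one: "1 \<in> forms n 0"
  by (simp add: forms_def)

lemma forms_add: "f \<in> forms n r \<Longrightarrow> g \<in> forms n r \<Longrightarrow> f + g \<in> forms n r"
  using Poly_Mapping.keys_add[of f g] unfolding forms_def by (auto simp: mpolys_add)

lemma forms_uminus: "f \<in> forms n r \<Longrightarrow> - f \<in> forms n r"
  by (auto simp: forms_def mpolys_uminus in_keys_iff)

lemma forms_diff: "f \<in> forms n r \<Longrightarrow> g \<in> forms n r \<Longrightarrow> f - g \<in> forms n r"
  using forms_add[of f n r "- g"] forms_uminus by force

lemma forms_sum: "(\<And>j. j \<in> T \<Longrightarrow> f j \<in> forms n r) \<Longrightarrow> sum f T \<in> forms n r"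
  by (induction T rule: infinite_finite_induct) (auto intro: forms_add)

lemma forms_mult: "f \<in> forms n a \<Longrightarrow> g \<in> forms n b \<Longrightarrow> f * g \<in> forms n (a + b)"
  using keys_mult[of f g] unfolding forms_def by (fastforce simp: mpolys_mult mdeg_add)

lemma forms_mult_eq:
  "f \<in> forms n a \<Longrightarrow> g \<in> forms n b \<Longrightarrow> c = a + b \<Longrightarrow> f * g \<in> forms n c"
  using forms_mult by blast

lemma forms_power: "f \<in> forms n a \<Longrightarrow> f ^ k \<in> forms n (int k * a)"
proof (induction k)
  case (Suc k)
  then have "f * f ^ k \<in> forms n (a + int k * a)" by (intro forms_mult)
  then show ?case by (simp add: algebra_simps)
qed (simp add: forms_one)

lemma keys_indet [simp]: "Poly_Mapping.keys (indet i :: 'k::field mpoly) = {Poly_Mapping.single i 1}"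
  by (simp add: indet_def)

lemma indet_forms: "i \<in> {1..n} \<Longrightarrow> indet i \<in> forms n 1"
  by (simp add: forms_def mpolys_def)

lemma indet_power_forms: "i \<in> {1..n} \<Longrightarrow> indet i ^ k \<in> forms n (int k)"
  using forms_power[OF indet_forms] by fastforce

lemma indet_neq_zero [simp]: "(indet i :: 'k::field mpoly) \<noteq> 0"
  using keys_indet[of i] by (metis insert_not_empty keys_zero)

lemma indet_prod_neq_zero [simp]: "finite S \<Longrightarrow> (indet_prod S :: 'k::field mpoly) \<noteq> 0"
  by (simp add: indet_prod_def)

lemma indet_prod_forms: "S \<subseteq> {1..n} \<Longrightarrow> indet_prod S \<in> forms n (int (card S))"
proof -
  assume S: "S \<subseteq> {1..n}"
  then have "finite S" by (rule finite_subset) simp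
  then show ?thesis using S
  proof (induction S rule: finite_induct)
    case empty
    then show ?case by (simp add: indet_prod_def forms_one)
  next
    case (insert x F)
    then show ?case
      using forms_mult[OF indet_forms[of x n], of "indet_prod F" "int (card F)"]
      by (simp add: indet_prod_def)
  qed
qed

lemma indet_prod_power_forms: "S \<subseteq> {1..n} \<Longrightarrow> indet_prod S ^ k \<in> forms n (int k * int (card S))"
  by (intro forms_power indet_prod_forms)

lemma indet_prod_remove:
  "finite S \<Longrightarrow> j \<in> S \<Longrightarrow> indet_prod S = indet j * indet_prod (S - {j})"
  by (simp add: indet_prod_def prod.remove)

definition part :: "(expvec \<Rightarrow> bool) \<Rightarrow> 'k::field mpoly \<Rightarrow> 'k mpoly" where
  "part P f = Abs_poly_mapping (\<lambda>m. if P m then Poly_Mapping.lookup f m else 0)"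

lemma lookup_part:
  "Poly_Mapping.lookup (part P f) m = (if P m then Poly_Mapping.lookup f m else 0)"
proof -
  have "finite {m. (if P m then Poly_Mapping.lookup f m else 0) \<noteq> 0}"
    by (rule finite_subset[of _ "Poly_Mapping.keys f"]) (auto simp: in_keys_iff split: if_splits)
  then show ?thesis by (simp add: part_def)
qed

lemma keys_part [simp]: "Poly_Mapping.keys (part P f) = {m \<in> Poly_Mapping.keys f. P m}"
  by (auto simp: in_keys_iff lookup_part split: if_splits)

lemma part_add: "part P (f + g) = part P f + part P g"
  by (rule poly_mapping_eqI) (simp add: lookup_part lookup_add)

lemma part_diff: "part P (f - g) = part P f - part P g"
  by (rule poly_mapping_eqI) (simp add: lookup_part lookup_minus)

lemma part_zero [simp]: "part P 0 = 0"
  by (rule poly_mapping_eqI) (simp add: lookup_part)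

lemma part_sum: "part P (sum f T) = (\<Sum>j\<in>T. part P (f j))"
  by (induction T rule: infinite_finite_induct) (auto simp: part_add)

lemma part_mpolys: "f \<in> mpolys n \<Longrightarrow> part P f \<in> mpolys n"
  by (auto simp: mpolys_def)

lemma part_forms: "f \<in> forms n r \<Longrightarrow> part P f \<in> forms n r"
  by (auto simp: forms_def part_mpolys)

lemma part_eq_self: "(\<And>m. m \<in> Poly_Mapping.keys f \<Longrightarrow> P m) \<Longrightarrow> part P f = f"
  by (rule poly_mapping_eqI) (auto simp: lookup_part in_keys_iff)

lemma part_eq_zero: "(\<And>m. m \<in> Poly_Mapping.keys f \<Longrightarrow> \<not> P m) \<Longrightarrow> part P f = 0"
  by (rule poly_mapping_eqI) (auto simp: lookup_part in_keys_iff)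

abbreviation hpart :: "int \<Rightarrow> 'k::field mpoly \<Rightarrow> 'k mpoly" where
  "hpart r \<equiv> part (\<lambda>m. int (mdeg m) = r)"

lemma hpart_forms: "f \<in> mpolys n \<Longrightarrow> hpart r f \<in> forms n r"
  by (auto simp: forms_def mpolys_def)

lemma hpart_eq_self: "f \<in> forms n r \<Longrightarrow> hpart r f = f"
  by (auto simp: forms_def intro: part_eq_self)

text \<open>Only the part of g in degree r - a can reach degree r: the remaining part
  \<open>h\<close> has no monomial there, and f shifts all degrees by a.\<close>

lemma hpart_mult:
  assumes "f \<in> forms n a"
  shows "hpart r (f * g) = f * hpart (r - a) g"
proof -
  define h where "h = g - hpart (r - a) g"
  have h: "int (mdeg m) \<noteq> r - a" if "m \<in> Poly_Mapping.keys h" for m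
    using that by (auto simp: h_def in_keys_iff lookup_minus lookup_part split: if_splits)
  have "hpart r (f * h) = 0"
  proof (rule part_eq_zero)
    fix m assume "m \<in> Poly_Mapping.keys (f * h)"
    then obtain u v where "u \<in> Poly_Mapping.keys f" "v \<in> Poly_Mapping.keys h" "m = u + v"
      using keys_mult by blast
    then show "int (mdeg m) \<noteq> r"
      using assms h[of v] by (auto simp: forms_def mdeg_add)
  qed
  moreover have "hpart r (f * hpart (r - a) g) = f * hpart (r - a) g"
  proof (rule part_eq_self)
    fix m assume "m \<in> Poly_Mapping.keys (f * hpart (r - a) g)"
    then obtain u v where "u \<in> Poly_Mapping.keys f" "v \<in> Poly_Mapping.keys (hpart (r - a) g)" "m = u + v"
      using keys_mult by blast
    then show "int (mdeg m) = r"
      using assms by (auto simp: forms_def mdeg_add)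
  qed
  moreover have "f * g = f * hpart (r - a) g + f * h"
    by (simp add: h_def algebra_simps)
  ultimately show ?thesis by (simp add: part_add)
qed

lemma sum_hpart: "f = (\<Sum>r\<in>(\<lambda>m. int (mdeg m)) ` Poly_Mapping.keys f. hpart r f)"
proof (rule poly_mapping_eqI)
  fix m
  show "Poly_Mapping.lookup f m
    = Poly_Mapping.lookup (\<Sum>r\<in>(\<lambda>m. int (mdeg m)) ` Poly_Mapping.keys f. hpart r f) m"
    by (auto simp: lookup_sum lookup_part sum.delta in_keys_iff image_iff)
qed

section \<open>Multiplication and division by a variable\<close>

lemma single_mult_lookup:
  "Poly_Mapping.lookup (Poly_Mapping.single u c * f) (u + m) = c * Poly_Mapping.lookup (f :: 'k::field mpoly) m"
proof -
  have "Poly_Mapping.lookup (Poly_Mapping.single u c * f) (u + m)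
      = (\<Sum>l. c * (\<Sum>q. Poly_Mapping.lookup f q when u + m = l + q) when u = l)"
    by (simp add: lookup_mult lookup_single when_mult)
  also have "\<dots> = c * Poly_Mapping.lookup f m"
    by simp
  finally show ?thesis .
qed

lemma keys_single_mult:
  fixes f :: "'k::field mpoly"
  assumes "c \<noteq> 0"
  shows "Poly_Mapping.keys (Poly_Mapping.single u c * f) = (+) u ` Poly_Mapping.keys f"
proof
  show "Poly_Mapping.keys (Poly_Mapping.single u c * f) \<subseteq> (+) u ` Poly_Mapping.keys f"
    using keys_mult[of "Poly_Mapping.single u c" f] by (auto split: if_splits)
  show "(+) u ` Poly_Mapping.keys f \<subseteq> Poly_Mapping.keys (Poly_Mapping.single u c * f)"
    using assms by (auto simp: in_keys_iff single_mult_lookup)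
qed

lemma keys_indet_mult:
  "Poly_Mapping.keys (indet v * f :: 'k::field mpoly) = (+) (Poly_Mapping.single v 1) ` Poly_Mapping.keys f"
  by (simp add: indet_def keys_single_mult)

text \<open>Adding x_v to exponents is injective, so pulling the coefficients of f back along this
  shift (\<open>map_key\<close>) gives the quotient; no monomial is lost, as each involves
  x_v.\<close>

lemma indet_dvdE:
  fixes f :: "'k::field mpoly"
  assumes "f \<in> mpolys n" "\<And>m. m \<in> Poly_Mapping.keys f \<Longrightarrow> Poly_Mapping.lookup m v > 0"
  obtains h where "h \<in> mpolys n" "f = indet v * h"
proof -
  define s :: "expvec \<Rightarrow> expvec" where "s = (+) (Poly_Mapping.single v 1)"
  have inj: "inj s" by (auto simp: s_def inj_def)
  define h where "h = Poly_Mapping.map_key s f"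
  have lh: "Poly_Mapping.lookup h m = Poly_Mapping.lookup f (s m)" for m
    using inj by (simp add: h_def map_key.rep_eq)
  have eq: "f = indet v * h"
  proof (rule poly_mapping_eqI)
    fix m
    show "Poly_Mapping.lookup f m = Poly_Mapping.lookup (indet v * h) m"
    proof (cases "Poly_Mapping.lookup m v > 0")
      case True
      then have "m = Poly_Mapping.single v 1 + (m - Poly_Mapping.single v 1)"
        by (intro poly_mapping_eqI) (auto simp: lookup_add lookup_minus lookup_single when_def)
      then show ?thesis
        using single_mult_lookup[of "Poly_Mapping.single v 1" 1 h "m - Poly_Mapping.single v 1"] lh
        by (simp add: indet_def s_def)
    next
      case False
      then have "m \<notin> Poly_Mapping.keys f" "m \<notin> Poly_Mapping.keys (indet v * h)"
        using assms(2)[of m] by (auto simp: keys_indet_mult lookup_add)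
      then show ?thesis by (simp add: in_keys_iff)
    qed
  qed
  have "Poly_Mapping.keys m \<subseteq> {1..n}" if "m \<in> Poly_Mapping.keys h" for m
  proof -
    have "s m \<in> Poly_Mapping.keys f" using that by (simp add: in_keys_iff lh)
    then have "Poly_Mapping.keys (s m) \<subseteq> {1..n}" using assms(1) by (simp add: mpolys_def)
    then show ?thesis by (auto simp: s_def keys_add_nat)
  qed
  then have "h \<in> mpolys n" by (simp add: mpolys_def)
  with eq show thesis by (rule that[rotated])
qed

lemma forms_indet_cancel:
  assumes "indet v * h \<in> forms n r" "h \<in> mpolys n"
  shows "h \<in> forms n (r - 1)"
  using assms unfolding forms_def by (auto simp: keys_indet_mult mdeg_add)


section \<open>Ideals\<close>

text \<open>Ideals as plain sets of polynomials, which keeps the record \<open>poly_ring n\<close>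
  out of the computations; negatives come from multiplication by -1.\<close>

definition mpideal :: "nat \<Rightarrow> 'k::field mpoly set \<Rightarrow> bool" where
  "mpideal n J \<longleftrightarrow> J \<subseteq> mpolys n \<and> 0 \<in> J \<and> (\<forall>f\<in>J. \<forall>g\<in>J. f + g \<in> J)
     \<and> (\<forall>f\<in>J. \<forall>a\<in>mpolys n. a * f \<in> J)"

lemma mpideal_add: "mpideal n J \<Longrightarrow> f \<in> J \<Longrightarrow> g \<in> J \<Longrightarrow> f + g \<in> J"
  by (simp add: mpideal_def)

lemma mpideal_mult: "mpideal n J \<Longrightarrow> f \<in> J \<Longrightarrow> a \<in> mpolys n \<Longrightarrow> a * f \<in> J"
  by (simp add: mpideal_def)

lemma mpideal_zero: "mpideal n J \<Longrightarrow> 0 \<in> J"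
  by (simp add: mpideal_def)

lemma mpideal_mpolys: "mpideal n J \<Longrightarrow> f \<in> J \<Longrightarrow> f \<in> mpolys n"
  by (auto simp: mpideal_def)

lemma mpideal_uminus: "mpideal n J \<Longrightarrow> f \<in> J \<Longrightarrow> - f \<in> J"
  using mpideal_mult[of n J f "- 1"] by (simp add: mpolys_uminus)

lemma mpideal_diff: "mpideal n J \<Longrightarrow> f \<in> J \<Longrightarrow> g \<in> J \<Longrightarrow> f - g \<in> J"
  using mpideal_add[of n J f "- g"] mpideal_uminus by force

lemma mpideal_sum: "mpideal n J \<Longrightarrow> (\<And>j. j \<in> T \<Longrightarrow> f j \<in> J) \<Longrightarrow> sum f T \<in> J"
  by (induction T rule: infinite_finite_induct) (auto simp: mpideal_zero intro: mpideal_add)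

lemma mpideal_cong: "mpideal n J \<Longrightarrow> f - g \<in> J \<Longrightarrow> f \<in> J \<longleftrightarrow> g \<in> J"
  using mpideal_add[of n J "f - g" g] mpideal_diff[of n J f "f - g"] by auto

lemma mpideal_top: "mpideal n (mpolys n)"
  by (simp add: mpideal_def mpolys_add mpolys_mult)

lemma mpideal_bot: "mpideal n {0}"
  by (simp add: mpideal_def)

lemma cring_poly_ring: "cring (poly_ring n)"
proof (rule cringI)
  show "abelian_group (poly_ring n)"
    by (rule abelian_groupI)
      (auto simp: poly_ring_def mpolys_add add.assoc add.commute intro!: bexI[OF _ mpolys_uminus])
  show "comm_monoid (poly_ring n)"
    by (rule comm_monoidI) (auto simp: poly_ring_def mpolys_mult mult.assoc mult.commute)
qed (auto simp: poly_ring_def algebra_simps)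

lemma poly_ring_simps [simp]:
  "carrier (poly_ring n) = mpolys n" "\<zero>\<^bsub>poly_ring n\<^esub> = 0" "\<one>\<^bsub>poly_ring n\<^esub> = 1"
  "f \<oplus>\<^bsub>poly_ring n\<^esub> g = f + g" "f \<otimes>\<^bsub>poly_ring n\<^esub> g = f * g" "f \<odot>\<^bsub>poly_ring n\<^esub> g = f * g"
  by (simp_all add: poly_ring_def)

lemma ideal_poly_ring_iff: "ideal J (poly_ring n) \<longleftrightarrow> mpideal n J"
proof
  assume "ideal J (poly_ring n)"
  then interpret ideal J "poly_ring n" .
  show "mpideal n J"
    using a_subset additive_subgroup.zero_closed[OF is_additive_subgroup]
      additive_subgroup.a_closed[OF is_additive_subgroup] I_l_closed
    unfolding mpideal_def by auto
next
  assume J: "mpideal n J"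
  interpret cring "poly_ring n" by (rule cring_poly_ring)
  have inv: "inv\<^bsub>add_monoid (poly_ring n)\<^esub> f = - f" if "f \<in> mpolys n" for f :: "'a mpoly"
    using that minus_equality[of "- f" f] by (simp add: a_inv_def mpolys_uminus)
  show "ideal J (poly_ring n)"
  proof (rule idealI)
    show "ring (poly_ring n)" by (rule ring_axioms)
    show "subgroup J (add_monoid (poly_ring n))"
      by (rule subgroup.intro)
        (use J inv in \<open>auto simp: mpideal_zero mpideal_uminus mpideal_mpolys intro: mpideal_add\<close>)
    show "g \<otimes>\<^bsub>poly_ring n\<^esub> f \<in> J" "f \<otimes>\<^bsub>poly_ring n\<^esub> g \<in> J"
      if "f \<in> J" "g \<in> carrier (poly_ring n)" for f g
      using mpideal_mult[OF J that(1), of g] that(2) by (simp_all add: mult.commute)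
  qed
qed

lemma genideal_poly_ring_minimal:
  "mpideal n J \<Longrightarrow> F \<subseteq> J \<Longrightarrow> Idl\<^bsub>poly_ring n\<^esub> F \<subseteq> J"
  by (auto simp: genideal_def ideal_poly_ring_iff)

lemma genideal_poly_ring:
  assumes "F \<subseteq> mpolys n"
  shows "mpideal n (Idl\<^bsub>poly_ring n\<^esub> F)" "F \<subseteq> Idl\<^bsub>poly_ring n\<^esub> F"
  using ring.genideal_ideal[OF cring.axioms(1)[OF cring_poly_ring[of n]], of F]
    ring.genideal_self[OF cring.axioms(1)[OF cring_poly_ring[of n]], of F] assms
  by (simp_all add: ideal_poly_ring_iff)

definition graded_ideal :: "nat \<Rightarrow> 'k::field mpoly set \<Rightarrow> bool" where
  "graded_ideal n J \<longleftrightarrow> mpideal n J \<and> (\<forall>f\<in>J. \<forall>r. hpart r f \<in> J)"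

lemma graded_ideal_hpart: "graded_ideal n J \<Longrightarrow> f \<in> J \<Longrightarrow> hpart r f \<in> J"
  by (simp add: graded_ideal_def)

lemma graded_ideal_mpideal: "graded_ideal n J \<Longrightarrow> mpideal n J"
  by (simp add: graded_ideal_def)

text \<open>The elements of I all of whose homogeneous parts lie in I form an ideal \<open>K\<close>
  that contains the homogeneous generators, hence all of I.\<close>

lemma homogeneous_ideal_imp_graded:
  assumes "homogeneous_ideal n I"
  shows "graded_ideal n I"
proof -
  have I: "mpideal n I" using assms by (simp add: homogeneous_ideal_def ideal_poly_ring_iff)
  obtain F where F: "F \<subseteq> homogeneous_elements n" "I = Idl\<^bsub>poly_ring n\<^esub> F"
    using assms by (auto simp: homogeneous_ideal_def)
  have Fm: "F \<subseteq> mpolys n"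
    using F(1) by (auto simp: homogeneous_elements_def forms_def)
  define K where "K = {f \<in> I. \<forall>r. hpart r f \<in> I}"
  have "mpideal n K"
    unfolding mpideal_def
  proof (intro conjI ballI)
    show "K \<subseteq> mpolys n" using I by (auto simp: K_def mpideal_mpolys)
    show "0 \<in> K" using I by (simp add: K_def mpideal_zero)
    show "f + g \<in> K" if "f \<in> K" "g \<in> K" for f g
      using that I by (auto simp: K_def part_add intro: mpideal_add)
    fix f a :: "'a mpoly" assume f: "f \<in> K" and a: "a \<in> mpolys n"
    have "hpart r (a * f) \<in> I" for r
    proof -
      let ?D = "(\<lambda>m. int (mdeg m)) ` Poly_Mapping.keys a"
      have "a * f = (\<Sum>d\<in>?D. hpart d a * f)"
        by (subst sum_hpart[of a]) (simp add: sum_distrib_right)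
      then have "hpart r (a * f) = (\<Sum>d\<in>?D. hpart d a * hpart (r - d) f)"
        by (simp only: part_sum hpart_mult[OF hpart_forms[OF a]])
      moreover have "\<dots> \<in> I"
        using f by (intro mpideal_sum[OF I] mpideal_mult[OF I] part_mpolys a) (simp add: K_def)
      ultimately show ?thesis by simp
    qed
    then show "a * f \<in> K" using f a I by (auto simp: K_def mpideal_mult)
  qed
  moreover have "F \<subseteq> K"
  proof
    fix f assume f: "f \<in> F"
    then obtain d where d: "f \<in> forms n d" using F(1) by (auto simp: homogeneous_elements_def)
    have fI: "f \<in> I" using f F(2) genideal_poly_ring(2)[OF Fm] by auto
    have "hpart r f \<in> I" for r
    proof (cases "r = d")
      case True
      then show ?thesis using hpart_eq_self[OF d] fI by simp
    next
      case False
      then have "hpart r f = 0" using d by (intro part_eq_zero) (auto simp: forms_def)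
      then show ?thesis using I by (simp add: mpideal_zero)
    qed
    then show "f \<in> K" using fI by (simp add: K_def)
  qed
  ultimately have "I \<subseteq> K" unfolding F(2) by (rule genideal_poly_ring_minimal)
  then show ?thesis using I by (auto simp: graded_ideal_def K_def)
qed


section \<open>The Cech complex through powers of the variables\<close>

text \<open>The sign (-1)^m for j at position m of T, counted from 0; as a polynomial it enters
  products without a case distinction.\<close>

definition csign :: "nat set \<Rightarrow> nat \<Rightarrow> 'k::field mpoly" where
  "csign T j = (if even (card {i\<in>T. i < j}) then 1 else - 1)"

text \<open>
  The differential of the Cech complex on families of numerators whose denominators are all
  \<open>(\<Prod>i\<in>S. x\<^sub>i)^k\<close>; equivalently, the Koszul differential of \<open>x\<^sub>1^k, \<dots>, x\<^sub>n^k\<close>.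
\<close>

definition kdiff :: "nat \<Rightarrow> (nat set \<Rightarrow> 'k::field mpoly) \<Rightarrow> nat set \<Rightarrow> 'k mpoly" where
  "kdiff k e T = (\<Sum>j\<in>T. csign T j * (indet j ^ k * e (T - {j})))"

lemma csign_mult_self [simp]: "csign T j * csign T j = 1"
  by (simp add: csign_def)

lemma csign_forms: "csign T j \<in> forms n 0"
  by (simp add: csign_def forms_one forms_uminus)

lemma csign_singleton [simp]: "csign {j} j = 1"
proof -
  have "{i \<in> {j}. i < j} = {}" by auto
  then show ?thesis unfolding csign_def by (simp only: card.empty) simp
qed

text \<open>For i < j, removing i lowers the position of j by one, while removing j leaves the
  position of i unchanged.\<close>

lemma csign_antisym:
  assumes "finite W" "i \<in> W" "j \<in> W" "i \<noteq> j"
  shows "csign W j * csign (W - {j}) i = - (csign W i * csign (W - {i}) j)"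
proof -
  have *: "csign W j * csign (W - {j}) i = - (csign W i * csign (W - {i}) j)"
    if "i < j" "i \<in> W" "j \<in> W" for i j
  proof -
    have "{l \<in> W. l < j} = insert i {l \<in> W - {i}. l < j}" using that by auto
    then have "card {l \<in> W. l < j} = Suc (card {l \<in> W - {i}. l < j})"
      using assms(1) by simp
    moreover have "{l \<in> W - {j}. l < i} = {l \<in> W. l < i}" using that by auto
    ultimately show ?thesis unfolding csign_def by simp
  qed
  show ?thesis
  proof (cases "i < j")
    case True
    then show ?thesis using * assms by blast
  next
    case False
    then have "csign W i * csign (W - {i}) j = - (csign W j * csign (W - {j}) i)"
      using *[of j i] assms by auto
    then show ?thesis by (metis minus_minus)
  qed
qed

text \<open>Elements are added to W one by one, and the row and the column of the new element
  cancel. Deducing the claim from s = -s would fail in characteristic 2.\<close>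

lemma sum_antisym_eq_zero:
  fixes a :: "'i \<Rightarrow> 'i \<Rightarrow> 'a::ab_group_add"
  assumes "finite W" "\<And>i j. i \<in> W \<Longrightarrow> j \<in> W \<Longrightarrow> i \<noteq> j \<Longrightarrow> a j i = - a i j"
  shows "(\<Sum>j\<in>W. \<Sum>i\<in>W - {j}. a j i) = 0"
  using assms
proof (induction W rule: finite_induct)
  case (insert x F)
  have "(\<Sum>i\<in>insert x F - {j}. a j i) = a j x + (\<Sum>i\<in>F - {j}. a j i)" if "j \<in> F" for j
  proof -
    have "insert x F - {j} = insert x (F - {j})" using that insert.hyps by auto
    then show ?thesis using insert.hyps by simp
  qed
  then have "(\<Sum>j\<in>F. \<Sum>i\<in>insert x F - {j}. a j i) = (\<Sum>j\<in>F. a j x) + (\<Sum>j\<in>F. \<Sum>i\<in>F - {j}. a j i)"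
    by (simp add: sum.distrib)
  moreover have "(\<Sum>j\<in>F. \<Sum>i\<in>F - {j}. a j i) = 0"
    by (rule insert.IH) (rule insert.prems, simp_all)
  moreover have "(\<Sum>j\<in>F. a j x) = - (\<Sum>j\<in>F. a x j)"
    unfolding sum_negf[symmetric]
  proof (rule sum.cong)
    fix j assume "j \<in> F"
    then show "a j x = - a x j" using insert.hyps by (intro insert.prems) auto
  qed simp
  moreover have "insert x F - {x} = F" using insert.hyps by auto
  ultimately show ?case using insert.hyps by simp
qed simp

lemma kdiff_empty [simp]: "kdiff k e {} = 0"
  by (simp add: kdiff_def)

lemma kdiff_add: "kdiff k (\<lambda>S. e S + f S) T = kdiff k e T + kdiff k f T"
  by (simp add: kdiff_def algebra_simps sum.distrib)

lemma kdiff_diff: "kdiff k (\<lambda>S. e S - f S) T = kdiff k e T - kdiff k f T"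
  by (simp add: kdiff_def algebra_simps sum_subtractf)

lemma kdiff_mult: "kdiff k (\<lambda>S. a * e S) T = a * kdiff k e T"
  by (simp add: kdiff_def sum_distrib_left mult_ac)

text \<open>Change of the common denominator: the fractions with numerators
  \<open>indet_prod S ^ m * e S\<close> and exponent k + m are the old ones, so the differential
  scales in the same way.\<close>

lemma kdiff_scale:
  assumes "finite T"
  shows "kdiff (k + m) (\<lambda>S. indet_prod S ^ m * e S) T = indet_prod T ^ m * kdiff k e T"
  unfolding kdiff_def sum_distrib_left
  by (rule sum.cong)
    (simp_all add: indet_prod_remove[OF assms] power_mult_distrib power_add mult_ac)

lemma kdiff_kdiff:
  fixes e :: "nat set \<Rightarrow> 'k::field mpoly"
  assumes "finite W"
  shows "kdiff k (kdiff k e) W = 0"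
proof -
  have "kdiff k (kdiff k e) W = (\<Sum>j\<in>W. \<Sum>i\<in>W - {j}.
      (csign W j * csign (W - {j}) i) * (indet j ^ k * indet i ^ k * e (W - {j} - {i})))"
    unfolding kdiff_def by (simp add: sum_distrib_left mult_ac)
  also have "\<dots> = 0"
  proof (rule sum_antisym_eq_zero[OF assms])
    fix i j assume "i \<in> W" "j \<in> W" "i \<noteq> j"
    then have "(csign W j :: 'k mpoly) * csign (W - {j}) i = - (csign W i * csign (W - {i}) j)"
      by (rule csign_antisym[OF assms])
    moreover have "W - {j} - {i} = W - {i} - {j}" by auto
    ultimately show "(csign W j * csign (W - {j}) i) * (indet j ^ k * indet i ^ k * e (W - {j} - {i}))
      = - ((csign W i * csign (W - {i}) j) * (indet i ^ k * indet j ^ k * e (W - {i} - {j})))"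
      by (simp only: mult.commute[of "indet i ^ k"] mult_minus_left)
  qed
  finally show ?thesis .
qed

section \<open>Index sets, graded cochains and vanishing of cohomology\<close>

lemma cech_index_finite: "S \<in> cech_index n p \<Longrightarrow> finite S"
  by (auto simp: cech_index_def intro: finite_subset)

lemma cech_index_remove: "T \<in> cech_index n (Suc p) \<Longrightarrow> j \<in> T \<Longrightarrow> T - {j} \<in> cech_index n p"
  using cech_index_finite[of T n "Suc p"] by (auto simp: cech_index_def)

lemma cech_index_zero [simp]: "cech_index n 0 = {{}}"
proof -
  have "S = {}" if "S \<subseteq> {1..n}" "card S = 0" for S
    using that finite_subset[OF that(1)] by auto
  then show ?thesis by (auto simp: cech_index_def)
qed

lemma cech_index_subset: "S \<in> cech_index n p \<Longrightarrow> S \<subseteq> {1..n}"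
  by (simp add: cech_index_def)

lemma cech_index_Suc_nonempty: "S \<in> cech_index n (Suc p) \<Longrightarrow> S \<noteq> {}"
  by (auto simp: cech_index_def)

lemma kdiff_mpideal:
  assumes "mpideal n J" "T \<subseteq> {1..n}" "\<And>j. j \<in> T \<Longrightarrow> e (T - {j}) \<in> J"
  shows "kdiff k e T \<in> J"
  unfolding kdiff_def
proof (intro mpideal_sum[OF assms(1)] mpideal_mult[OF assms(1)])
  fix j assume j: "j \<in> T"
  show "e (T - {j}) \<in> J" by (rule assms(3)[OF j])
  show "indet j ^ k \<in> mpolys n"
    using j assms(2) by (intro forms_mpolys[OF indet_power_forms]) auto
  show "csign T j \<in> mpolys n" by (rule forms_mpolys[OF csign_forms])
qed

text \<open>Cochains of degree \<open>r\<close> with denominators \<open>(\<Prod>i\<in>S. x\<^sub>i)^k\<close>, given by their numerators.\<close>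

definition cochain ::
  "nat \<Rightarrow> 'k::field mpoly set \<Rightarrow> nat \<Rightarrow> int \<Rightarrow> nat \<Rightarrow> (nat set \<Rightarrow> 'k mpoly) \<Rightarrow> bool" where
  "cochain n A p r k e \<longleftrightarrow> (\<forall>S\<in>cech_index n p. e S \<in> A \<inter> forms n (r + int k * int p))"

lemma cochainD:
  assumes "cochain n A p r k e" "S \<in> cech_index n p"
  shows "e S \<in> A" "e S \<in> forms n (r + int k * int p)"
  using assms by (auto simp: cochain_def)

lemma cochain_diff:
  "mpideal n A \<Longrightarrow> cochain n A p r k e \<Longrightarrow> cochain n A p r k f
    \<Longrightarrow> cochain n A p r k (\<lambda>S. e S - f S)"
  by (auto simp: cochain_def mpideal_diff forms_diff)

lemma cochain_mono: "A \<subseteq> B \<Longrightarrow> cochain n A p r k e \<Longrightarrow> cochain n B p r k e"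
  by (auto simp: cochain_def)

lemma cochain_scale:
  assumes "mpideal n A" "cochain n A p r k e"
  shows "cochain n A p r (k + m) (\<lambda>S. indet_prod S ^ m * e S)"
  unfolding cochain_def
proof
  fix S assume S: "S \<in> cech_index n p"
  have f: "indet_prod S ^ m \<in> forms n (int m * int p)"
    using indet_prod_power_forms[OF cech_index_subset[OF S]] S by (simp add: cech_index_def)
  show "indet_prod S ^ m * e S \<in> A \<inter> forms n (r + int (k + m) * int p)"
    using mpideal_mult[OF assms(1) cochainD(1)[OF assms(2) S] forms_mpolys[OF f]]
      forms_mult_eq[OF f cochainD(2)[OF assms(2) S]] by (simp add: algebra_simps)
qed

lemma cochain_mult:
  assumes "mpideal n A" "cochain n A p r k e" "a \<in> forms n d"
  shows "cochain n A p (r + d) k (\<lambda>S. a * e S)"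
  using assms forms_mpolys[OF assms(3)] unfolding cochain_def
  by (auto intro!: mpideal_mult forms_mult_eq)

lemma kdiff_forms:
  assumes "cochain n A p r k e" "T \<in> cech_index n (Suc p)"
  shows "kdiff k e T \<in> forms n (r + int k * int (Suc p))"
  unfolding kdiff_def
proof (rule forms_sum)
  fix j assume j: "j \<in> T"
  have "indet j ^ k * e (T - {j}) \<in> forms n (int k + (r + int k * int p))"
    using j cech_index_subset[OF assms(2)]
    by (intro forms_mult indet_power_forms cochainD(2)[OF assms(1)] cech_index_remove[OF assms(2)]) auto
  then show "csign T j * (indet j ^ k * e (T - {j})) \<in> forms n (r + int k * int (Suc p))"
    by (rule forms_mult_eq[OF csign_forms]) (simp add: algebra_simps)
qed

lemma cochain_kdiff:
  assumes "mpideal n A" "cochain n A p r k e"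
  shows "cochain n A (Suc p) r k (kdiff k e)"
  unfolding cochain_def
proof
  fix T assume T: "T \<in> cech_index n (Suc p)"
  have "kdiff k e T \<in> A"
    using T by (intro kdiff_mpideal[OF assms(1)] cech_index_subset cochainD(1)[OF assms(2)] cech_index_remove)
  then show "kdiff k e T \<in> A \<inter> forms n (r + int k * int (Suc p))"
    using kdiff_forms[OF assms(2) T] by simp
qed

text \<open>
  Vanishing of \<open>H^p(A/B)\<close> in degree \<open>r\<close>, for ideals \<open>B \<subseteq> A\<close>. For \<open>p = 0\<close> the family \<open>f\<close> is
  irrelevant, as \<open>kdiff k f {} = 0\<close>.
\<close>

definition lc_vanish ::
  "nat \<Rightarrow> 'k::field mpoly set \<Rightarrow> 'k mpoly set \<Rightarrow> nat \<Rightarrow> int \<Rightarrow> bool" where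
  "lc_vanish n A B p r \<longleftrightarrow>
     (\<forall>k e. cochain n A p r k e \<longrightarrow> (\<forall>T\<in>cech_index n (Suc p). kdiff k e T \<in> B) \<longrightarrow>
        (\<exists>m f. (\<forall>q. p = Suc q \<longrightarrow> cochain n A q r (k + m) f) \<and>
           (\<forall>S\<in>cech_index n p. indet_prod S ^ m * e S - kdiff (k + m) f S \<in> B)))"

lemma lc_vanishI:
  assumes "\<And>k e. cochain n A p r k e \<Longrightarrow> (\<And>T. T \<in> cech_index n (Suc p) \<Longrightarrow> kdiff k e T \<in> B) \<Longrightarrow>
    \<exists>m f. (\<forall>q. p = Suc q \<longrightarrow> cochain n A q r (k + m) f) \<and>
           (\<forall>S\<in>cech_index n p. indet_prod S ^ m * e S - kdiff (k + m) f S \<in> B)"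
  shows "lc_vanish n A B p r"
  unfolding lc_vanish_def using assms by blast

lemma lc_vanishD:
  assumes "lc_vanish n A B p r" "cochain n A p r k e" "\<And>T. T \<in> cech_index n (Suc p) \<Longrightarrow> kdiff k e T \<in> B"
  shows "\<exists>m f. (\<forall>q. p = Suc q \<longrightarrow> cochain n A q r (k + m) f) \<and>
    (\<forall>S\<in>cech_index n p. indet_prod S ^ m * e S - kdiff (k + m) f S \<in> B)"
  using assms unfolding lc_vanish_def by blast

text \<open>There are no nonzero coboundaries for p = 0 and scaling by
  \<open>indet_prod {} ^ m\<close> is trivial, so what remains is H^0: classes of A/B killed by a
  power of every variable.\<close>

lemma lc_vanish_zero_iff:
  assumes "mpideal n B"
  shows "lc_vanish n A B 0 r \<longleftrightarrow>
    (\<forall>k. \<forall>e\<in>A \<inter> forms n r. (\<forall>j\<in>{1..n}. indet j ^ k * e \<in> B) \<longrightarrow> e \<in> B)"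
proof -
  have idx: "T \<in> cech_index n (Suc 0) \<longleftrightarrow> (\<exists>j\<in>{1..n}. T = {j})" for T
    by (auto simp: cech_index_def card_1_singleton_iff)
  have kd: "kdiff k e {j} = indet j ^ k * e {}" for k e and j :: nat
    by (simp add: kdiff_def)
  show ?thesis
  proof
    assume L: "lc_vanish n A B 0 r"
    show "\<forall>k. \<forall>e\<in>A \<inter> forms n r. (\<forall>j\<in>{1..n}. indet j ^ k * e \<in> B) \<longrightarrow> e \<in> B"
    proof (intro allI ballI impI)
      fix k e assume e: "e \<in> A \<inter> forms n r" "\<forall>j\<in>{1..n}. indet j ^ k * e \<in> B"
      have "cochain n A 0 r k (\<lambda>_. e)" using e by (simp add: cochain_def)
      moreover have "kdiff k (\<lambda>_. e) T \<in> B" if "T \<in> cech_index n (Suc 0)" for T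
        using that e kd[of k "\<lambda>_. e"] by (auto simp: idx)
      ultimately show "e \<in> B"
        using lc_vanishD[OF L, of k "\<lambda>_. e"] by (auto simp: indet_prod_def)
    qed
  next
    assume R: "\<forall>k. \<forall>e\<in>A \<inter> forms n r. (\<forall>j\<in>{1..n}. indet j ^ k * e \<in> B) \<longrightarrow> e \<in> B"
    show "lc_vanish n A B 0 r"
    proof (rule lc_vanishI)
      fix k e assume e: "cochain n A 0 r k e" "\<And>T. T \<in> cech_index n (Suc 0) \<Longrightarrow> kdiff k e T \<in> B"
      have "e {} \<in> A \<inter> forms n r" using e(1) by (simp add: cochain_def)
      moreover have "indet j ^ k * e {} \<in> B" if "j \<in> {1..n}" for j
        using e(2)[of "{j}"] that unfolding idx kd by blast
      ultimately have "e {} \<in> B" using R by blast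
      then show "\<exists>m f. (\<forall>q. 0 = Suc q \<longrightarrow> cochain n A q r (k + m) f) \<and>
           (\<forall>S\<in>cech_index n 0. indet_prod S ^ m * e S - kdiff (k + m) f S \<in> B)"
        by (auto simp: indet_prod_def)
    qed
  qed
qed

text \<open>The contracting homotopy of the Cech complex after multiplication by a power of \<open>x\<^sub>v\<close>.\<close>

lemma indet_power_coboundary:
  fixes e :: "nat set \<Rightarrow> 'k::field mpoly"
  assumes v: "v \<in> {1..n}" and B: "mpideal n B" and A: "mpideal n A"
    and e: "cochain n A (Suc p) r k e"
    and cyc: "\<And>T. T \<in> cech_index n (Suc (Suc p)) \<Longrightarrow> kdiff k e T \<in> B"
  shows "\<exists>f. cochain n A p (r + int k) k f \<and>
    (\<forall>S\<in>cech_index n (Suc p). indet v ^ k * e S - kdiff k f S \<in> B)"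
proof -
  \<comment> \<open>Contraction along v: for v in S the v-summand of \<open>kdiff k f S\<close>
    returns x_v^k e_S, and the other summands vanish because their index sets still contain v. The
    degree r + k accounts for f living on sets with one element less.\<close>
  define f where "f U = (if v \<in> U then 0 else csign (insert v U) v * e (insert v U))" for U
  have "cochain n A p (r + int k) k f"
    unfolding cochain_def
  proof
    fix U assume U: "U \<in> cech_index n p"
    show "f U \<in> A \<inter> forms n (r + int k + int k * int p)"
    proof (cases "v \<in> U")
      case False
      then have V: "insert v U \<in> cech_index n (Suc p)"
        using U v cech_index_finite[OF U] by (auto simp: cech_index_def)
      have "csign (insert v U) v * e (insert v U) \<in> forms n (r + int k + int k * int p)"
        by (rule forms_mult_eq[OF csign_forms cochainD(2)[OF e V]]) (simp add: algebra_simps)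
      moreover have "csign (insert v U) v * e (insert v U) \<in> A"
        by (rule mpideal_mult[OF A cochainD(1)[OF e V] forms_mpolys[OF csign_forms]])
      ultimately show ?thesis using False by (simp add: f_def)
    qed (simp add: f_def mpideal_zero[OF A])
  qed
  moreover have "indet v ^ k * e S - kdiff k f S \<in> B" if S: "S \<in> cech_index n (Suc p)" for S
  proof (cases "v \<in> S")
    case True
    have fS: "finite S" by (rule cech_index_finite[OF S])
    have "kdiff k f S = csign S v * (indet v ^ k * f (S - {v}))
        + (\<Sum>j\<in>S - {v}. csign S j * (indet j ^ k * f (S - {j})))"
      unfolding kdiff_def by (rule sum.remove[OF fS True])
    also have "(\<Sum>j\<in>S - {v}. csign S j * (indet j ^ k * f (S - {j}))) = 0"
      using True by (intro sum.neutral) (auto simp: f_def)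
    also have "f (S - {v}) = csign S v * e S"
      using True by (simp add: f_def insert_absorb)
    also have "csign S v * (indet v ^ k * (csign S v * e S)) + 0
        = (csign S v * csign S v) * (indet v ^ k * e S)"
      by (simp only: mult_ac add_0_right)
    finally have "kdiff k f S = indet v ^ k * e S" by simp
    then show ?thesis using B by (simp add: mpideal_zero)
  next
    case False
    \<comment> \<open>For v outside S the defect of the homotopy is the differential of e on
      \<open>T\<close>, up to sign, and that lies in B.\<close>
    define T where "T = insert v S"
    have T: "T \<in> cech_index n (Suc (Suc p))" and fT: "finite T"
      using S v cech_index_finite[OF S] False by (auto simp: T_def cech_index_def)
    have Tv: "T - {v} = S" using False by (auto simp: T_def)
    have "csign S j * (indet j ^ k * f (S - {j}))
        = - (csign T v * (csign T j * (indet j ^ k * e (T - {j}))))" if j: "j \<in> S" for j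
    proof -
      have jv: "j \<noteq> v" using j False by auto
      have ins: "insert v (S - {j}) = T - {j}" using jv by (auto simp: T_def)
      have "v \<in> T" "j \<in> T" using j by (auto simp: T_def)
      then have "(csign T j :: 'k mpoly) * csign (T - {j}) v = - (csign T v * csign S j)"
        using csign_antisym[OF fT, of v j] jv Tv by simp
      then have "(csign T j :: 'k mpoly) * (csign T j * csign (T - {j}) v)
          = - (csign T j * (csign T v * csign S j))"
        by simp
      then have "(csign (T - {j}) v :: 'k mpoly) = - (csign T j * csign T v * csign S j)"
        by (simp add: mult.assoc[symmetric])
      then have "(csign S j :: 'k mpoly) * csign (T - {j}) v = - (csign T j * csign T v) * (csign S j * csign S j)"
        by (simp only: mult_ac mult_minus_left mult_minus_right)
      then have "(csign S j :: 'k mpoly) * csign (T - {j}) v = - (csign T v * csign T j)"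
        by (simp add: mult_ac)
      moreover have "csign S j * (indet j ^ k * f (S - {j}))
          = (csign S j * csign (T - {j}) v) * (indet j ^ k * e (T - {j}))"
        using False by (simp add: f_def ins mult_ac)
      ultimately show ?thesis by (simp add: mult_ac)
    qed
    then have "kdiff k f S = - (csign T v * (\<Sum>j\<in>S. csign T j * (indet j ^ k * e (T - {j}))))"
      unfolding kdiff_def by (simp add: sum_distrib_left sum_negf)
    moreover have "kdiff k e T = csign T v * (indet v ^ k * e S)
        + (\<Sum>j\<in>S. csign T j * (indet j ^ k * e (T - {j})))"
    proof -
      have "v \<in> T" by (simp add: T_def)
      then show ?thesis unfolding kdiff_def by (simp only: sum.remove[OF fT] Tv)
    qed
    moreover have "csign T v * (csign T v * (indet v ^ k * e S)) = indet v ^ k * e S"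
      by (simp add: mult.assoc[symmetric])
    ultimately have "indet v ^ k * e S - kdiff k f S = csign T v * kdiff k e T"
      by (simp add: distrib_left)
    then show ?thesis
      using mpideal_mult[OF B cyc[OF T] forms_mpolys[OF csign_forms]] by simp
  qed
  ultimately show ?thesis by blast
qed


section \<open>Passing to the quotient by a filter-regular variable\<close>

text \<open>This is the vanishing of (J : x_v)/J in degree r; filter-regularity of x_v on R/J asks
  for it in all large degrees.\<close>

definition colon_stable :: "nat \<Rightarrow> 'k::field mpoly set \<Rightarrow> nat \<Rightarrow> int \<Rightarrow> bool" where
  "colon_stable n J v r \<longleftrightarrow> (\<forall>e\<in>forms n r. indet v * e \<in> J \<longrightarrow> e \<in> J)"

text \<open>Here \<open>J'\<close> is \<open>J + (x\<^sub>v)\<close>, and \<open>x\<^sub>v\<close> is filter-regular on the quotient by \<open>J\<close>.\<close>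

locale filter_regular_variable =
  fixes n v :: nat and J J' :: "'k::field mpoly set"
  assumes v: "v \<in> {1..n}"
    and J: "mpideal n J" and J': "mpideal n J'" and sub: "J \<subseteq> J'"
    and indet_mult_mem: "h \<in> mpolys n \<Longrightarrow> indet v * h \<in> J'"
    and split: "f \<in> J' \<Longrightarrow> f \<in> forms n d \<Longrightarrow> \<exists>h\<in>forms n (d - 1). f - indet v * h \<in> J"
    and eventually_stable: "\<exists>r0. \<forall>r\<ge>r0. colon_stable n J v r"
begin

abbreviation "R \<equiv> mpolys n :: 'k mpoly set"

lemma z_mpolys: "indet v \<in> mpolys n"
  using v by (intro forms_mpolys[OF indet_forms])

text \<open>An element killed by x_v modulo J lies in J once its degree reaches \<open>r0\<close>,
  and a power of \<open>indet_prod T\<close> raises the degree that far. The exponent N depends on d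
  only, so one N serves all components of a cochain.\<close>

lemma torsion:
  "\<exists>N. \<forall>T e. T \<subseteq> {1..n} \<longrightarrow> T \<noteq> {} \<longrightarrow> e \<in> forms n d \<longrightarrow> indet v * e \<in> J
    \<longrightarrow> indet_prod T ^ N * e \<in> J"
proof -
  obtain r0 where r0: "\<And>r. r \<ge> r0 \<Longrightarrow> colon_stable n J v r" using eventually_stable by blast
  define N where "N = nat (r0 - d)"
  show ?thesis
  proof (intro exI[of _ N] allI impI)
    fix T e assume T: "T \<subseteq> {1..n}" "T \<noteq> {}" and e: "e \<in> forms n d" "indet v * e \<in> J"
    have "finite T" using T(1) by (rule finite_subset) simp
    then have "1 \<le> int (card T)" using T(2) by (simp add: Suc_le_eq card_gt_0_iff)
    then have "int N * 1 \<le> int N * int (card T)" by (intro mult_left_mono) auto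
    moreover have "r0 \<le> int N + d" by (simp add: N_def)
    ultimately have deg: "r0 \<le> int N * int (card T) + d" by simp
    have f: "indet_prod T ^ N * e \<in> forms n (int N * int (card T) + d)"
      by (intro forms_mult indet_prod_power_forms T e)
    have "indet_prod T ^ N * (indet v * e) \<in> J"
      by (intro mpideal_mult[OF J] e forms_mpolys[OF indet_prod_power_forms[OF T(1)]])
    then have "indet v * (indet_prod T ^ N * e) \<in> J" by (simp add: mult_ac)
    then show "indet_prod T ^ N * e \<in> J" using r0[OF deg] f by (simp add: colon_stable_def)
  qed
qed

text \<open>What x_v kills is killed by powers of all variables, hence represents a class of
  H^0.\<close>

lemma lc_vanish_zero_imp_colon_stable:
  assumes "lc_vanish n R J 0 r"
  shows "colon_stable n J v r"
  unfolding colon_stable_def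
proof (intro ballI impI)
  fix e assume e: "e \<in> forms n r" "indet v * e \<in> J"
  obtain N where N: "\<And>T e. T \<subseteq> {1..n} \<Longrightarrow> T \<noteq> {} \<Longrightarrow> e \<in> forms n r \<Longrightarrow> indet v * e \<in> J
    \<Longrightarrow> indet_prod T ^ N * e \<in> J" using torsion[of r] by blast
  have "indet j ^ N * e \<in> J" if "j \<in> {1..n}" for j
    using N[of "{j}" e] e that by (simp add: indet_prod_def)
  then show "e \<in> J"
    using assms e(1) forms_mpolys[OF e(1)] unfolding lc_vanish_zero_iff[OF J] by blast
qed

text \<open>The factors of x_v^k are cancelled singly; the intermediate products have degrees r + i,
  whence the assumption on all \<open>s \<ge> r\<close>.\<close>

lemma colon_stable_imp_lc_vanish_zero:
  assumes "\<And>s. s \<ge> r \<Longrightarrow> colon_stable n J v s"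
  shows "lc_vanish n R J 0 r"
  unfolding lc_vanish_zero_iff[OF J]
proof (intro allI ballI impI)
  fix k e assume e: "e \<in> R \<inter> forms n r" and k: "\<forall>j\<in>{1..n}. indet j ^ k * e \<in> J"
  have "indet v ^ i * e \<in> J \<longrightarrow> e \<in> J" for i
  proof (induction i)
    case (Suc i)
    have "indet v ^ i * e \<in> forms n (int i + r)"
      using e v by (intro forms_mult indet_power_forms) auto
    moreover have "colon_stable n J v (int i + r)" by (rule assms) simp
    ultimately have "indet v ^ Suc i * e \<in> J \<longrightarrow> indet v ^ i * e \<in> J"
      by (simp add: colon_stable_def mult.assoc)
    with Suc show ?case by blast
  qed simp
  then show "e \<in> J" using k v by blast
qed

text \<open>The part H^p(R/J)_r -> H^p(R/J')_r -> H^(p+1)(R/J)_(r-1) of the long exact sequence, as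
  a chase on numerators: lift a cocycle, divide its differential by x_v, bound the result, and
  correct the lift.\<close>

lemma lc_vanish_quotient:
  assumes H0: "lc_vanish n R J p r" and H1: "lc_vanish n R J (Suc p) (r - 1)"
  shows "lc_vanish n R J' p r"
proof (rule lc_vanishI)
  fix k e
  assume e: "cochain n R p r k e"
    and cyc: "\<And>T. T \<in> cech_index n (Suc p) \<Longrightarrow> kdiff k e T \<in> J'"
  let ?z = "indet v"
  have "\<forall>T\<in>cech_index n (Suc p). \<exists>g. g \<in> forms n (r + int k * int (Suc p) - 1) \<and> kdiff k e T - ?z * g \<in> J"
    using split[OF cyc kdiff_forms[OF e]] by blast
  then obtain g where g: "\<And>T. T \<in> cech_index n (Suc p) \<Longrightarrow> g T \<in> forms n (r + int k * int (Suc p) - 1)"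
    and gJ: "\<And>T. T \<in> cech_index n (Suc p) \<Longrightarrow> kdiff k e T - ?z * g T \<in> J"
    by metis
  have cg: "cochain n R (Suc p) (r - 1) k g"
    unfolding cochain_def using g forms_mpolys[OF g] by (simp add: algebra_simps)
  let ?d = "r - 1 + int k * int (Suc (Suc p))"
  obtain N where N: "\<And>T e. T \<subseteq> {1..n} \<Longrightarrow> T \<noteq> {} \<Longrightarrow> e \<in> forms n ?d \<Longrightarrow> ?z * e \<in> J
    \<Longrightarrow> indet_prod T ^ N * e \<in> J" using torsion[of ?d] by blast
  define g' where "g' T = indet_prod T ^ N * g T" for T
  have cg': "cochain n R (Suc p) (r - 1) (k + N) g'"
    unfolding g'_def by (rule cochain_scale[OF mpideal_top cg])
  have "kdiff (k + N) g' W \<in> J" if W: "W \<in> cech_index n (Suc (Suc p))" for W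
  proof -
    have fW: "finite W" by (rule cech_index_finite[OF W])
    \<comment> \<open>As d(d(e)) = 0, this puts x_v d(g) into J, not yet d(g) itself;
      \<open>torsion\<close> supplies the exponent N that removes x_v, which is why g was replaced
      by \<open>g'\<close>.\<close>
    have "kdiff k (\<lambda>T. kdiff k e T - ?z * g T) W \<in> J"
      by (intro kdiff_mpideal[OF J] cech_index_subset[OF W] gJ cech_index_remove[OF W])
    then have "?z * kdiff k g W \<in> J"
      using mpideal_uminus[OF J] by (fastforce simp: kdiff_diff kdiff_mult kdiff_kdiff[OF fW])
    moreover have "kdiff k g W \<in> forms n ?d" by (rule kdiff_forms[OF cg W])
    ultimately have "indet_prod W ^ N * kdiff k g W \<in> J"
      by (intro N cech_index_subset[OF W] cech_index_Suc_nonempty[OF W])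
    then show ?thesis unfolding g'_def by (simp add: kdiff_scale[OF fW])
  qed
  with lc_vanishD[OF H1 cg'] obtain m f where f: "\<And>q. Suc p = Suc q \<Longrightarrow> cochain n R q (r - 1) (k + N + m) f"
    and fJ: "\<And>T. T \<in> cech_index n (Suc p) \<Longrightarrow> indet_prod T ^ m * g' T - kdiff (k + N + m) f T \<in> J"
    by blast
  have cf: "cochain n R p (r - 1) (k + N + m) f" using f by blast
  define K where "K = k + N + m"
  \<comment> \<open>The corrected lift: modulo J its differential is zero, while modulo J' it still
    represents the class of e.\<close>
  define e' where "e' S = indet_prod S ^ (N + m) * e S - ?z * f S" for S
  have "cochain n R p (r - 1 + 1) K (\<lambda>S. ?z * f S)"
    unfolding K_def using v by (intro cochain_mult[OF mpideal_top cf] indet_forms)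
  moreover have "cochain n R p r K (\<lambda>S. indet_prod S ^ (N + m) * e S)"
    using cochain_scale[OF mpideal_top e, of "N + m"] by (simp add: K_def add.assoc)
  ultimately have ce': "cochain n R p r K e'"
    unfolding e'_def by (intro cochain_diff[OF mpideal_top]) auto
  have "kdiff K e' T \<in> J" if T: "T \<in> cech_index n (Suc p)" for T
  proof -
    have fT: "finite T" by (rule cech_index_finite[OF T])
    have "kdiff K (\<lambda>S. indet_prod S ^ (N + m) * e S) T = indet_prod T ^ (N + m) * kdiff k e T"
      using kdiff_scale[OF fT, of k "N + m"] by (simp add: K_def add.assoc)
    then have "kdiff K e' T = indet_prod T ^ (N + m) * kdiff k e T - ?z * kdiff K f T"
      unfolding e'_def by (simp add: kdiff_diff kdiff_mult)
    also have "\<dots> = indet_prod T ^ (N + m) * (kdiff k e T - ?z * g T)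
        + ?z * (indet_prod T ^ m * g' T - kdiff K f T)"
      by (simp add: g'_def power_add algebra_simps)
    also have "\<dots> \<in> J"
      using fJ[OF T] gJ[OF T] unfolding K_def
      by (intro mpideal_add[OF J] mpideal_mult[OF J] z_mpolys
          forms_mpolys[OF indet_prod_power_forms[OF cech_index_subset[OF T]]])
    finally show ?thesis .
  qed
  with lc_vanishD[OF H0 ce'] obtain m' h where h: "\<And>q. p = Suc q \<Longrightarrow> cochain n R q r (K + m') h"
    and hJ: "\<And>S. S \<in> cech_index n p \<Longrightarrow> indet_prod S ^ m' * e' S - kdiff (K + m') h S \<in> J"
    by blast
  have eqK: "k + (N + m + m') = K + m'" by (simp add: K_def)
  have "indet_prod S ^ (N + m + m') * e S - kdiff (K + m') h S \<in> J'" if S: "S \<in> cech_index n p" for S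
  proof -
    have "indet_prod S ^ (N + m + m') * e S - kdiff (K + m') h S
      = (indet_prod S ^ m' * e' S - kdiff (K + m') h S) + ?z * (indet_prod S ^ m' * f S)"
      by (simp add: e'_def power_add algebra_simps)
    also have "\<dots> \<in> J'"
    proof (rule mpideal_add[OF J'])
      show "?z * (indet_prod S ^ m' * f S) \<in> J'"
        by (intro indet_mult_mem mpolys_mult cochainD(1)[OF cf S]
            forms_mpolys[OF indet_prod_power_forms[OF cech_index_subset[OF S]]])
    qed (use hJ[OF S] sub in blast)
    finally show ?thesis .
  qed
  then show "\<exists>m f. (\<forall>q. p = Suc q \<longrightarrow> cochain n R q r (k + m) f) \<and>
           (\<forall>S\<in>cech_index n p. indet_prod S ^ m * e S - kdiff (k + m) f S \<in> J')"
    using h by (intro exI[of _ "N + m + m'"] exI[of _ h]) (auto simp only: eqK)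
qed

text \<open>The vanishing of \<open>H^p\<close> of the quotient by \<open>J'\<close> makes \<open>x\<^sub>v\<close> injective on \<open>H^(p+1)\<close> of the
  quotient by \<open>J\<close>.\<close>

lemma indet_cancel_coboundary:
  assumes H: "lc_vanish n R J' p (r + 1)"
    and e: "cochain n R (Suc p) r k e"
    and f: "cochain n R p (r + 1) k f"
    and ef: "\<And>T. T \<in> cech_index n (Suc p) \<Longrightarrow> indet v * e T - kdiff k f T \<in> J"
  shows "\<exists>m g. cochain n R p r (k + m) g \<and>
    (\<forall>T\<in>cech_index n (Suc p). indet_prod T ^ m * e T - kdiff (k + m) g T \<in> J)"
proof -
  let ?z = "indet v"
  \<comment> \<open>Modulo J' the products x_v e_T vanish, which makes f a cocycle there.\<close>
  have "kdiff k f T \<in> J'" if T: "T \<in> cech_index n (Suc p)" for T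
    using mpideal_cong[OF J', of "?z * e T" "kdiff k f T"] sub ef[OF T]
      indet_mult_mem[OF cochainD(1)[OF e T]] by blast
  with lc_vanishD[OF H f] obtain m h where h: "\<And>q. p = Suc q \<Longrightarrow> cochain n R q (r + 1) (k + m) h"
    and hJ: "\<And>S. S \<in> cech_index n p \<Longrightarrow> indet_prod S ^ m * f S - kdiff (k + m) h S \<in> J'"
    by blast
  let ?K = "k + m"
  let ?d = "r + 1 + int ?K * int p"
  have cf': "cochain n R p (r + 1) ?K (\<lambda>S. indet_prod S ^ m * f S)"
    by (rule cochain_scale[OF mpideal_top f])
  have ch: "cochain n R p (r + 1) ?K (kdiff ?K h)"
  proof (cases p)
    case 0
    then show ?thesis by (simp add: cochain_def)
  next
    case (Suc q)
    show ?thesis using cochain_kdiff[OF mpideal_top h[OF Suc]] Suc by simp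
  qed
  \<comment> \<open>After subtracting a coboundary, f is x_v g modulo J. Then x_v kills e - d(g),
    suitably scaled, and \<open>torsion\<close> removes the factor x_v.\<close>
  have "\<forall>S\<in>cech_index n p. \<exists>g. g \<in> forms n (?d - 1) \<and>
      indet_prod S ^ m * f S - kdiff ?K h S - ?z * g \<in> J"
    using split[OF hJ cochainD(2)[OF cochain_diff[OF mpideal_top cf' ch]]] by blast
  then obtain g where g: "\<And>S. S \<in> cech_index n p \<Longrightarrow> g S \<in> forms n (?d - 1)"
    and gJ: "\<And>S. S \<in> cech_index n p \<Longrightarrow> indet_prod S ^ m * f S - kdiff ?K h S - ?z * g S \<in> J"
    by metis
  have cg: "cochain n R p r ?K g"
    unfolding cochain_def using g forms_mpolys[OF g] by (simp add: algebra_simps)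
  have ce': "cochain n R (Suc p) r ?K (\<lambda>T. indet_prod T ^ m * e T - kdiff ?K g T)"
    by (intro cochain_diff cochain_scale cochain_kdiff mpideal_top e cg)
  obtain N where N: "\<And>T e. T \<subseteq> {1..n} \<Longrightarrow> T \<noteq> {} \<Longrightarrow> e \<in> forms n (r + int ?K * int (Suc p))
    \<Longrightarrow> ?z * e \<in> J \<Longrightarrow> indet_prod T ^ N * e \<in> J"
    using torsion[of "r + int ?K * int (Suc p)"] by blast
  show ?thesis
  proof (intro exI[of _ "m + N"] exI[of _ "\<lambda>S. indet_prod S ^ N * g S"] conjI ballI)
    show "cochain n R p r (k + (m + N)) (\<lambda>S. indet_prod S ^ N * g S)"
      using cochain_scale[OF mpideal_top cg, of N] by (simp add: add.assoc)
    fix T assume T: "T \<in> cech_index n (Suc p)"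
    have fT: "finite T" by (rule cech_index_finite[OF T])
    have "kdiff ?K (\<lambda>S. indet_prod S ^ m * f S - kdiff ?K h S - ?z * g S) T \<in> J"
      by (intro kdiff_mpideal[OF J] cech_index_subset[OF T] gJ cech_index_remove[OF T])
    then have a: "indet_prod T ^ m * kdiff k f T - ?z * kdiff ?K g T \<in> J"
      by (simp add: kdiff_diff kdiff_mult kdiff_kdiff[OF fT] kdiff_scale[OF fT])
    have b: "indet_prod T ^ m * (?z * e T - kdiff k f T) \<in> J"
      by (intro mpideal_mult[OF J] ef T forms_mpolys[OF indet_prod_power_forms[OF cech_index_subset[OF T]]])
    have "?z * (indet_prod T ^ m * e T - kdiff ?K g T) \<in> J"
      using mpideal_add[OF J a b] by (simp add: algebra_simps)
    then have "indet_prod T ^ N * (indet_prod T ^ m * e T - kdiff ?K g T) \<in> J"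
      by (intro N cech_index_subset[OF T] cech_index_Suc_nonempty[OF T] cochainD(2)[OF ce' T])
    moreover have "kdiff (k + (m + N)) (\<lambda>S. indet_prod S ^ N * g S) T = indet_prod T ^ N * kdiff ?K g T"
      using kdiff_scale[OF fT, of ?K N] by (simp add: add.assoc)
    ultimately show "indet_prod T ^ (m + N) * e T - kdiff (k + (m + N)) (\<lambda>S. indet_prod S ^ N * g S) T \<in> J"
      by (simp add: power_add algebra_simps)
  qed
qed

text \<open>One factor is cancelled at a time. The step from x_v^(i+1) to x_v^i concerns the class
  of x_v^i e in degree r + i and consumes the vanishing for J' in degree r + i + 1; the denominator
  grows on the way, so k, e and f vary in the induction.\<close>

lemma indet_power_cancel_coboundary:
  assumes H: "\<And>s. s \<ge> r \<Longrightarrow> lc_vanish n R J' p (s + 1)"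
    and e: "cochain n R (Suc p) r k e"
    and f: "cochain n R p (r + int i) k f"
    and ef: "\<And>T. T \<in> cech_index n (Suc p) \<Longrightarrow> indet v ^ i * e T - kdiff k f T \<in> J"
  shows "\<exists>m g. cochain n R p r (k + m) g \<and>
    (\<forall>T\<in>cech_index n (Suc p). indet_prod T ^ m * e T - kdiff (k + m) g T \<in> J)"
  using e f ef
proof (induction i arbitrary: k e f)
  case 0
  then show ?case by (intro exI[of _ "0::nat"] exI[of _ f]) simp
next
  case (Suc i)
  have ce: "cochain n R (Suc p) (r + int i) k (\<lambda>T. indet v ^ i * e T)"
    using v by (intro cochain_mult[OF mpideal_top Suc.prems(1)] indet_power_forms)
  have cf: "cochain n R p (r + int i + 1) k f" using Suc.prems(2) by (simp add: algebra_simps)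
  have ef: "indet v * (indet v ^ i * e T) - kdiff k f T \<in> J" if "T \<in> cech_index n (Suc p)" for T
    using Suc.prems(3)[OF that] by (simp add: mult.assoc)
  have "lc_vanish n R J' p (r + int i + 1)" by (rule H) simp
  from indet_cancel_coboundary[OF this ce cf ef] obtain m g where g: "cochain n R p (r + int i) (k + m) g"
    and gJ: "\<And>T. T \<in> cech_index n (Suc p) \<Longrightarrow> indet_prod T ^ m * (indet v ^ i * e T) - kdiff (k + m) g T \<in> J"
    by blast
  have "\<exists>m' g. cochain n R p r (k + m + m') g \<and>
    (\<forall>T\<in>cech_index n (Suc p). indet_prod T ^ m' * (indet_prod T ^ m * e T) - kdiff (k + m + m') g T \<in> J)"
    using g gJ by (intro Suc.IH cochain_scale mpideal_top Suc.prems) (auto simp: mult_ac)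
  then obtain m' g' where "cochain n R p r (k + (m + m')) g'"
    "\<forall>T\<in>cech_index n (Suc p). indet_prod T ^ (m + m') * e T - kdiff (k + (m + m')) g' T \<in> J"
    by (auto simp: power_add mult_ac add.assoc)
  then show ?case by blast
qed

text \<open>Every class of positive cohomological degree is killed by x_v^k, with k its denominator
  exponent, and x_v acts injectively in all degrees from r on.\<close>

lemma lc_vanish_Suc:
  assumes H: "\<And>s. s \<ge> r \<Longrightarrow> lc_vanish n R J' p (s + 1)"
  shows "lc_vanish n R J (Suc p) r"
proof (rule lc_vanishI)
  fix k e
  assume e: "cochain n R (Suc p) r k e"
    and cyc: "\<And>T. T \<in> cech_index n (Suc (Suc p)) \<Longrightarrow> kdiff k e T \<in> J"
  obtain f where "cochain n R p (r + int k) k f"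
    "\<And>S. S \<in> cech_index n (Suc p) \<Longrightarrow> indet v ^ k * e S - kdiff k f S \<in> J"
    using indet_power_coboundary[OF v J mpideal_top e cyc] by blast
  then show "\<exists>m f. (\<forall>q. Suc p = Suc q \<longrightarrow> cochain n R q r (k + m) f) \<and>
           (\<forall>S\<in>cech_index n (Suc p). indet_prod S ^ m * e S - kdiff (k + m) f S \<in> J)"
    using indet_power_cancel_coboundary[OF H e] by auto
qed

end


section \<open>Local cohomology in terms of a filter-regular sequence of variables\<close>

text \<open>The ideal \<open>I + (x\<^sub>n, \<dots>, x\<^bsub>n-i+1\<^esub>)\<close>.\<close>

definition add_vars :: "nat \<Rightarrow> 'k::field mpoly set \<Rightarrow> nat \<Rightarrow> 'k mpoly set" where
  "add_vars n I i = {f \<in> mpolys n. \<exists>g\<in>I. \<forall>m\<in>Poly_Mapping.keys (f - g).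
     \<exists>v\<in>{n - i<..n}. Poly_Mapping.lookup m v > 0}"

lemma add_vars_zero [simp]:
  assumes "mpideal n I"
  shows "add_vars n I 0 = I"
proof -
  have "f = g" if "Poly_Mapping.keys (f - g) = {}" for f g :: "'a mpoly"
    using that by (metis keys_eq_empty right_minus_eq)
  then show ?thesis
    using assms by (auto simp: add_vars_def mpideal_mpolys)
qed

lemma add_vars_mpideal:
  assumes I: "mpideal n I"
  shows "mpideal n (add_vars n I i)"
  unfolding mpideal_def
proof (intro conjI ballI)
  show "add_vars n I i \<subseteq> mpolys n" by (auto simp: add_vars_def)
  show "0 \<in> add_vars n I i" using mpideal_zero[OF I] by (auto simp: add_vars_def intro!: bexI[of _ 0])
  let ?P = "\<lambda>m. \<exists>v\<in>{n - i<..n}. Poly_Mapping.lookup m v > 0"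
  fix f assume "f \<in> add_vars n I i"
  then obtain f' where f: "f \<in> mpolys n" "f' \<in> I" "\<And>m. m \<in> Poly_Mapping.keys (f - f') \<Longrightarrow> ?P m"
    by (auto simp: add_vars_def)
  {
    fix g assume "g \<in> add_vars n I i"
    then obtain g' where g: "g \<in> mpolys n" "g' \<in> I" "\<And>m. m \<in> Poly_Mapping.keys (g - g') \<Longrightarrow> ?P m"
      by (auto simp: add_vars_def)
    have "(f + g) - (f' + g') = (f - f') + (g - g')" by simp
    then have "Poly_Mapping.keys ((f + g) - (f' + g')) \<subseteq> Poly_Mapping.keys (f - f') \<union> Poly_Mapping.keys (g - g')"
      by (simp only: Poly_Mapping.keys_add)
    then have "\<forall>m\<in>Poly_Mapping.keys ((f + g) - (f' + g')). ?P m"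
      using f(3) g(3) by blast
    then show "f + g \<in> add_vars n I i"
      using mpideal_add[OF I f(2) g(2)] mpolys_add[OF f(1) g(1)] unfolding add_vars_def by blast
  next
    fix a :: "'a mpoly" assume a: "a \<in> mpolys n"
    have "?P m" if "m \<in> Poly_Mapping.keys (a * f - a * f')" for m
    proof -
      have "m \<in> Poly_Mapping.keys (a * (f - f'))" using that by (simp add: algebra_simps)
      then obtain u w where "w \<in> Poly_Mapping.keys (f - f')" "m = u + w"
        using keys_mult by blast
      then show ?thesis using f(3)[of w] by (auto simp: lookup_add)
    qed
    then show "a * f \<in> add_vars n I i"
      using mpideal_mult[OF I f(2) a] mpolys_mult[OF a f(1)] unfolding add_vars_def by blast
  }
qed

lemma add_vars_mono: "i \<le> j \<Longrightarrow> add_vars n I i \<subseteq> add_vars n I j"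
  unfolding add_vars_def by fastforce

lemma subset_add_vars: "mpideal n I \<Longrightarrow> I \<subseteq> add_vars n I i"
  using add_vars_mono[of 0 i n I] by simp

lemma mem_add_vars_of_keys:
  assumes "mpideal n I" "f \<in> mpolys n"
    "\<And>m. m \<in> Poly_Mapping.keys f \<Longrightarrow> \<exists>v\<in>{n - i<..n}. Poly_Mapping.lookup m v > 0"
  shows "f \<in> add_vars n I i"
proof -
  have "\<forall>m\<in>Poly_Mapping.keys (f - 0). \<exists>v\<in>{n - i<..n}. Poly_Mapping.lookup m v > 0"
    using assms(3) by simp
  then show ?thesis unfolding add_vars_def using assms(2) mpideal_zero[OF assms(1)] by blast
qed

text \<open>After passing to the degree d part of the representative in I, the monomials of the
  difference that involve x_(n-i) are collected in \<open>u\<close> and divided by it; the others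
  involve one of the later variables.\<close>

lemma add_vars_Suc_split:
  assumes I: "graded_ideal n I" and i: "i < n"
    and f: "f \<in> add_vars n I (Suc i)" "f \<in> forms n d"
  shows "\<exists>h\<in>forms n (d - 1). f - indet (n - i) * h \<in> add_vars n I i"
proof -
  let ?v = "n - i"
  have iv: "{n - Suc i<..n} = insert ?v {n - i<..n}" using i by auto
  obtain g where g: "g \<in> I"
    and fg: "\<And>m. m \<in> Poly_Mapping.keys (f - g) \<Longrightarrow> \<exists>v\<in>{n - Suc i<..n}. Poly_Mapping.lookup m v > 0"
    using f(1) by (auto simp: add_vars_def)
  define g' where "g' = hpart d g"
  have g': "g' \<in> I" using graded_ideal_hpart[OF I g] by (simp add: g'_def)
  have gm: "g' \<in> forms n d"
    unfolding g'_def using mpideal_mpolys[OF graded_ideal_mpideal[OF I] g] by (rule hpart_forms)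
  have eq: "f - g' = hpart d (f - g)"
    using hpart_eq_self[OF f(2)] by (simp add: part_diff g'_def)
  define u where "u = part (\<lambda>m. Poly_Mapping.lookup m ?v > 0) (f - g')"
  have u: "u \<in> forms n d" unfolding u_def by (intro part_forms forms_diff f(2) gm)
  obtain h where h: "h \<in> mpolys n" "u = indet ?v * h"
    by (rule indet_dvdE[OF forms_mpolys[OF u], of ?v]) (auto simp: u_def)
  have hf: "h \<in> forms n (d - 1)" using u h by (auto intro: forms_indet_cancel)
  have um: "f - u \<in> mpolys n" by (intro mpolys_diff forms_mpolys[OF f(2)] forms_mpolys[OF u])
  have "\<exists>v\<in>{n - i<..n}. Poly_Mapping.lookup m v > 0" if "m \<in> Poly_Mapping.keys (f - u - g')" for m
  proof -
    have "Poly_Mapping.lookup (f - u - g') m = Poly_Mapping.lookup (f - g') m - Poly_Mapping.lookup u m"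
      by (simp add: lookup_minus)
    then have "m \<in> Poly_Mapping.keys (f - g')" "\<not> Poly_Mapping.lookup m ?v > 0"
      using that by (auto simp: in_keys_iff u_def lookup_part split: if_splits)
    then show ?thesis using fg[of m] unfolding eq iv by auto
  qed
  then have "f - u \<in> add_vars n I i"
    unfolding add_vars_def using um g' by blast
  with hf h(2) show ?thesis by auto
qed

lemma filter_regular_variable_add_vars:
  assumes I: "graded_ideal n I" and i: "i < n"
    and "\<exists>r0. \<forall>r\<ge>r0. colon_stable n (add_vars n I i) (n - i) r"
  shows "filter_regular_variable n (n - i) (add_vars n I i) (add_vars n I (Suc i))"
proof
  have I': "mpideal n I" using I by (rule graded_ideal_mpideal)
  show "n - i \<in> {1..n}" using i by auto
  show "mpideal n (add_vars n I i)" "mpideal n (add_vars n I (Suc i))"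
    by (rule add_vars_mpideal[OF I'])+
  show "add_vars n I i \<subseteq> add_vars n I (Suc i)" by (rule add_vars_mono) simp
  fix h :: "'a mpoly" assume "h \<in> mpolys n"
  then show "indet (n - i) * h \<in> add_vars n I (Suc i)"
    using i by (intro mem_add_vars_of_keys[OF I'] mpolys_mult forms_mpolys[OF indet_forms])
      (auto simp: keys_indet_mult lookup_add intro!: bexI[of _ "n - i"])
qed (use assms add_vars_Suc_split[OF I i] in auto)

text \<open>
  With \<open>c = 1\<close> the left-hand side bounds the partial regularity, and with \<open>c = 0\<close> the maximum of
  the \<open>a\<close>-invariants.
\<close>

lemma lc_vanish_iff_colon_stable:
  fixes c \<rho> :: int
  assumes I: "graded_ideal n I" and c: "0 \<le> c" "c \<le> 1"
    and "j + t \<le> n"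
    and "\<And>i. i < t \<Longrightarrow> \<exists>r0. \<forall>r\<ge>r0. colon_stable n (add_vars n I (j + i)) (n - (j + i)) r"
  shows "(\<forall>q<t. \<forall>r. \<rho> < r + c * int q \<longrightarrow> lc_vanish n (mpolys n) (add_vars n I j) q r) \<longleftrightarrow>
    (\<forall>i<t. \<forall>r. \<rho> < r - (1 - c) * int i \<longrightarrow> colon_stable n (add_vars n I (j + i)) (n - (j + i)) r)"
  using assms(4,5)
proof (induction t arbitrary: j \<rho>)
  case (Suc t)
  let ?J = "add_vars n I"
  let ?V = "\<lambda>j. lc_vanish n (mpolys n) (?J j)"
  let ?Q = "\<lambda>i. colon_stable n (?J i) (n - i)"
  interpret filter_regular_variable n "n - j" "?J j" "?J (Suc j)"
    using Suc.prems(1) Suc.prems(2)[of 0] by (intro filter_regular_variable_add_vars[OF I]) auto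
  \<comment> \<open>The index \<open>j\<close> and the threshold vary in the induction: the next
    ideal of the chain is taken with \<open>\<rho> + (1 - c)\<close>.\<close>
  have IH: "(\<forall>q<t. \<forall>r. \<rho> + (1 - c) < r + c * int q \<longrightarrow> ?V (Suc j) q r) \<longleftrightarrow>
    (\<forall>i<t. \<forall>r. \<rho> + (1 - c) < r - (1 - c) * int i \<longrightarrow> ?Q (Suc j + i) r)"
    using Suc.prems(1) Suc.prems(2)[of "Suc i" for i] by (intro Suc.IH) auto
  have R: "(\<forall>i<Suc t. \<forall>r. \<rho> < r - (1 - c) * int i \<longrightarrow> ?Q (j + i) r) \<longleftrightarrow>
    (\<forall>r>\<rho>. ?Q j r) \<and> (\<forall>i<t. \<forall>r. \<rho> + (1 - c) < r - (1 - c) * int i \<longrightarrow> ?Q (Suc j + i) r)"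
    unfolding All_less_Suc2 by (simp add: algebra_simps)
  have L: "(\<forall>q<Suc t. \<forall>r. \<rho> < r + c * int q \<longrightarrow> ?V j q r) \<longleftrightarrow>
    (\<forall>r>\<rho>. ?V j 0 r) \<and> (\<forall>q<t. \<forall>r. \<rho> < r + c * int (Suc q) \<longrightarrow> ?V j (Suc q) r)"
    unfolding All_less_Suc2 by simp
  show ?case
    unfolding R IH[symmetric]
  proof
    assume *: "\<forall>q<Suc t. \<forall>r. \<rho> < r + c * int q \<longrightarrow> ?V j q r"
    have "?Q j r" if "\<rho> < r" for r
      using * that by (intro lc_vanish_zero_imp_colon_stable) auto
    \<comment> \<open>The two inputs sit at (q, r) and (q + 1, r - 1). If r + c q > \<rho> + 1 - c,
      both lie above the line for \<rho>; for the first this uses c <= 1.\<close>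
    moreover have "?V (Suc j) q r" if "q < t" "\<rho> + (1 - c) < r + c * int q" for q r
      using * that c by (intro lc_vanish_quotient) (auto simp: algebra_simps)
    ultimately show "(\<forall>r>\<rho>. ?Q j r) \<and> (\<forall>q<t. \<forall>r. \<rho> + (1 - c) < r + c * int q \<longrightarrow> ?V (Suc j) q r)"
      by blast
  next
    assume *: "(\<forall>r>\<rho>. ?Q j r) \<and> (\<forall>q<t. \<forall>r. \<rho> + (1 - c) < r + c * int q \<longrightarrow> ?V (Suc j) q r)"
    have "?V j 0 r" if "\<rho> < r" for r
      using * that by (intro colon_stable_imp_lc_vanish_zero) auto
    \<comment> \<open>Vanishing for the next ideal is asked at (q, s + 1) for s >= r, and s + 1 + c
      q > \<rho> + 1 - c just says s + c (q + 1) > \<rho>.\<close>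
    moreover have "?V j (Suc q) r" if "q < t" "\<rho> < r + c * int (Suc q)" for q r
      using * that by (intro lc_vanish_Suc) (auto simp: algebra_simps)
    ultimately show "\<forall>q<Suc t. \<forall>r. \<rho> < r + c * int q \<longrightarrow> ?V j q r"
      unfolding L by blast
  qed
qed simp

section \<open>The polynomial ring, and the passage from I to R/I\<close>

lemma graded_ideal_bot: "graded_ideal n {0}"
  by (simp add: graded_ideal_def mpideal_bot)

text \<open>The variable x_(n-i) is not among the later ones, so multiplying by it cannot bring a
  later variable into a monomial: the variables form a regular sequence.\<close>

lemma colon_stable_bot:
  assumes "i < n"
  shows "colon_stable n (add_vars n {0} i) (n - i) r"
  unfolding colon_stable_def
proof (intro ballI impI)
  fix e :: "'a mpoly" assume e: "e \<in> forms n r" "indet (n - i) * e \<in> add_vars n {0} i"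
  show "e \<in> add_vars n {0} i"
  proof (rule mem_add_vars_of_keys[OF mpideal_bot forms_mpolys[OF e(1)]])
    fix m assume "m \<in> Poly_Mapping.keys e"
    then have "Poly_Mapping.single (n - i) 1 + m \<in> Poly_Mapping.keys (indet (n - i) * e)"
      by (simp add: keys_indet_mult)
    then obtain v where "v \<in> {n - i<..n}" "Poly_Mapping.lookup (Poly_Mapping.single (n - i) 1 + m) v > 0"
      using e(2) by (auto simp: add_vars_def)
    then show "\<exists>v\<in>{n - i<..n}. Poly_Mapping.lookup m v > 0"
      by (intro bexI[of _ v]) (auto simp: lookup_add lookup_single)
  qed
qed

text \<open>For I = 0 every colon condition holds in all degrees, so the criterion with c = 0 and
  threshold r - 1 covers degree r.\<close>

lemma lc_vanish_poly_ring:
  assumes "q < n"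
  shows "lc_vanish n (mpolys n) {0 :: 'k::field mpoly} q r"
proof -
  have "\<forall>q<n. \<forall>s. r - 1 < s + 0 * int q \<longrightarrow> lc_vanish n (mpolys n) (add_vars n {0 :: 'k mpoly} 0) q s"
    by (subst lc_vanish_iff_colon_stable[OF graded_ideal_bot]) (auto simp: colon_stable_bot)
  then show ?thesis using assms by (simp add: mpideal_bot)
qed

text \<open>R is a domain, and for n >= 1 there is a variable to cancel.\<close>

lemma lc_vanish_ideal_zero:
  assumes "n \<ge> 1"
  shows "lc_vanish n A {0} 0 r"
  unfolding lc_vanish_zero_iff[OF mpideal_bot] using assms by force

text \<open>Connecting homomorphism of \<open>0 \<rightarrow> I \<rightarrow> R \<rightarrow> R/I \<rightarrow> 0\<close> below the top cohomological degree.\<close>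

lemma lc_vanish_ideal_Suc_iff:
  assumes I: "mpideal n I" and q: "Suc q < n"
  shows "lc_vanish n I {0} (Suc q) r \<longleftrightarrow> lc_vanish n (mpolys n) I q r"
proof
  assume H: "lc_vanish n (mpolys n) I q r"
  show "lc_vanish n I {0} (Suc q) r"
  proof (rule lc_vanishI)
    fix k e assume e: "cochain n I (Suc q) r k e"
      and cyc: "\<And>T. T \<in> cech_index n (Suc (Suc q)) \<Longrightarrow> kdiff k e T \<in> {0}"
    have eR: "cochain n (mpolys n) (Suc q) r k e"
      using mpideal_mpolys[OF I] by (intro cochain_mono[OF _ e]) auto
    \<comment> \<open>Over R the cocycle bounds, as H^(q+1)(R) = 0. Its primitive f need not lie in
      I but is a cocycle modulo I, and the vanishing of H^q(R/I) moves it into I by a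
      coboundary.\<close>
    from lc_vanishD[OF lc_vanish_poly_ring[OF q] eR cyc] obtain m f
      where f: "cochain n (mpolys n) q r (k + m) f"
        and fe: "\<And>S. S \<in> cech_index n (Suc q) \<Longrightarrow> indet_prod S ^ m * e S = kdiff (k + m) f S"
      by auto
    have "kdiff (k + m) f S \<in> I" if S: "S \<in> cech_index n (Suc q)" for S
      using mpideal_mult[OF I cochainD(1)[OF e S]
          forms_mpolys[OF indet_prod_power_forms[OF cech_index_subset[OF S]]]] fe[OF S] by metis
    from lc_vanishD[OF H f this] obtain m' h
      where h: "\<And>p. q = Suc p \<Longrightarrow> cochain n (mpolys n) p r (k + m + m') h"
        and hf: "\<And>U. U \<in> cech_index n q \<Longrightarrow> indet_prod U ^ m' * f U - kdiff (k + m + m') h U \<in> I"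
      by blast
    define f' where "f' U = indet_prod U ^ m' * f U - kdiff (k + m + m') h U" for U
    have "cochain n (mpolys n) q r (k + m + m') (kdiff (k + m + m') h)"
    proof (cases q)
      case 0
      then show ?thesis by (simp add: cochain_def)
    next
      case (Suc p)
      show ?thesis using cochain_kdiff[OF mpideal_top h[OF Suc]] Suc by simp
    qed
    then have "cochain n (mpolys n) q r (k + m + m') f'"
      unfolding f'_def by (intro cochain_diff[OF mpideal_top] cochain_scale[OF mpideal_top f])
    then have cf': "cochain n I q r (k + (m + m')) f'"
      using hf by (auto simp: cochain_def f'_def add.assoc)
    have "indet_prod S ^ (m + m') * e S = kdiff (k + (m + m')) f' S" if S: "S \<in> cech_index n (Suc q)" for S
    proof -
      have fS: "finite S" by (rule cech_index_finite[OF S])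
      have "kdiff (k + m + m') f' S = indet_prod S ^ m' * kdiff (k + m) f S"
        unfolding f'_def by (simp add: kdiff_diff kdiff_kdiff[OF fS] kdiff_scale[OF fS])
      then show ?thesis by (simp add: fe[OF S, symmetric] power_add mult_ac add.assoc)
    qed
    then show "\<exists>m f. (\<forall>p. Suc q = Suc p \<longrightarrow> cochain n I p r (k + m) f) \<and>
           (\<forall>S\<in>cech_index n (Suc q). indet_prod S ^ m * e S - kdiff (k + m) f S \<in> {0})"
      using cf' by (intro exI[of _ "m + m'"] exI[of _ f']) auto
  qed
next
  assume H: "lc_vanish n I {0} (Suc q) r"
  show "lc_vanish n (mpolys n) I q r"
  proof (rule lc_vanishI)
    fix k e assume e: "cochain n (mpolys n) q r k e"
      and cyc: "\<And>T. T \<in> cech_index n (Suc q) \<Longrightarrow> kdiff k e T \<in> I"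
    \<comment> \<open>The connecting map sends a cocycle e modulo I to d(e), with values in I. If
      d(e) = d(f) with f in I, then e - f is a cocycle over R and bounds because H^q(R) = 0.\<close>
    have "cochain n I (Suc q) r k (kdiff k e)"
      using cyc kdiff_forms[OF e] by (auto simp: cochain_def)
    moreover have "kdiff k (kdiff k e) T \<in> {0}" if "T \<in> cech_index n (Suc (Suc q))" for T
      using kdiff_kdiff[OF cech_index_finite[OF that]] by simp
    ultimately obtain m f where f: "cochain n I q r (k + m) f"
      and fe: "\<And>T. T \<in> cech_index n (Suc q) \<Longrightarrow> indet_prod T ^ m * kdiff k e T = kdiff (k + m) f T"
      using lc_vanishD[OF H, of k "kdiff k e"] by auto
    have fR: "cochain n (mpolys n) q r (k + m) f"
      using mpideal_mpolys[OF I] by (intro cochain_mono[OF _ f]) auto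
    define e' where "e' S = indet_prod S ^ m * e S - f S" for S
    have e': "cochain n (mpolys n) q r (k + m) e'"
      unfolding e'_def by (intro cochain_diff[OF mpideal_top] cochain_scale[OF mpideal_top e] fR)
    have "kdiff (k + m) e' T \<in> {0}" if T: "T \<in> cech_index n (Suc q)" for T
      unfolding e'_def using fe[OF T] by (simp add: kdiff_diff kdiff_scale[OF cech_index_finite[OF T]])
    from lc_vanishD[OF lc_vanish_poly_ring e' this] q obtain m' h
      where h: "\<And>p. q = Suc p \<Longrightarrow> cochain n (mpolys n) p r (k + m + m') h"
        and he: "\<And>S. S \<in> cech_index n q \<Longrightarrow> indet_prod S ^ m' * e' S = kdiff (k + m + m') h S"
      by auto
    have "indet_prod S ^ (m + m') * e S - kdiff (k + (m + m')) h S \<in> I" if S: "S \<in> cech_index n q" for S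
    proof -
      have "indet_prod S ^ (m + m') * e S - kdiff (k + (m + m')) h S = indet_prod S ^ m' * f S"
        using he[OF S] by (simp add: e'_def power_add algebra_simps)
      moreover have "\<dots> \<in> I"
        by (intro mpideal_mult[OF I] cochainD(1)[OF f S]
            forms_mpolys[OF indet_prod_power_forms[OF cech_index_subset[OF S]]])
      ultimately show ?thesis by simp
    qed
    then show "\<exists>m f. (\<forall>p. q = Suc p \<longrightarrow> cochain n (mpolys n) p r (k + m) f) \<and>
           (\<forall>S\<in>cech_index n q. indet_prod S ^ m * e S - kdiff (k + m) f S \<in> I)"
      using h by (intro exI[of _ "m + m'"] exI[of _ h]) (auto simp: add.assoc)
  qed
qed


section \<open>Initial ideals for the graded reverse lexicographic order\<close>

lemma grevlex_less_irrefl: "\<not> grevlex_less u u"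
  by (simp add: grevlex_less_def)

lemma grevlex_less_trans:
  assumes "grevlex_less u v" "grevlex_less v w"
  shows "grevlex_less u w"
proof (cases "mdeg u = mdeg v \<and> mdeg v = mdeg w")
  case False
  then show ?thesis using assms by (auto simp: grevlex_less_def)
next
  case True
  obtain i where i: "Poly_Mapping.lookup u i > Poly_Mapping.lookup v i"
    "\<And>l. l > i \<Longrightarrow> Poly_Mapping.lookup u l = Poly_Mapping.lookup v l"
    using assms(1) True by (auto simp: grevlex_less_def)
  obtain j where j: "Poly_Mapping.lookup v j > Poly_Mapping.lookup w j"
    "\<And>l. l > j \<Longrightarrow> Poly_Mapping.lookup v l = Poly_Mapping.lookup w l"
    using assms(2) True by (auto simp: grevlex_less_def)
  have "Poly_Mapping.lookup u (max i j) > Poly_Mapping.lookup w (max i j)"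
    using i j by (cases i j rule: linorder_cases) (auto simp: max_def)
  then show ?thesis
    using True i(2) j(2) unfolding grevlex_less_def by (intro disjI2 conjI exI[of _ "max i j"]) auto
qed

lemma grevlex_less_total:
  assumes "u \<noteq> v"
  shows "grevlex_less u v \<or> grevlex_less v u"
proof (cases "mdeg u = mdeg v")
  case True
  let ?D = "{i. Poly_Mapping.lookup u i \<noteq> Poly_Mapping.lookup v i}"
  have "?D \<subseteq> Poly_Mapping.keys u \<union> Poly_Mapping.keys v" by (auto simp: in_keys_iff)
  then have fin: "finite ?D" by (rule finite_subset) simp
  moreover have "?D \<noteq> {}" using assms by (auto intro: poly_mapping_eqI)
  ultimately have "Max ?D \<in> ?D" by (rule Max_in)
  moreover have "Poly_Mapping.lookup u j = Poly_Mapping.lookup v j" if "j > Max ?D" for j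
    using that Max_ge[OF fin, of j] by force
  ultimately show ?thesis
    using True unfolding grevlex_less_def by (metis (lifting) linorder_neqE_nat mem_Collect_eq)
qed (auto simp: grevlex_less_def)

lemma grevlex_less_add: "grevlex_less u v \<Longrightarrow> grevlex_less (w + u) (w + v)"
  by (auto simp: grevlex_less_def mdeg_add lookup_add)

lemma lead_monom_eqI:
  assumes "m \<in> Poly_Mapping.keys f" "\<And>u. u \<in> Poly_Mapping.keys f \<Longrightarrow> u \<noteq> m \<Longrightarrow> grevlex_less u m"
  shows "lead_monom f = m"
  unfolding lead_monom_def
proof (rule the_equality)
  fix m' assume "m' \<in> Poly_Mapping.keys f \<and> (\<forall>u\<in>Poly_Mapping.keys f. u \<noteq> m' \<longrightarrow> grevlex_less u m')"
  then show "m' = m" using assms grevlex_less_trans grevlex_less_irrefl by metis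
qed (use assms in auto)

lemma grevlex_max:
  assumes "finite A" "A \<noteq> {}"
  shows "\<exists>m\<in>A. \<forall>u\<in>A. u \<noteq> m \<longrightarrow> grevlex_less u m"
  using assms
proof (induction A rule: finite_ne_induct)
  case (insert x F)
  then obtain m where m: "m \<in> F" "\<And>u. u \<in> F \<Longrightarrow> u \<noteq> m \<Longrightarrow> grevlex_less u m" by blast
  then have "x \<noteq> m" using insert.hyps by blast
  then show ?case
    using m grevlex_less_total[of x m] grevlex_less_trans[of _ m x] by blast
qed simp

lemma lead_monom_max:
  assumes "f \<noteq> 0"
  shows "lead_monom f \<in> Poly_Mapping.keys f"
    "u \<in> Poly_Mapping.keys f \<Longrightarrow> u \<noteq> lead_monom f \<Longrightarrow> grevlex_less u (lead_monom f)"
proof -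
  have "Poly_Mapping.keys f \<noteq> {}" using assms by simp
  then obtain m where m: "m \<in> Poly_Mapping.keys f" "\<And>u. u \<in> Poly_Mapping.keys f \<Longrightarrow> u \<noteq> m \<Longrightarrow> grevlex_less u m"
    using grevlex_max[OF finite_keys] by blast
  then have "lead_monom f = m" by (rule lead_monom_eqI)
  with m show "lead_monom f \<in> Poly_Mapping.keys f"
    "u \<in> Poly_Mapping.keys f \<Longrightarrow> u \<noteq> lead_monom f \<Longrightarrow> grevlex_less u (lead_monom f)" by auto
qed

lemma lead_monom_single_mult:
  fixes f :: "'k::field mpoly"
  assumes "f \<noteq> 0" "c \<noteq> 0"
  shows "lead_monom (Poly_Mapping.single u c * f) = u + lead_monom f"
  using lead_monom_max[OF assms(1)]
  by (intro lead_monom_eqI) (auto simp: keys_single_mult[OF assms(2)] grevlex_less_add)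

lemma lead_monom_indet_mult:
  "f \<noteq> 0 \<Longrightarrow> lead_monom (indet v * f :: 'k::field mpoly) = Poly_Mapping.single v 1 + lead_monom f"
  by (simp add: indet_def lead_monom_single_mult)

text \<open>This keeps the leading monomial when passing to a homogeneous part or dropping the
  monomials in the last variables.\<close>

lemma lead_monom_part:
  assumes "f \<noteq> 0" "P (lead_monom f)"
  shows "part P f \<noteq> 0" "lead_monom (part P f) = lead_monom f"
proof -
  have m: "lead_monom f \<in> Poly_Mapping.keys (part P f)"
    using lead_monom_max(1)[OF assms(1)] assms(2) by simp
  then show "part P f \<noteq> 0" by (metis keys_zero empty_iff)
  show "lead_monom (part P f) = lead_monom f"
    using m lead_monom_max(2)[OF assms(1)] by (intro lead_monom_eqI) auto
qed

section \<open>Initial ideals as spans of monomials\<close>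

definition lead_monoms :: "'k::field mpoly set \<Rightarrow> expvec set" where
  "lead_monoms I = {lead_monom f | f. f \<in> I \<and> f \<noteq> 0}"

lemma lead_monomsI: "f \<in> I \<Longrightarrow> f \<noteq> 0 \<Longrightarrow> lead_monom f = m \<Longrightarrow> m \<in> lead_monoms I"
  unfolding lead_monoms_def by blast

lemma lead_monomsE:
  assumes "m \<in> lead_monoms I"
  obtains f where "f \<in> I" "f \<noteq> 0" "m = lead_monom f"
  using assms unfolding lead_monoms_def by blast

lemma sum_monomials: "f = (\<Sum>m\<in>Poly_Mapping.keys f. Poly_Mapping.single m (Poly_Mapping.lookup f m))"
  by (rule poly_mapping_eqI) (auto simp: lookup_sum lookup_single when_def in_keys_iff)

lemma single_mpolys: "Poly_Mapping.keys m \<subseteq> {1..n} \<Longrightarrow> Poly_Mapping.single m c \<in> mpolys n"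
  by (simp add: mpolys_def)

lemma lead_monoms_add:
  fixes I :: "'k::field mpoly set"
  assumes "mpideal n I" "m \<in> lead_monoms I" "Poly_Mapping.keys u \<subseteq> {1..n}"
  shows "u + m \<in> lead_monoms I"
proof -
  obtain f where f: "f \<in> I" "f \<noteq> 0" "m = lead_monom f" using assms(2) by (auto simp: lead_monoms_def)
  let ?u = "Poly_Mapping.single u (1::'k)"
  have "?u \<noteq> 0" by (metis keys_single keys_zero insert_not_empty one_neq_zero)
  then have "?u * f \<noteq> 0" using f(2) by simp
  moreover have "?u * f \<in> I" using single_mpolys[OF assms(3)] by (intro mpideal_mult[OF assms(1)] f)
  moreover have "u + m = lead_monom (?u * f)" using f by (simp add: lead_monom_single_mult)
  ultimately show ?thesis by (auto simp: lead_monoms_def)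
qed

text \<open>Leading monomials of I are closed under multiplication by monomials, so the right-hand
  side is an ideal; conversely each term of its elements is a scalar multiple of a generator.
  Membership in in(I) thus becomes a question about exponent vectors.\<close>

lemma initial_ideal_eq:
  fixes I :: "'k::field mpoly set"
  assumes I: "mpideal n I"
  shows "initial_ideal n I = {f \<in> mpolys n. Poly_Mapping.keys f \<subseteq> lead_monoms I}" (is "_ = ?K")
proof
  let ?G = "{Poly_Mapping.single (lead_monom f) (1::'k) | f. f \<in> I \<and> f \<noteq> 0}"
  have G: "?G \<subseteq> mpolys n"
    using lead_monom_max(1) mpideal_mpolys[OF I] by (fastforce simp: mpolys_def)
  have K: "mpideal n ?K"
    unfolding mpideal_def
  proof (intro conjI ballI)
    fix f g assume "f \<in> ?K" "g \<in> ?K"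
    then show "f + g \<in> ?K" using Poly_Mapping.keys_add[of f g] by (auto simp: mpolys_add)
  next
    fix f a :: "'k mpoly" assume f: "f \<in> ?K" and a: "a \<in> mpolys n"
    have "m \<in> lead_monoms I" if "m \<in> Poly_Mapping.keys (a * f)" for m
    proof -
      obtain u w where "u \<in> Poly_Mapping.keys a" "w \<in> Poly_Mapping.keys f" "m = u + w"
        using \<open>m \<in> _\<close> keys_mult[of a f] by blast
      then show ?thesis using f a lead_monoms_add[OF I, of w u] by (auto simp: mpolys_def)
    qed
    then show "a * f \<in> ?K" using f a by (auto simp: mpolys_mult)
  qed auto
  show "initial_ideal n I \<subseteq> ?K"
    unfolding initial_ideal_def using G
    by (intro genideal_poly_ring_minimal[OF K]) (auto simp: lead_monoms_def split: if_splits)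
  show "?K \<subseteq> initial_ideal n I"
  proof
    fix f assume f: "f \<in> ?K"
    note ini = genideal_poly_ring[OF G]
    have "Poly_Mapping.single m (Poly_Mapping.lookup f m) \<in> initial_ideal n I" if "m \<in> Poly_Mapping.keys f" for m
    proof -
      have "m \<in> lead_monoms I" using f that by blast
      then obtain g where "g \<in> I" "g \<noteq> 0" "m = lead_monom g" by (rule lead_monomsE)
      then have "Poly_Mapping.single m (1::'k) \<in> ?G" by blast
      then have "Poly_Mapping.single m (1::'k) \<in> initial_ideal n I"
        using ini(2) unfolding initial_ideal_def by blast
      then have "Poly_Mapping.single 0 (Poly_Mapping.lookup f m) * Poly_Mapping.single m 1 \<in> initial_ideal n I"
        unfolding initial_ideal_def by (intro mpideal_mult[OF ini(1)] single_mpolys) auto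
      then show ?thesis by (simp add: mult_single)
    qed
    then have "(\<Sum>m\<in>Poly_Mapping.keys f. Poly_Mapping.single m (Poly_Mapping.lookup f m)) \<in> initial_ideal n I"
      unfolding initial_ideal_def by (intro mpideal_sum[OF ini(1)])
    then show "f \<in> initial_ideal n I" by (simp only: sum_monomials[symmetric])
  qed
qed

lemma graded_initial_ideal:
  fixes I :: "'k::field mpoly set"
  assumes I: "mpideal n I"
  shows "graded_ideal n (initial_ideal n I)"
proof -
  have "{Poly_Mapping.single (lead_monom f) (1::'k) | f. f \<in> I \<and> f \<noteq> 0} \<subseteq> mpolys n"
    using lead_monom_max(1) mpideal_mpolys[OF I] by (fastforce simp: mpolys_def)
  then have "mpideal n (initial_ideal n I)"
    unfolding initial_ideal_def by (rule genideal_poly_ring(1))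
  then show ?thesis
    unfolding graded_ideal_def by (auto simp: initial_ideal_eq[OF I] part_mpolys)
qed

definition var_monoms :: "nat \<Rightarrow> nat \<Rightarrow> expvec set" where
  "var_monoms n i = {m. \<exists>v\<in>{n - i<..n}. Poly_Mapping.lookup m v > 0}"

lemma add_vars_alt: "add_vars n I i = {f \<in> mpolys n. \<exists>g\<in>I. Poly_Mapping.keys (f - g) \<subseteq> var_monoms n i}"
  by (auto simp: add_vars_def var_monoms_def)

lemma single_add_var_monoms_iff:
  "Poly_Mapping.single (n - i) 1 + m \<in> var_monoms n i \<longleftrightarrow> m \<in> var_monoms n i"
  by (auto simp: var_monoms_def lookup_add lookup_single when_def)

text \<open>Both summands are spanned by monomials, so membership is decided monomial by monomial;
  an element is split by truncating it to \<open>lead_monoms I\<close>.\<close>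

lemma add_vars_initial_ideal:
  fixes I :: "'k::field mpoly set"
  assumes I: "mpideal n I"
  shows "add_vars n (initial_ideal n I) i
    = {f \<in> mpolys n. Poly_Mapping.keys f \<subseteq> lead_monoms I \<union> var_monoms n i}"
proof (intro equalityI subsetI)
  fix f assume "f \<in> add_vars n (initial_ideal n I) i"
  then obtain g where g: "f \<in> mpolys n" "Poly_Mapping.keys g \<subseteq> lead_monoms I"
    "Poly_Mapping.keys (f - g) \<subseteq> var_monoms n i"
    by (auto simp: add_vars_alt initial_ideal_eq[OF I])
  have "m \<in> lead_monoms I \<union> var_monoms n i" if "m \<in> Poly_Mapping.keys f" for m
  proof (cases "m \<in> Poly_Mapping.keys (f - g)")
    case False
    then have "m \<in> Poly_Mapping.keys g" using that by (simp add: in_keys_iff lookup_minus)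
    then show ?thesis using g(2) by blast
  qed (use g(3) in blast)
  then show "f \<in> {f \<in> mpolys n. Poly_Mapping.keys f \<subseteq> lead_monoms I \<union> var_monoms n i}"
    using g(1) by blast
next
  fix f :: "'k mpoly" assume f: "f \<in> {f \<in> mpolys n. Poly_Mapping.keys f \<subseteq> lead_monoms I \<union> var_monoms n i}"
  let ?g = "part (\<lambda>m. m \<in> lead_monoms I) f"
  have "?g \<in> initial_ideal n I" using f by (auto simp: initial_ideal_eq[OF I] part_mpolys)
  moreover have "Poly_Mapping.keys (f - ?g) \<subseteq> var_monoms n i"
  proof
    fix m assume "m \<in> Poly_Mapping.keys (f - ?g)"
    then have "m \<in> Poly_Mapping.keys f" "m \<notin> lead_monoms I"
      by (auto simp: in_keys_iff lookup_minus lookup_part split: if_splits)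
    then show "m \<in> var_monoms n i" using f by auto
  qed
  ultimately show "f \<in> add_vars n (initial_ideal n I) i"
    using f by (auto simp: add_vars_alt)
qed

lemma keys_forms:
  assumes "f \<in> forms n d" "m \<in> Poly_Mapping.keys f"
  shows "Poly_Mapping.keys m \<subseteq> {1..n}" "int (mdeg m) = d"
  using assms by (auto simp: forms_def mpolys_def)

text \<open>The colon of an ideal spanned by monomials by a variable is again spanned by monomials,
  which reduces stability to a condition on single exponent vectors.\<close>

lemma colon_stable_add_vars_initial_iff:
  fixes I :: "'k::field mpoly set"
  assumes I: "mpideal n I" and i: "i < n"
  shows "colon_stable n (add_vars n (initial_ideal n I) i) (n - i) r \<longleftrightarrow>
    (\<forall>m. Poly_Mapping.keys m \<subseteq> {1..n} \<longrightarrow> int (mdeg m) = r \<longrightarrow>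
      Poly_Mapping.single (n - i) 1 + m \<in> lead_monoms I \<union> var_monoms n i \<longrightarrow>
      m \<in> lead_monoms I \<union> var_monoms n i)" (is "?L \<longleftrightarrow> ?R")
proof
  have z: "(indet (n - i) :: 'k mpoly) \<in> mpolys n"
    using i by (intro forms_mpolys[OF indet_forms]) auto
  {
    assume L: ?L
    show ?R
    proof (intro allI impI)
      fix m assume m: "Poly_Mapping.keys m \<subseteq> {1..n}" "int (mdeg m) = r"
        "Poly_Mapping.single (n - i) 1 + m \<in> lead_monoms I \<union> var_monoms n i"
      let ?m = "Poly_Mapping.single m (1::'k)"
      have "?m \<in> forms n r" using m single_mpolys[OF m(1), of "1::'k"] by (simp add: forms_def)
      moreover have "indet (n - i) * ?m \<in> add_vars n (initial_ideal n I) i"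
        using m mpolys_mult[OF z single_mpolys[OF m(1)], of 1]
        by (auto simp: add_vars_initial_ideal[OF I] keys_indet_mult)
      ultimately have "?m \<in> add_vars n (initial_ideal n I) i" using L by (simp add: colon_stable_def)
      then show "m \<in> lead_monoms I \<union> var_monoms n i" by (simp add: add_vars_initial_ideal[OF I])
    qed
  next
    assume R: ?R
    show ?L
      unfolding colon_stable_def
    proof (intro ballI impI)
      fix e :: "'k mpoly" assume e: "e \<in> forms n r" "indet (n - i) * e \<in> add_vars n (initial_ideal n I) i"
      have "m \<in> lead_monoms I \<union> var_monoms n i" if "m \<in> Poly_Mapping.keys e" for m
      proof -
        have "Poly_Mapping.single (n - i) 1 + m \<in> lead_monoms I \<union> var_monoms n i"
        proof -
          have "Poly_Mapping.keys (indet (n - i) * e) \<subseteq> lead_monoms I \<union> var_monoms n i"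
            using e(2) by (simp add: add_vars_initial_ideal[OF I])
          then show ?thesis using that unfolding keys_indet_mult by blast
        qed
        then show ?thesis using R keys_forms[OF e(1) that] by blast
      qed
      then show "e \<in> add_vars n (initial_ideal n I) i"
        using forms_mpolys[OF e(1)] by (auto simp: add_vars_initial_ideal[OF I])
    qed
  }
qed

text \<open>The characteristic property of the reverse lexicographic order.\<close>

lemma var_monoms_grevlex_less:
  assumes u: "u \<in> var_monoms n i" "Poly_Mapping.keys u \<subseteq> {1..n}"
    and m: "m \<notin> var_monoms n i" "Poly_Mapping.keys m \<subseteq> {1..n}" and deg: "mdeg u = mdeg m"
  shows "grevlex_less u m"
proof -
  obtain v where v: "v \<in> {n - i<..n}" "Poly_Mapping.lookup u v > 0" using u(1) by (auto simp: var_monoms_def)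
  then have "v \<in> Poly_Mapping.keys u" by (simp add: in_keys_iff)
  \<comment> \<open>The last variable of u: as \<open>w \<ge> v > n - i\<close>, m does not involve
    it, and beyond w neither monomial has a nonzero exponent.\<close>
  define w where "w = Max (Poly_Mapping.keys u)"
  have w: "w \<in> Poly_Mapping.keys u" "v \<le> w"
    using \<open>v \<in> Poly_Mapping.keys u\<close> by (auto simp: w_def intro: Max_in)
  have m0: "Poly_Mapping.lookup m j = 0" if "j > n - i" for j
  proof (cases "j \<le> n")
    case True
    then show ?thesis using m(1) that by (auto simp: var_monoms_def)
  next
    case False
    then have "j \<notin> Poly_Mapping.keys m" using m(2) by auto
    then show ?thesis by (simp add: in_keys_iff)
  qed
  have u0: "Poly_Mapping.lookup u j = 0" if "j > w" for j
  proof -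
    have "j \<notin> Poly_Mapping.keys u" using that by (metis Max_ge finite_keys leD w_def)
    then show ?thesis by (simp add: in_keys_iff)
  qed
  have "Poly_Mapping.lookup u w > Poly_Mapping.lookup m w"
    using w v m0[of w] by (simp add: in_keys_iff)
  moreover have "\<forall>j>w. Poly_Mapping.lookup u j = Poly_Mapping.lookup m j"
    using u0 m0 w(2) v(1) by auto
  ultimately show ?thesis using deg unfolding grevlex_less_def by blast
qed

text \<open>The inclusion of in(I + (x_n, ..., x_(n-i+1))) in in(I) + (x_n, ..., x_(n-i+1)). If the
  leading monomial of f avoids the last variables, it survives in the representative
  \<open>g'\<close> in I; what \<open>g'\<close> has in addition to f involves those variables and
  is smaller by the reverse lexicographic property, all degrees being d.\<close>

lemma lead_monom_add_vars:
  assumes I: "graded_ideal n I" and f: "f \<in> add_vars n I i" "f \<in> forms n d" "f \<noteq> 0"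
  shows "lead_monom f \<in> lead_monoms I \<union> var_monoms n i"
proof (rule ccontr)
  assume neg: "\<not> ?thesis"
  obtain g where g: "g \<in> I" "Poly_Mapping.keys (f - g) \<subseteq> var_monoms n i"
    using f(1) by (auto simp: add_vars_alt)
  define g' where "g' = hpart d g"
  have g': "g' \<in> I" "g' \<in> forms n d"
    unfolding g'_def using graded_ideal_hpart[OF I g(1)] mpideal_mpolys[OF graded_ideal_mpideal[OF I] g(1)]
    by (auto simp: hpart_forms)
  have "f - g' = hpart d (f - g)" using hpart_eq_self[OF f(2)] by (simp add: part_diff g'_def)
  then have fg: "Poly_Mapping.keys (f - g') \<subseteq> var_monoms n i" using g(2) by auto
  have lf: "lead_monom f \<in> Poly_Mapping.keys f" by (rule lead_monom_max(1)[OF f(3)])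
  moreover have "lead_monom f \<notin> Poly_Mapping.keys (f - g')" using fg neg by blast
  ultimately have lg: "lead_monom f \<in> Poly_Mapping.keys g'"
    by (simp add: in_keys_iff lookup_minus)
  have "grevlex_less u (lead_monom f)" if u: "u \<in> Poly_Mapping.keys g'" "u \<noteq> lead_monom f" for u
  proof (cases "u \<in> Poly_Mapping.keys f")
    case True
    then show ?thesis using lead_monom_max(2)[OF f(3)] u by blast
  next
    case False
    then have "u \<in> Poly_Mapping.keys (f - g')" using u(1) by (simp add: in_keys_iff lookup_minus)
    then have "u \<in> var_monoms n i" using fg by blast
    then show ?thesis
      using neg keys_forms[OF g'(2) u(1)] keys_forms[OF f(2) lf]
      by (intro var_monoms_grevlex_less) auto
  qed
  then have "lead_monom g' = lead_monom f" by (intro lead_monom_eqI lg)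
  moreover have "g' \<noteq> 0" using lg by auto
  ultimately have "lead_monom f \<in> lead_monoms I" using g'(1) by (intro lead_monomsI)
  then show False using neg by blast
qed

section \<open>Transfer of the colon condition between I and in(I)\<close>

lemma finite_monoms: "finite {u. Poly_Mapping.keys u \<subseteq> {1..n} \<and> int (mdeg u) = r}" (is "finite ?M")
proof -
  have "(\<lambda>u. restrict (Poly_Mapping.lookup u) {1..n}) ` ?M \<subseteq> (\<Pi>\<^sub>E j\<in>{1..n}. {0..nat r})"
  proof clarsimp
    fix u :: expvec and j assume u: "Poly_Mapping.keys u \<subseteq> {Suc 0..n}" and j: "Suc 0 \<le> j" "j \<le> n"
    have "mdeg u = (\<Sum>j\<in>{Suc 0..n}. Poly_Mapping.lookup u j)" using u by (intro mdeg_superset) auto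
    then show "Poly_Mapping.lookup u j \<le> mdeg u" using j by (simp add: member_le_sum)
  qed
  then have "finite ((\<lambda>u. restrict (Poly_Mapping.lookup u) {1..n}) ` ?M)"
    by (rule finite_subset) (intro finite_PiE finite_atLeastAtMost)
  moreover have "inj_on (\<lambda>u. restrict (Poly_Mapping.lookup u) {1..n}) ?M"
  proof (rule inj_onI)
    fix u w assume u: "u \<in> ?M" and w: "w \<in> ?M"
      and eq: "restrict (Poly_Mapping.lookup u) {1..n} = restrict (Poly_Mapping.lookup w) {1..n}"
    show "u = w"
    proof (rule poly_mapping_eqI)
      fix j show "Poly_Mapping.lookup u j = Poly_Mapping.lookup w j"
      proof (cases "j \<in> {1..n}")
        case True
        then show ?thesis using fun_cong[OF eq, of j] by simp
      next
        case False
        then have "j \<notin> Poly_Mapping.keys u" "j \<notin> Poly_Mapping.keys w" using u w by auto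
        then show ?thesis by (simp add: in_keys_iff)
      qed
    qed
  qed
  ultimately show ?thesis by (rule finite_imageD)
qed

text \<open>Let v = n - i. If m violates the condition for in(I), then x_v m is the leading monomial
  of some f in I. In the degree r + 1 part of f, drop the monomials in later variables; the order
  forces x_v to divide what is left, and the quotient has leading monomial m.\<close>

lemma colon_stable_imp_initial:
  fixes I :: "'k::field mpoly set"
  assumes I: "graded_ideal n I" and i: "i < n"
    and st: "colon_stable n (add_vars n I i) (n - i) r"
  shows "colon_stable n (add_vars n (initial_ideal n I) i) (n - i) r"
  unfolding colon_stable_add_vars_initial_iff[OF graded_ideal_mpideal[OF I] i]
proof (intro allI impI)
  let ?v = "n - i"
  fix m assume m: "Poly_Mapping.keys m \<subseteq> {1..n}" "int (mdeg m) = r"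
    "Poly_Mapping.single ?v 1 + m \<in> lead_monoms I \<union> var_monoms n i"
  show "m \<in> lead_monoms I \<union> var_monoms n i"
  proof (rule ccontr)
    assume neg: "\<not> ?thesis"
    let ?zm = "Poly_Mapping.single ?v 1 + m"
    have nV: "?zm \<notin> var_monoms n i" using neg single_add_var_monoms_iff[of n i m] by blast
    then obtain f where f: "f \<in> I" "f \<noteq> 0" "?zm = lead_monom f" using m(3) by (auto simp: lead_monoms_def)
    define f1 where "f1 = hpart (r + 1) f"
    have deg: "int (mdeg (lead_monom f)) = r + 1" using m(2) unfolding f(3)[symmetric] by (simp add: mdeg_add)
    have f1: "f1 \<noteq> 0" "lead_monom f1 = ?zm"
      using lead_monom_part[OF f(2), where P = "\<lambda>m. int (mdeg m) = r + 1"] deg f(3) by (simp_all add: f1_def)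
    have f1I: "f1 \<in> I" "f1 \<in> forms n (r + 1)"
      unfolding f1_def using graded_ideal_hpart[OF I f(1)] mpideal_mpolys[OF graded_ideal_mpideal[OF I] f(1)]
      by (auto simp: hpart_forms)
    define f2 where "f2 = part (\<lambda>m. m \<notin> var_monoms n i) f1"
    have f2: "f2 \<noteq> 0" "lead_monom f2 = ?zm"
      using lead_monom_part[OF f1(1), where P = "\<lambda>m. m \<notin> var_monoms n i"] f1(2) nV by (simp_all add: f2_def)
    have f2f: "f2 \<in> forms n (r + 1)" unfolding f2_def by (rule part_forms[OF f1I(2)])
    have "Poly_Mapping.keys (f2 - f1) \<subseteq> var_monoms n i"
      by (auto simp: f2_def in_keys_iff lookup_minus lookup_part split: if_splits)
    then have f2J: "f2 \<in> add_vars n I i"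
      using f1I(1) forms_mpolys[OF f2f] by (auto simp: add_vars_alt)
    \<comment> \<open>A smaller monomial u of the same degree has the larger exponent at the last
      place l where it differs from x_v m. Since u avoids the later variables, l <= v. For l = v the
      exponent of x_v in u exceeds another one; for l < v it equals that of x_v m, which is
      positive.\<close>
    have "Poly_Mapping.lookup u ?v > 0" if u: "u \<in> Poly_Mapping.keys f2" for u
    proof (cases "u = ?zm")
      case True
      then show ?thesis by (simp add: lookup_add)
    next
      case False
      then have "grevlex_less u ?zm" using lead_monom_max(2)[OF f2(1) u] f2(2) by simp
      moreover have "mdeg u = mdeg ?zm"
        using keys_forms(2)[OF f2f u] deg f(3) by simp
      ultimately obtain l where l: "Poly_Mapping.lookup u l > Poly_Mapping.lookup ?zm l"
        "\<And>j. j > l \<Longrightarrow> Poly_Mapping.lookup u j = Poly_Mapping.lookup ?zm j"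
        by (auto simp: grevlex_less_def)
      then have "l \<in> Poly_Mapping.keys u" by (auto simp: in_keys_iff)
      then have "l \<le> n" using keys_forms(1)[OF f2f u] by auto
      moreover have "u \<notin> var_monoms n i" using u by (simp add: f2_def)
      moreover have "Poly_Mapping.lookup u l > 0" using l(1) by simp
      ultimately have "l \<le> ?v" unfolding var_monoms_def using not_le by fastforce
      then show ?thesis
        using l by (cases "l = ?v") (auto simp: lookup_add)
    qed
    then obtain h where h: "h \<in> mpolys n" "f2 = indet ?v * h"
      by (rule indet_dvdE[OF forms_mpolys[OF f2f]])
    have hf: "h \<in> forms n r" using forms_indet_cancel[of ?v h n "r + 1"] f2f h by simp
    have "h \<in> add_vars n I i" using st hf f2J h(2) by (simp add: colon_stable_def)
    moreover have "h \<noteq> 0" using f2(1) h(2) by auto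
    ultimately have "lead_monom h \<in> lead_monoms I \<union> var_monoms n i"
      by (intro lead_monom_add_vars[OF I _ hf])
    moreover have "lead_monom h = m"
      using f2(2) lead_monom_indet_mult[OF \<open>h \<noteq> 0\<close>, of ?v] h(2) by simp
    ultimately show False using neg by simp
  qed
qed

text \<open>Reduction by leading monomials: by the condition for in(I), the leading monomial of e is
  also that of some g in \<open>?J\<close>, and subtracting the right multiple of g from e keeps the
  product with x_(n-i) in \<open>?J\<close>.\<close>

lemma initial_imp_colon_stable:
  fixes I :: "'k::field mpoly set"
  assumes I: "graded_ideal n I" and i: "i < n"
    and st: "colon_stable n (add_vars n (initial_ideal n I) i) (n - i) r"
  shows "colon_stable n (add_vars n I i) (n - i) r"
  unfolding colon_stable_def
proof (intro ballI impI)
  let ?z = "indet (n - i) :: 'k mpoly"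
  let ?J = "add_vars n I i"
  have I': "mpideal n I" by (rule graded_ideal_mpideal[OF I])
  have J: "mpideal n ?J" by (rule add_vars_mpideal[OF I'])
  have v: "n - i \<in> {1..n}" using i by auto
  \<comment> \<open>The induction measure is the number of monomials of degree r below the leading
    one, finite because the degree and the variables are fixed.\<close>
  define M where "M e = {u. Poly_Mapping.keys u \<subseteq> {1..n} \<and> int (mdeg u) = r \<and> grevlex_less u (lead_monom e)}"
    for e :: "'k mpoly"
  have finM: "finite (M e)" for e by (rule finite_subset[OF _ finite_monoms[of n r]]) (auto simp: M_def)
  fix e assume "e \<in> forms n r" "?z * e \<in> ?J"
  then show "e \<in> ?J"
  proof (induction "card (M e)" arbitrary: e rule: less_induct)
    case (less e)
    show ?case
    proof (cases "e = 0")
      case True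
      then show ?thesis using mpideal_zero[OF J] by simp
    next
      case False
      define l where "l = lead_monom e"
      have le: "l \<in> Poly_Mapping.keys e" using lead_monom_max(1)[OF False] by (simp add: l_def)
      have "?z * e \<in> forms n (1 + r)" by (intro forms_mult indet_forms v less.prems)
      then have "Poly_Mapping.single (n - i) 1 + l \<in> lead_monoms I \<union> var_monoms n i"
        using lead_monom_add_vars[OF I less.prems(2)] False lead_monom_indet_mult[OF False, of "n - i"]
        by (simp add: l_def)
      then have "l \<in> lead_monoms I \<union> var_monoms n i"
        using st keys_forms[OF less.prems(1) le]
        unfolding colon_stable_add_vars_initial_iff[OF I' i] by blast
      then have "\<exists>g. g \<in> ?J \<and> g \<in> forms n r \<and> g \<noteq> 0 \<and> lead_monom g = l"
      proof
        assume "l \<in> lead_monoms I"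
        then obtain f where f: "f \<in> I" "f \<noteq> 0" "l = lead_monom f" by (auto simp: lead_monoms_def)
        have "hpart r f \<noteq> 0 \<and> lead_monom (hpart r f) = l"
          using lead_monom_part[OF f(2), where P = "\<lambda>m. int (mdeg m) = r"] f(3)
            keys_forms(2)[OF less.prems(1) le] by simp
        moreover have "hpart r f \<in> ?J"
          using graded_ideal_hpart[OF I f(1)] subset_add_vars[OF I'] by blast
        moreover have "hpart r f \<in> forms n r" by (rule hpart_forms[OF mpideal_mpolys[OF I' f(1)]])
        ultimately show ?thesis by blast
      next
        assume l: "l \<in> var_monoms n i"
        let ?g = "Poly_Mapping.single l (1::'k)"
        have "?g \<in> forms n r"
          using keys_forms[OF less.prems(1) le] single_mpolys[of l n "1::'k"] by (simp add: forms_def)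
        moreover from this l have "?g \<in> ?J"
          by (intro mem_add_vars_of_keys[OF I'] forms_mpolys) (auto simp: var_monoms_def)
        moreover have "?g \<noteq> 0" by (metis keys_single keys_zero insert_not_empty one_neq_zero)
        moreover have "lead_monom ?g = l" by (rule lead_monom_eqI) auto
        ultimately show ?thesis by blast
      qed
      then obtain g where g: "g \<in> ?J" "g \<in> forms n r" "g \<noteq> 0" "lead_monom g = l" by blast
      have lg: "Poly_Mapping.lookup g l \<noteq> 0"
        using lead_monom_max(1)[OF g(3)] g(4) by (simp add: in_keys_iff)
      define a where "a = Poly_Mapping.single (0::expvec) (Poly_Mapping.lookup e l / Poly_Mapping.lookup g l)"
      have lag: "Poly_Mapping.lookup (a * g) u = Poly_Mapping.lookup e l / Poly_Mapping.lookup g l * Poly_Mapping.lookup g u" for u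
        using single_mult_lookup[of 0 _ g u] by (simp add: a_def)
      have a: "a \<in> forms n 0" using single_mpolys[of 0 n] by (auto simp: a_def forms_def split: if_splits)
      define e' where "e' = e - a * g"
      have agJ: "a * g \<in> ?J" by (intro mpideal_mult[OF J g(1)] forms_mpolys[OF a])
      have e'f: "e' \<in> forms n r"
        unfolding e'_def using forms_mult[OF a g(2)] by (intro forms_diff less.prems) simp
      have "?z * e' = ?z * e - ?z * (a * g)" by (simp add: e'_def algebra_simps)
      also have "\<dots> \<in> ?J"
        by (intro mpideal_diff[OF J] less.prems mpideal_mult[OF J agJ] forms_mpolys[OF indet_forms[OF v]])
      finally have ze': "?z * e' \<in> ?J" .
      have "e' \<in> ?J"
      proof (cases "e' = 0")
        case True
        then show ?thesis using mpideal_zero[OF J] by simp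
      next
        case e'0: False
        have le': "lead_monom e' \<in> Poly_Mapping.keys e'" by (rule lead_monom_max(1)[OF e'0])
        then have ne: "lead_monom e' \<noteq> l"
          using lg by (auto simp: in_keys_iff e'_def lookup_minus lag)
        have "lead_monom e' \<in> Poly_Mapping.keys e \<or> lead_monom e' \<in> Poly_Mapping.keys g"
          using le' by (auto simp: in_keys_iff e'_def lookup_minus lag)
        then have lt: "grevlex_less (lead_monom e') l"
          using lead_monom_max(2)[OF False] lead_monom_max(2)[OF g(3)] g(4) ne by (auto simp: l_def)
        have "M e' \<subseteq> M e" using grevlex_less_trans[OF _ lt] by (auto simp: M_def l_def)
        moreover have "lead_monom e' \<in> M e"
          using keys_forms[OF e'f le'] lt by (simp add: M_def l_def)
        moreover have "lead_monom e' \<notin> M e'" using grevlex_less_irrefl by (simp add: M_def)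
        ultimately have "card (M e') < card (M e)" by (intro psubset_card_mono finM) blast
        then show ?thesis using e'f ze' by (rule less.hyps)
      qed
      then show ?thesis using mpideal_add[OF J _ agJ, of e'] by (simp add: e'_def)
    qed
  qed
qed


section \<open>Filter-regular sequences of variables\<close>

lemma poly_coset: "H +>\<^bsub>poly_ring n\<^esub> e = (\<lambda>h. h + e) ` H"
  by (auto simp: a_r_coset_def r_coset_def)

lemma poly_coset_eq_iff:
  assumes "mpideal n H"
  shows "H +>\<^bsub>poly_ring n\<^esub> e = H +>\<^bsub>poly_ring n\<^esub> f \<longleftrightarrow> e - f \<in> H"
proof
  assume "H +>\<^bsub>poly_ring n\<^esub> e = H +>\<^bsub>poly_ring n\<^esub> f"
  moreover have "e \<in> H +>\<^bsub>poly_ring n\<^esub> e"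
    unfolding poly_coset using mpideal_zero[OF assms] by (force intro: image_eqI[of _ _ 0])
  ultimately obtain h where "h \<in> H" "e = h + f" by (auto simp: poly_coset)
  then show "e - f \<in> H" by simp
next
  have *: "h + a \<in> (\<lambda>h. h + b) ` H" if "a - b \<in> H" "h \<in> H" for a b h
    using mpideal_add[OF assms that(2,1)] by (force intro: image_eqI[of _ _ "h + (a - b)"])
  assume ef: "e - f \<in> H"
  then have fe: "f - e \<in> H" using mpideal_uminus[OF assms, of "e - f"] by simp
  show "H +>\<^bsub>poly_ring n\<^esub> e = H +>\<^bsub>poly_ring n\<^esub> f"
    unfolding poly_coset using *[OF ef] *[OF fe] by blast
qed

lemma poly_coset_zero: "H +>\<^bsub>poly_ring n\<^esub> 0 = H"
  by (simp add: poly_coset)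

lemma quotmod_poly_ring_simps:
  assumes H: "mpideal n H"
  defines "M \<equiv> quotmod (poly_ring n) H"
  shows "carrier M = {H +>\<^bsub>poly_ring n\<^esub> e | e. e \<in> mpolys n}"
    and "\<zero>\<^bsub>M\<^esub> = H"
    and "(H +>\<^bsub>poly_ring n\<^esub> e) \<oplus>\<^bsub>M\<^esub> (H +>\<^bsub>poly_ring n\<^esub> f) = H +>\<^bsub>poly_ring n\<^esub> (e + f)"
    and "a \<in> mpolys n \<Longrightarrow> a \<odot>\<^bsub>M\<^esub> (H +>\<^bsub>poly_ring n\<^esub> e) = H +>\<^bsub>poly_ring n\<^esub> (a * e)"
    and "component M r = {H +>\<^bsub>poly_ring n\<^esub> e | e. e \<in> forms n r}"
proof -
  show "carrier M = {H +>\<^bsub>poly_ring n\<^esub> e | e. e \<in> mpolys n}"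
    by (auto simp: M_def quotmod_def A_RCOSETS_def RCOSETS_def a_r_coset_def)
  show "\<zero>\<^bsub>M\<^esub> = H" by (simp add: M_def quotmod_def)
  show "component M r = {H +>\<^bsub>poly_ring n\<^esub> e | e. e \<in> forms n r}"
    by (auto simp: M_def quotmod_def)
  have "(H +>\<^bsub>poly_ring n\<^esub> e) \<oplus>\<^bsub>M\<^esub> (H +>\<^bsub>poly_ring n\<^esub> f)
      = {(h + e) + (h' + f) | h h'. h \<in> H \<and> h' \<in> H}"
    by (auto simp: M_def quotmod_def set_add_def set_mult_def poly_coset)
  also have "\<dots> = (\<lambda>h. h + (e + f)) ` H"
  proof (intro equalityI subsetI)
    fix x assume "x \<in> {(h + e) + (h' + f) | h h'. h \<in> H \<and> h' \<in> H}"
    then obtain h h' where "h \<in> H" "h' \<in> H" "x = (h + e) + (h' + f)" by blast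
    then show "x \<in> (\<lambda>h. h + (e + f)) ` H"
      using mpideal_add[OF H, of h h'] by (intro image_eqI[of _ _ "h + h'"]) (auto simp: algebra_simps)
  next
    fix x assume "x \<in> (\<lambda>h. h + (e + f)) ` H"
    then obtain h where h: "h \<in> H" "x = h + (e + f)" by blast
    then have "x = (h + e) + (0 + f)" by (simp add: algebra_simps)
    then show "x \<in> {(h + e) + (h' + f) | h h'. h \<in> H \<and> h' \<in> H}"
      using h(1) mpideal_zero[OF H] by blast
  qed
  finally show "(H +>\<^bsub>poly_ring n\<^esub> e) \<oplus>\<^bsub>M\<^esub> (H +>\<^bsub>poly_ring n\<^esub> f) = H +>\<^bsub>poly_ring n\<^esub> (e + f)"
    by (simp add: poly_coset)
  assume a: "a \<in> mpolys n"
  have "H +>\<^bsub>poly_ring n\<^esub> (a * x) = H +>\<^bsub>poly_ring n\<^esub> (a * e)" if x: "x \<in> H +>\<^bsub>poly_ring n\<^esub> e" for x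
  proof -
    obtain h where "h \<in> H" "x = h + e" using x by (auto simp: poly_coset)
    then have "a * x - a * e \<in> H" using mpideal_mult[OF H _ a, of h] by (simp add: algebra_simps)
    then show ?thesis by (simp add: poly_coset_eq_iff[OF H])
  qed
  moreover have "H +>\<^bsub>poly_ring n\<^esub> e \<noteq> {}" using mpideal_zero[OF H] by (auto simp: poly_coset)
  ultimately show "a \<odot>\<^bsub>M\<^esub> (H +>\<^bsub>poly_ring n\<^esub> e) = H +>\<^bsub>poly_ring n\<^esub> (a * e)"
    by (simp add: M_def quotmod_def)
qed

text \<open>Serves to bound \<open>ideal_mult\<close> from above, which is defined as an
  intersection of submodules.\<close>

lemma submodule_quotmod_poly_ring:
  assumes H: "mpideal n H" and K: "mpideal n K"
  shows "submodule {H +>\<^bsub>poly_ring n\<^esub> e | e. e \<in> K} (poly_ring n) (quotmod (poly_ring n) H)"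
proof -
  let ?M = "quotmod (poly_ring n) H"
  let ?c = "\<lambda>e. H +>\<^bsub>poly_ring n\<^esub> e"
  note M = quotmod_poly_ring_simps[OF H]
  have zero: "\<zero>\<^bsub>?M\<^esub> = ?c 0" by (simp add: M(2) poly_coset_zero)
  have inv: "inv\<^bsub>add_monoid ?M\<^esub> (?c e) = ?c (- e)" if e: "e \<in> mpolys n" for e
    unfolding m_inv_def
  proof (rule the_equality)
    show "?c (- e) \<in> carrier (add_monoid ?M) \<and> ?c e \<otimes>\<^bsub>add_monoid ?M\<^esub> ?c (- e) = \<one>\<^bsub>add_monoid ?M\<^esub>
        \<and> ?c (- e) \<otimes>\<^bsub>add_monoid ?M\<^esub> ?c e = \<one>\<^bsub>add_monoid ?M\<^esub>"
      using mpolys_uminus[OF e] by (auto simp: M(1) M(3) zero)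
  next
    fix Y assume "Y \<in> carrier (add_monoid ?M) \<and> ?c e \<otimes>\<^bsub>add_monoid ?M\<^esub> Y = \<one>\<^bsub>add_monoid ?M\<^esub>
        \<and> Y \<otimes>\<^bsub>add_monoid ?M\<^esub> ?c e = \<one>\<^bsub>add_monoid ?M\<^esub>"
    then obtain f where f: "Y = ?c f" "?c (e + f) = ?c 0" by (auto simp: M(1) M(3) zero)
    then show "Y = ?c (- e)" by (simp add: poly_coset_eq_iff[OF H] add.commute)
  qed
  show ?thesis
  proof (intro submodule.intro subgroup.intro submodule_axioms.intro)
    show "{?c e | e. e \<in> K} \<subseteq> carrier (add_monoid ?M)"
      using mpideal_mpolys[OF K] by (auto simp: M(1))
    show "x \<otimes>\<^bsub>add_monoid ?M\<^esub> y \<in> {?c e | e. e \<in> K}" if "x \<in> {?c e | e. e \<in> K}" "y \<in> {?c e | e. e \<in> K}" for x y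
      using that mpideal_add[OF K] by (auto simp: M(3))
    show "\<one>\<^bsub>add_monoid ?M\<^esub> \<in> {?c e | e. e \<in> K}"
      using mpideal_zero[OF K] zero by auto
    show "inv\<^bsub>add_monoid ?M\<^esub> x \<in> {?c e | e. e \<in> K}" if "x \<in> {?c e | e. e \<in> K}" for x
      using that mpideal_uminus[OF K] inv[OF mpideal_mpolys[OF K]] by auto
    show "a \<odot>\<^bsub>?M\<^esub> x \<in> {?c e | e. e \<in> K}" if "a \<in> carrier (poly_ring n)" "x \<in> {?c e | e. e \<in> K}" for a x
      using that mpideal_mult[OF K] by (auto simp: M(4))
  qed
qed

lemma var_monoms_subset_genideal:
  fixes w :: "'k::field mpoly"
  assumes w: "w \<in> mpolys n" "Poly_Mapping.keys w \<subseteq> var_monoms n i" and i: "i \<le> n"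
  shows "w \<in> Idl\<^bsub>poly_ring n\<^esub> (indet ` {n - i<..n})"
proof -
  let ?A = "Idl\<^bsub>poly_ring n\<^esub> (indet ` {n - i<..n} :: 'k mpoly set)"
  have "indet ` {n - i<..n} \<subseteq> (mpolys n :: 'k mpoly set)"
    by (auto intro!: forms_mpolys[OF indet_forms])
  note A = genideal_poly_ring[OF this]
  have "Poly_Mapping.single m (Poly_Mapping.lookup w m) \<in> ?A" if m: "m \<in> Poly_Mapping.keys w" for m
  proof -
    obtain v where v: "v \<in> {n - i<..n}" "Poly_Mapping.lookup m v > 0"
      using w(2) m by (auto simp: var_monoms_def)
    have "Poly_Mapping.single m (Poly_Mapping.lookup w m) \<in> mpolys n"
      using w(1) m by (intro single_mpolys) (simp add: mpolys_def)
    then obtain h where "h \<in> mpolys n" "Poly_Mapping.single m (Poly_Mapping.lookup w m) = indet v * h"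
      by (rule indet_dvdE[of _ _ v]) (use v in \<open>auto split: if_splits\<close>)
    moreover have "indet v \<in> ?A" using A(2) v(1) by blast
    ultimately show ?thesis using mpideal_mult[OF A(1), of "indet v" h] by (simp add: mult.commute)
  qed
  then have "(\<Sum>m\<in>Poly_Mapping.keys w. Poly_Mapping.single m (Poly_Mapping.lookup w m)) \<in> ?A"
    by (intro mpideal_sum[OF A(1)])
  then show ?thesis by (simp only: sum_monomials[symmetric])
qed

text \<open>The submodule \<open>N\<close> generated by the earlier variables of the sequence is
  never computed; two bounds suffice. It lies in the image of \<open>add_vars n H i\<close>, and it
  contains w times the class of 1 for every w in the ideal of these variables.\<close>

lemma filter_regular_imp_colon_stable:
  fixes H :: "'k::field mpoly set"
  assumes H: "mpideal n H" and t: "t < n" and i: "i \<le> t"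
    and fr: "filter_regular n (quotmod (poly_ring n) H) (map (\<lambda>i. indet (n - i)) [0..<Suc t])"
  shows "\<exists>r0. \<forall>r\<ge>r0. colon_stable n (add_vars n H i) (n - i) r"
proof -
  define M where "M = quotmod (poly_ring n) H"
  let ?c = "\<lambda>e. H +>\<^bsub>poly_ring n\<^esub> e"
  let ?zs = "map (\<lambda>i. indet (n - i)) [0..<Suc t] :: 'k mpoly list"
  let ?A = "Idl\<^bsub>poly_ring n\<^esub> (indet ` {n - i<..n} :: 'k mpoly set)"
  let ?z = "indet (n - i) :: 'k mpoly"
  note Ms = quotmod_poly_ring_simps[OF H, folded M_def]
  define N where "N = ideal_mult n ?A M"
  define Q where "Q = quotmod (submod M (colon M N ?z)) N"
  have rng: "(\<lambda>j. n - j) ` {0..<i} = {n - i<..n}"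
  proof (intro equalityI subsetI)
    fix v assume "v \<in> {n - i<..n}"
    then show "v \<in> (\<lambda>j. n - j) ` {0..<i}" by (intro image_eqI[of _ _ "n - v"]) auto
  qed (use i t in auto)
  have "take i [0..<Suc t] = [0..<i]" using i by (simp del: upt_Suc)
  then have "set (take i ?zs) = (\<lambda>j. indet (n - j)) ` {0..<i}" by (simp add: take_map del: upt_Suc)
  then have tk: "set (take i ?zs) = indet ` {n - i<..n}"
    unfolding rng[symmetric] by (simp only: image_image)
  have zi: "?zs ! i = ?z" using i by (simp add: nth_append del: upt_Suc)
  have "i < length ?zs" using i by simp
  then obtain r0 where r0: "\<And>r. r \<ge> r0 \<Longrightarrow> component Q r = {\<zero>\<^bsub>Q\<^esub>}"
    using fr unfolding filter_regular_def Let_def M_def[symmetric]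
    unfolding Q_def N_def tk[symmetric] zi[symmetric] by blast
  have zm: "?z \<in> mpolys n" using i t by (intro forms_mpolys[OF indet_forms]) auto
  have K: "mpideal n (add_vars n H i)" by (rule add_vars_mpideal[OF H])
  have AK: "?A \<subseteq> add_vars n H i"
  proof (rule genideal_poly_ring_minimal[OF K], safe)
    fix v assume "v \<in> {n - i<..n}"
    then show "indet v \<in> add_vars n H i"
      by (intro mem_add_vars_of_keys[OF H] forms_mpolys[OF indet_forms]) (auto intro!: bexI[of _ v])
  qed
  have AR: "?A \<subseteq> mpolys n" using AK mpideal_mpolys[OF K] by blast
  have N_sub: "N \<subseteq> {?c e | e. e \<in> add_vars n H i}"
    unfolding N_def ideal_mult_def
  proof (rule Inter_lower, rule CollectI, intro conjI ballI)
    show "submodule {?c e | e. e \<in> add_vars n H i} (poly_ring n) M"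
      unfolding M_def by (rule submodule_quotmod_poly_ring[OF H K])
    fix a X assume a: "a \<in> ?A" and "X \<in> carrier M"
    then obtain f where f: "f \<in> mpolys n" "X = ?c f" by (auto simp: Ms(1))
    have "f * a \<in> add_vars n H i" using a AK f(1) by (intro mpideal_mult[OF K]) auto
    moreover have "a \<in> mpolys n" using a AR by blast
    then have "a \<odot>\<^bsub>M\<^esub> X = ?c (f * a)" unfolding f(2) by (simp add: Ms(4) mult.commute)
    ultimately show "a \<odot>\<^bsub>M\<^esub> X \<in> {?c e | e. e \<in> add_vars n H i}" by blast
  qed
  have zeroN: "\<zero>\<^bsub>M\<^esub> \<in> N"
    unfolding N_def ideal_mult_def
    using subgroup.one_closed[OF submodule.axioms(1)] by fastforce
  have "colon_stable n (add_vars n H i) (n - i) r" if r: "r \<ge> r0" for r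
    unfolding colon_stable_def
  proof (intro ballI impI)
    fix e assume e: "e \<in> forms n r" "?z * e \<in> add_vars n H i"
    obtain g where g: "g \<in> H" "Poly_Mapping.keys (?z * e - g) \<subseteq> var_monoms n i"
      using e(2) by (auto simp: add_vars_alt)
    \<comment> \<open>The product of x_(n-i) and e is w + g with g in H and w in the ideal of the
      earlier variables of the sequence, so modulo H it is w acting on the class of 1.\<close>
    define w where "w = ?z * e - g"
    have "w \<in> mpolys n"
      unfolding w_def by (intro mpolys_diff mpolys_mult zm forms_mpolys[OF e(1)] mpideal_mpolys[OF H g(1)])
    then have w: "w \<in> ?A" using g(2) i t by (intro var_monoms_subset_genideal) (auto simp: w_def)
    have "?c 1 \<in> carrier M" unfolding Ms(1) using mpolys_one by blast
    then have "w \<odot>\<^bsub>M\<^esub> ?c 1 \<in> N"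
      unfolding N_def ideal_mult_def using w by blast
    moreover have "w \<odot>\<^bsub>M\<^esub> ?c 1 = ?c w" using w AR by (auto simp: Ms(4))
    moreover have "?c w = ?c (?z * e)"
      using mpideal_uminus[OF H g(1)] by (simp add: poly_coset_eq_iff[OF H] w_def)
    ultimately have "?z \<odot>\<^bsub>M\<^esub> ?c e \<in> N" by (simp add: Ms(4)[OF zm])
    then have "?c e \<in> colon M N ?z"
      using forms_mpolys[OF e(1)] by (auto simp: colon_def Ms(1))
    moreover have "?c e \<in> component M r" using e(1) by (auto simp: Ms(5))
    ultimately have "N +>\<^bsub>submod M (colon M N ?z)\<^esub> ?c e \<in> component Q r"
      by (auto simp: Q_def quotmod_def submod_def)
    then have "N +>\<^bsub>submod M (colon M N ?z)\<^esub> ?c e = N"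
      using r0[OF r] by (simp add: Q_def quotmod_def)
    \<comment> \<open>The zero coset lies in \<open>N\<close>, so the trivial coset of the class of
      e contains that class itself.\<close>
    moreover have "\<zero>\<^bsub>M\<^esub> \<oplus>\<^bsub>M\<^esub> ?c e \<in> N +>\<^bsub>submod M (colon M N ?z)\<^esub> ?c e"
      using zeroN by (auto simp: a_r_coset_def r_coset_def submod_def)
    moreover have "\<zero>\<^bsub>M\<^esub> \<oplus>\<^bsub>M\<^esub> ?c e = ?c e"
      using Ms(3)[of 0 e] by (simp add: Ms(2) poly_coset_zero)
    ultimately obtain f where "f \<in> add_vars n H i" "?c e = ?c f" using N_sub by auto
    then show "e \<in> add_vars n H i"
      using mpideal_cong[OF K, of e f] subset_add_vars[OF H, of i] by (auto simp: poly_coset_eq_iff[OF H])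
  qed
  then show ?thesis by blast
qed


section \<open>Fractions of elements of an ideal\<close>

text \<open>Operations on fractions are unions over representatives; this evaluates them once the
  members of the union are known to agree.\<close>

lemma UN_pairs_const:
  assumes "(a, k) \<in> X" "\<And>e l. (e, l) \<in> X \<Longrightarrow> F e l = C"
  shows "(\<Union>(e, l)\<in>X. F e l) = C"
proof -
  have "(\<Union>(e, l)\<in>X. F e l) = (\<Union>p\<in>X. C)" using assms(2) by (intro SUP_cong) auto
  then show ?thesis using assms(1) by auto
qed

locale ideal_fractions =
  fixes n :: nat and I :: "'k::field mpoly set"
  assumes I: "mpideal n I"
begin

abbreviation "M \<equiv> ideal_module n I"

lemma M_simps [simp]:
  "carrier M = I" "\<zero>\<^bsub>M\<^esub> = 0" "f \<oplus>\<^bsub>M\<^esub> g = f + g" "f \<odot>\<^bsub>M\<^esub> g = f * g"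
  "component M r = I \<inter> forms n r"
  by (simp_all add: ideal_module_def submod_def)

text \<open>R is a domain, so the extra factor s^q in \<open>frac_rel\<close> cancels and equality
  of fractions is cross multiplication.\<close>

lemma mfrac_iff:
  assumes "s \<noteq> 0" "e \<in> I"
  shows "(f, l) \<in> mfrac M s e k \<longleftrightarrow> f \<in> I \<and> s ^ l * e = s ^ k * f"
proof -
  have "s ^ (q + l) * e = s ^ (q + k) * f \<longleftrightarrow> s ^ l * e = s ^ k * f" for q
    using assms(1) by (simp add: power_add mult.assoc)
  then show ?thesis using assms(2) by (simp add: mfrac_def frac_rel_def)
qed

lemma mfrac_eq_iff:
  assumes "s \<noteq> 0" "e \<in> I" "f \<in> I"
  shows "mfrac M s e k = mfrac M s f l \<longleftrightarrow> s ^ l * e = s ^ k * f"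
proof
  assume "mfrac M s e k = mfrac M s f l"
  moreover have "(f, l) \<in> mfrac M s f l" using assms by (simp add: mfrac_iff)
  ultimately show "s ^ l * e = s ^ k * f" using assms by (metis mfrac_iff)
next
  assume eq: "s ^ l * e = s ^ k * f"
  have "s ^ j * e = s ^ k * g \<longleftrightarrow> s ^ j * f = s ^ l * g" for g j
  proof -
    have "s ^ j * e = s ^ k * g \<longleftrightarrow> s ^ l * (s ^ j * e) = s ^ l * (s ^ k * g)" using assms(1) by simp
    also have "s ^ l * (s ^ j * e) = s ^ k * (s ^ j * f)" using eq by (metis mult.left_commute)
    also have "s ^ k * (s ^ j * f) = s ^ l * (s ^ k * g) \<longleftrightarrow> s ^ k * (s ^ j * f) = s ^ k * (s ^ l * g)"
      by (simp add: mult.left_commute)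
    also have "\<dots> \<longleftrightarrow> s ^ j * f = s ^ l * g" using assms(1) by simp
    finally show ?thesis .
  qed
  then show "mfrac M s e k = mfrac M s f l"
    using assms by (auto simp: mfrac_iff)
qed

lemma mfrac_scale:
  assumes "s \<noteq> 0" "s \<in> mpolys n" "e \<in> I"
  shows "s ^ m * e \<in> I" "mfrac M s (s ^ m * e) (k + m) = mfrac M s e k"
proof -
  have p: "s ^ m \<in> mpolys n" by (induction m) (auto simp: mpolys_mult assms(2))
  show "s ^ m * e \<in> I" by (rule mpideal_mult[OF I assms(3) p])
  then show "mfrac M s (s ^ m * e) (k + m) = mfrac M s e k"
    using assms by (simp add: mfrac_eq_iff power_add mult_ac)
qed

context
  fixes s :: "'k mpoly" and d :: nat
  assumes s: "s \<noteq> 0" "s \<in> mpolys n"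
begin

abbreviation "L \<equiv> localization M s d"

lemma power_s: "s ^ m \<in> mpolys n"
  by (induction m) (auto simp: mpolys_mult s)

lemma power_mult_mem: "e \<in> I \<Longrightarrow> s ^ m * e \<in> I"
  by (rule mpideal_mult[OF I _ power_s])

lemma loc_add:
  assumes "e \<in> I" "f \<in> I"
  shows "mfrac M s e k \<oplus>\<^bsub>L\<^esub> mfrac M s f l = mfrac M s (s ^ l * e + s ^ k * f) (k + l)"
proof -
  have "mfrac M s (s ^ l' * e' + s ^ k' * f') (k' + l') = mfrac M s (s ^ l * e + s ^ k * f) (k + l)"
    if "(e', k') \<in> mfrac M s e k" "(f', l') \<in> mfrac M s f l" for e' k' f' l'
  proof -
    have e': "e' \<in> I" "s ^ k' * e = s ^ k * e'" and f': "f' \<in> I" "s ^ l' * f = s ^ l * f'"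
      using that assms s by (auto simp: mfrac_iff)
    have "s ^ (k + l) * (s ^ l' * e' + s ^ k' * f')
        = s ^ l * s ^ l' * (s ^ k * e') + s ^ k * s ^ k' * (s ^ l * f')"
      by (simp add: power_add algebra_simps)
    also have "\<dots> = s ^ l * s ^ l' * (s ^ k' * e) + s ^ k * s ^ k' * (s ^ l' * f)"
      by (simp only: e'(2) f'(2))
    also have "\<dots> = s ^ (k' + l') * (s ^ l * e + s ^ k * f)"
      by (simp add: power_add algebra_simps)
    finally show ?thesis
      using e' f' assms s by (subst mfrac_eq_iff) (auto intro!: mpideal_add[OF I] power_mult_mem)
  qed
  moreover have "(e, k) \<in> mfrac M s e k" "(f, l) \<in> mfrac M s f l"
    using assms s by (simp_all add: mfrac_iff)
  ultimately have "(\<Union>(e', k')\<in>mfrac M s e k. \<Union>(f', l')\<in>mfrac M s f l.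
      mfrac M s (s ^ l' * e' + s ^ k' * f') (k' + l')) = mfrac M s (s ^ l * e + s ^ k * f) (k + l)"
    by (intro UN_pairs_const[of e k] UN_pairs_const[of f l])
  then show ?thesis by (simp add: localization_def)
qed

lemma loc_add_same:
  assumes "e \<in> I" "f \<in> I"
  shows "mfrac M s e k \<oplus>\<^bsub>L\<^esub> mfrac M s f k = mfrac M s (e + f) k"
  unfolding loc_add[OF assms] distrib_left[symmetric]
  by (rule mfrac_scale(2)[OF s mpideal_add[OF I assms]])

lemma loc_zero: "\<zero>\<^bsub>L\<^esub> = mfrac M s 0 k"
  using s mpideal_zero[OF I] by (simp add: localization_def mfrac_eq_iff)

lemma loc_carrier: "carrier L = {mfrac M s e k | e k. e \<in> I}"
  by (simp add: localization_def)

lemma loc_common_denominator: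
  assumes "x \<in> carrier L" "y \<in> carrier L" "z \<in> carrier L"
  obtains e f g k where "e \<in> I" "f \<in> I" "g \<in> I" "x = mfrac M s e k" "y = mfrac M s f k" "z = mfrac M s g k"
proof -
  obtain e a f b g c where *: "e \<in> I" "f \<in> I" "g \<in> I"
    "x = mfrac M s e a" "y = mfrac M s f b" "z = mfrac M s g c"
    using assms unfolding loc_carrier by blast
  show thesis
  proof (rule that[of "s ^ (b + c) * e" "s ^ (a + c) * f" "s ^ (a + b) * g" "a + b + c"])
    show "x = mfrac M s (s ^ (b + c) * e) (a + b + c)"
      using mfrac_scale(2)[OF s *(1), of "b + c" a] *(4) by (simp add: add_ac)
    show "y = mfrac M s (s ^ (a + c) * f) (a + b + c)"
      using mfrac_scale(2)[OF s *(2), of "a + c" b] *(5) by (simp add: add_ac)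
    show "z = mfrac M s (s ^ (a + b) * g) (a + b + c)"
      using mfrac_scale(2)[OF s *(3), of "a + b" c] *(6) by (simp add: add_ac)
  qed (use * in \<open>auto intro: power_mult_mem\<close>)
qed

text \<open>The sums over T in \<open>cech_diff\<close> are finite sums in this group, and their
  rules presuppose its laws.\<close>

lemma loc_abelian_group: "abelian_group L"
proof (rule abelian_groupI)
  fix x y assume xy: "x \<in> carrier L" "y \<in> carrier L"
  then obtain e f k where *: "e \<in> I" "f \<in> I" "x = mfrac M s e k" "y = mfrac M s f k"
    by (rule loc_common_denominator[OF _ _ xy(1)]) blast
  have "e + f \<in> I" by (rule mpideal_add[OF I *(1,2)])
  then show "x \<oplus>\<^bsub>L\<^esub> y \<in> carrier L" unfolding * loc_add_same[OF *(1,2)] loc_carrier by blast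
  show "x \<oplus>\<^bsub>L\<^esub> y = y \<oplus>\<^bsub>L\<^esub> x"
    unfolding * loc_add_same[OF *(1,2)] loc_add_same[OF *(2,1)] by (simp add: add.commute)
next
  show "\<zero>\<^bsub>L\<^esub> \<in> carrier L" using loc_zero[of 0] mpideal_zero[OF I] by (auto simp: loc_carrier)
next
  fix x y z assume xyz: "x \<in> carrier L" "y \<in> carrier L" "z \<in> carrier L"
  then obtain e f g k where *: "e \<in> I" "f \<in> I" "g \<in> I"
    "x = mfrac M s e k" "y = mfrac M s f k" "z = mfrac M s g k"
    by (rule loc_common_denominator)
  show "x \<oplus>\<^bsub>L\<^esub> y \<oplus>\<^bsub>L\<^esub> z = x \<oplus>\<^bsub>L\<^esub> (y \<oplus>\<^bsub>L\<^esub> z)"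
    using * mpideal_add[OF I] by (simp add: loc_add_same add.assoc)
next
  fix x assume "x \<in> carrier L"
  then obtain e k where *: "e \<in> I" "x = mfrac M s e k" unfolding loc_carrier by blast
  show "\<zero>\<^bsub>L\<^esub> \<oplus>\<^bsub>L\<^esub> x = x"
    using * mpideal_zero[OF I] by (simp add: loc_zero[of k] loc_add_same)
  have "mfrac M s (- e) k \<in> carrier L" using mpideal_uminus[OF I *(1)] by (auto simp: loc_carrier)
  moreover have "mfrac M s (- e) k \<oplus>\<^bsub>L\<^esub> x = \<zero>\<^bsub>L\<^esub>"
    using * mpideal_uminus[OF I *(1)] by (simp add: loc_zero[of k] loc_add_same)
  ultimately show "\<exists>y\<in>carrier L. y \<oplus>\<^bsub>L\<^esub> x = \<zero>\<^bsub>L\<^esub>" by blast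
qed

lemma loc_uminus:
  assumes "e \<in> I"
  shows "\<ominus>\<^bsub>L\<^esub> mfrac M s e k = mfrac M s (- e) k"
proof -
  interpret abelian_group L by (rule loc_abelian_group)
  have "- e \<in> I" by (rule mpideal_uminus[OF I assms])
  then show ?thesis
    using assms by (intro minus_equality) (auto simp: loc_carrier loc_add_same loc_zero[of k])
qed

lemma loc_finsum:
  assumes "finite T" "\<And>j. j \<in> T \<Longrightarrow> e j \<in> I"
  shows "(\<Oplus>\<^bsub>L\<^esub>j\<in>T. mfrac M s (e j) k) = mfrac M s (\<Sum>j\<in>T. e j) k"
proof -
  interpret abelian_group L by (rule loc_abelian_group)
  show ?thesis using assms
  proof (induction T rule: finite_induct)
    case empty
    then show ?case by (simp add: loc_zero[of k])
  next
    case (insert j T)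
    have "(\<lambda>j. mfrac M s (e j) k) \<in> T \<rightarrow> carrier L" "mfrac M s (e j) k \<in> carrier L"
      using insert.prems by (auto simp: loc_carrier)
    then have "(\<Oplus>\<^bsub>L\<^esub>j\<in>insert j T. mfrac M s (e j) k)
        = mfrac M s (e j) k \<oplus>\<^bsub>L\<^esub> (\<Oplus>\<^bsub>L\<^esub>j\<in>T. mfrac M s (e j) k)"
      using insert.hyps by (intro finsum_insert) auto
    also have "\<dots> = mfrac M s (e j) k \<oplus>\<^bsub>L\<^esub> mfrac M s (\<Sum>j\<in>T. e j) k"
      using insert by simp
    also have "\<dots> = mfrac M s (\<Sum>j\<in>insert j T. e j) k"
      using insert by (simp add: loc_add_same mpideal_sum[OF I])
    finally show ?case .
  qed
qed

end


section \<open>Cech cohomology of an ideal\<close>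

definition cech_vec :: "nat \<Rightarrow> nat \<Rightarrow> (nat set \<Rightarrow> 'k mpoly) \<Rightarrow> nat set \<Rightarrow> ('k mpoly \<times> nat) set" where
  "cech_vec p k e = (\<lambda>S\<in>cech_index n p. mfrac M (indet_prod S) (e S) k)"

text \<open>The ungraded counterpart of \<open>cochain\<close>: carriers and
  \<open>coboundaries\<close> may also contain inhomogeneous elements.\<close>

definition numerators :: "nat \<Rightarrow> (nat set \<Rightarrow> 'k mpoly) \<Rightarrow> bool" where
  "numerators p e \<longleftrightarrow> (\<forall>S\<in>cech_index n p. e S \<in> I)"

lemma indet_prod_mpolys: "S \<in> cech_index n p \<Longrightarrow> indet_prod S \<in> mpolys n"
  by (intro forms_mpolys[OF indet_prod_forms] cech_index_subset)

lemma indet_prod_nonzero: "S \<in> cech_index n p \<Longrightarrow> (indet_prod S :: 'k mpoly) \<noteq> 0"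
  by (simp add: cech_index_finite)

lemma finite_cech_index: "finite (cech_index n p)"
  by (rule finite_subset[of _ "Pow {1..n}"]) (auto simp: cech_index_def)

lemma numerators_scale: "numerators p e \<Longrightarrow> numerators p (\<lambda>S. indet_prod S ^ m * e S)"
  unfolding numerators_def by (auto intro!: mfrac_scale(1)[OF indet_prod_nonzero indet_prod_mpolys])

lemma numerators_add: "numerators p e \<Longrightarrow> numerators p f \<Longrightarrow> numerators p (\<lambda>S. e S + f S)"
  by (auto simp: numerators_def intro: mpideal_add[OF I])

lemma numerators_diff: "numerators p e \<Longrightarrow> numerators p f \<Longrightarrow> numerators p (\<lambda>S. e S - f S)"
  by (auto simp: numerators_def intro: mpideal_diff[OF I])

lemma numerators_zero: "numerators p (\<lambda>S. 0)"
  by (simp add: numerators_def mpideal_zero[OF I])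

lemma numerators_kdiff: "numerators p e \<Longrightarrow> numerators (Suc p) (kdiff k e)"
  unfolding numerators_def
  by (auto intro!: kdiff_mpideal[OF I] cech_index_subset cech_index_remove)

lemma cochain_numerators: "cochain n I p r k e \<Longrightarrow> numerators p e"
  by (auto simp: cochain_def numerators_def)

lemma cech_vec_eq_iff:
  assumes "numerators p e" "numerators p f"
  shows "cech_vec p k e = cech_vec p l f \<longleftrightarrow>
    (\<forall>S\<in>cech_index n p. indet_prod S ^ l * e S = indet_prod S ^ k * f S)"
proof -
  have "cech_vec p k e = cech_vec p l f \<longleftrightarrow>
      (\<forall>S\<in>cech_index n p. mfrac M (indet_prod S) (e S) k = mfrac M (indet_prod S) (f S) l)"
    (is "?a = ?b \<longleftrightarrow> _")
  proof
    assume eq: "?a = ?b"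
    show "\<forall>S\<in>cech_index n p. mfrac M (indet_prod S) (e S) k = mfrac M (indet_prod S) (f S) l"
    proof
      fix S assume "S \<in> cech_index n p"
      then show "mfrac M (indet_prod S) (e S) k = mfrac M (indet_prod S) (f S) l"
        using fun_cong[OF eq, of S] by (simp add: cech_vec_def)
    qed
  qed (auto simp: cech_vec_def intro: restrict_ext)
  then show ?thesis
    using assms by (simp add: numerators_def mfrac_eq_iff[OF indet_prod_nonzero])
qed

lemma cech_vec_scale:
  "numerators p e \<Longrightarrow> cech_vec p (k + m) (\<lambda>S. indet_prod S ^ m * e S) = cech_vec p k e"
  by (subst cech_vec_eq_iff[OF numerators_scale]) (simp_all add: power_add mult_ac)

lemma cech_add:
  assumes "numerators p e" "numerators p f"
  shows "cech_vec p k e \<oplus>\<^bsub>cech n M p\<^esub> cech_vec p k f = cech_vec p k (\<lambda>S. e S + f S)"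
  unfolding cech_def cech_vec_def cech_loc_def
  using assms by (auto simp: numerators_def fun_eq_iff restrict_def
      loc_add_same[OF indet_prod_nonzero indet_prod_mpolys])

lemma cech_zero: "\<zero>\<^bsub>cech n M p\<^esub> = cech_vec p k (\<lambda>S. 0)"
proof -
  have "(\<lambda>S\<in>cech_index n p. \<zero>\<^bsub>cech_loc M S\<^esub>) = cech_vec p k (\<lambda>S. 0)"
    unfolding cech_vec_def cech_loc_def
    by (intro restrict_ext loc_zero[OF indet_prod_nonzero indet_prod_mpolys])
  then show ?thesis by (simp add: cech_def)
qed

text \<open>There are finitely many index sets, so the largest exponent serves all. The family P may
  depend on the exponent, which covers the carrier as well as the graded components, where the
  degree of the numerator grows with k.\<close>

lemma PiE_common_denominator:
  assumes c: "c \<in> (\<Pi>\<^sub>E S\<in>cech_index n p. {mfrac M (indet_prod S) e k | e k. e \<in> P S k})"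
    and P: "\<And>S k m e. S \<in> cech_index n p \<Longrightarrow> e \<in> P S k \<Longrightarrow> e \<in> I \<and> indet_prod S ^ m * e \<in> P S (k + m)"
  shows "\<exists>k e. (\<forall>S\<in>cech_index n p. e S \<in> P S k) \<and> c = cech_vec p k e"
proof -
  have "\<forall>S\<in>cech_index n p. \<exists>e k. e \<in> P S k \<and> c S = mfrac M (indet_prod S) e k"
    using c by (fastforce dest: PiE_mem)
  then obtain e l where e: "\<And>S. S \<in> cech_index n p \<Longrightarrow> e S \<in> P S (l S) \<and> c S = mfrac M (indet_prod S) (e S) (l S)"
    by metis
  define k where "k = Max (l ` cech_index n p)"
  have le: "l S \<le> k" if "S \<in> cech_index n p" for S
    unfolding k_def using that finite_cech_index by (intro Max_ge) auto
  define e' where "e' S = indet_prod S ^ (k - l S) * e S" for S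
  have "e' S \<in> P S k" if S: "S \<in> cech_index n p" for S
    using P[OF S, of "e S" "l S" "k - l S"] e[OF S] le[OF S] by (simp add: e'_def)
  moreover have "c = cech_vec p k e'"
  proof
    fix S show "c S = cech_vec p k e' S"
    proof (cases "S \<in> cech_index n p")
      case True
      have "e S \<in> I" using P[OF True] e[OF True] by blast
      then have "mfrac M (indet_prod S) (e' S) k = mfrac M (indet_prod S) (e S) (l S)"
        using mfrac_scale(2)[OF indet_prod_nonzero[OF True] indet_prod_mpolys[OF True], of "e S" "k - l S" "l S"]
          le[OF True] by (simp add: e'_def)
      then show ?thesis using e[OF True] True by (simp add: cech_vec_def)
    next
      case False
      then show ?thesis using PiE_arb[OF c False] by (simp add: cech_vec_def)
    qed
  qed
  ultimately show ?thesis by blast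
qed

lemma cech_carrier: "c \<in> carrier (cech n M p) \<longleftrightarrow> (\<exists>k e. numerators p e \<and> c = cech_vec p k e)"
proof
  assume "c \<in> carrier (cech n M p)"
  then have "c \<in> (\<Pi>\<^sub>E S\<in>cech_index n p. {mfrac M (indet_prod S) e k | e k. e \<in> I})"
    by (simp add: cech_def cech_loc_def localization_def)
  from PiE_common_denominator[OF this]
  show "\<exists>k e. numerators p e \<and> c = cech_vec p k e"
    unfolding numerators_def using mfrac_scale(1)[OF indet_prod_nonzero indet_prod_mpolys] by blast
next
  assume "\<exists>k e. numerators p e \<and> c = cech_vec p k e"
  then obtain k e where e: "numerators p e" "c = cech_vec p k e" by blast
  have "mfrac M (indet_prod S) (e S) k \<in> {mfrac M (indet_prod S) e k | e k. e \<in> I}"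
    if "S \<in> cech_index n p" for S
    using e(1) that unfolding numerators_def by blast
  then show "c \<in> carrier (cech n M p)"
    unfolding e(2) cech_vec_def by (simp add: cech_def cech_loc_def localization_def restrict_PiE_iff)
qed

lemma cech_component: "c \<in> component (cech n M p) r \<longleftrightarrow> (\<exists>k e. cochain n I p r k e \<and> c = cech_vec p k e)"
proof
  let ?P = "\<lambda>S k. I \<inter> forms n (r + int (k * card S))"
  assume "c \<in> component (cech n M p) r"
  then have c: "c \<in> (\<Pi>\<^sub>E S\<in>cech_index n p. {mfrac M (indet_prod S) e k | e k. e \<in> ?P S k})"
    by (simp add: cech_def cech_loc_def localization_def)
  have "\<exists>k e. (\<forall>S\<in>cech_index n p. e S \<in> ?P S k) \<and> c = cech_vec p k e"
  proof (rule PiE_common_denominator[OF c])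
    fix S k m e assume S: "S \<in> cech_index n p" and e: "e \<in> ?P S k"
    have "indet_prod S ^ m * e \<in> forms n (r + int ((k + m) * card S))"
      using e by (intro forms_mult_eq[OF indet_prod_power_forms[OF cech_index_subset[OF S]]])
        (auto simp: algebra_simps)
    then show "e \<in> I \<and> indet_prod S ^ m * e \<in> ?P S (k + m)"
      using e mfrac_scale(1)[OF indet_prod_nonzero[OF S] indet_prod_mpolys[OF S]] by blast
  qed
  then obtain k e where e: "\<forall>S\<in>cech_index n p. e S \<in> ?P S k" "c = cech_vec p k e" by blast
  have "cochain n I p r k e" using e(1) by (auto simp: cochain_def cech_index_def)
  with e(2) show "\<exists>k e. cochain n I p r k e \<and> c = cech_vec p k e" by blast
next
  assume "\<exists>k e. cochain n I p r k e \<and> c = cech_vec p k e"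
  then obtain k e where e: "cochain n I p r k e" "c = cech_vec p k e" by blast
  have "e S \<in> I \<inter> forms n (r + int (k * card S))" if "S \<in> cech_index n p" for S
    using e(1) that by (auto simp: cochain_def cech_index_def)
  then show "c \<in> component (cech n M p) r"
    unfolding e(2) by (fastforce simp: cech_def cech_loc_def localization_def cech_vec_def)
qed

lemma cech_map_mfrac:
  assumes T: "T \<in> cech_index n (Suc p)" and j: "j \<in> T" and e: "e \<in> I"
  shows "cech_map M T j (mfrac M (indet_prod (T - {j})) e k) = mfrac M (indet_prod T) (indet j ^ k * e) k"
proof -
  let ?s = "indet_prod (T - {j}) :: 'k mpoly"
  have fT: "finite T" by (rule cech_index_finite[OF T])
  have s: "?s \<noteq> 0" using fT by simp
  have pw: "indet j ^ m * f \<in> I" if "f \<in> I" for f m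
    using j cech_index_subset[OF T] that by (intro mpideal_mult[OF I] forms_mpolys[OF indet_power_forms]) auto
  have "mfrac M (indet_prod T) (indet j ^ l * f) l = mfrac M (indet_prod T) (indet j ^ k * e) k"
    if fl: "(f, l) \<in> mfrac M ?s e k" for f l
  proof -
    have f: "f \<in> I" "?s ^ l * e = ?s ^ k * f" using fl e s by (auto simp: mfrac_iff)
    have "indet_prod T ^ k * (indet j ^ l * f) = indet j ^ k * indet j ^ l * (?s ^ k * f)"
      by (simp add: indet_prod_remove[OF fT j] power_mult_distrib mult_ac)
    also have "\<dots> = indet j ^ k * indet j ^ l * (?s ^ l * e)" by (simp only: f(2))
    also have "\<dots> = indet_prod T ^ l * (indet j ^ k * e)"
      by (simp add: indet_prod_remove[OF fT j] power_mult_distrib mult_ac)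
    finally show ?thesis
      using mfrac_eq_iff[OF indet_prod_nonzero[OF T] pw[OF f(1), of l] pw[OF e, of k], of l k] by simp
  qed
  moreover have "(e, k) \<in> mfrac M ?s e k" using s e by (simp add: mfrac_iff)
  ultimately show ?thesis unfolding cech_map_def M_simps by (intro UN_pairs_const[of e k])
qed

text \<open>With one exponent k for all index sets, the canonical map just multiplies the numerator
  by x_j^k, and the Cech differential becomes \<open>kdiff\<close>.\<close>

lemma cech_diff_vec:
  assumes e: "numerators p e"
  shows "cech_diff n M p (cech_vec p k e) = cech_vec (Suc p) k (kdiff k e)"
  unfolding cech_diff_def cech_vec_def
proof (rule restrict_ext)
  fix T assume T: "T \<in> cech_index n (Suc p)"
  let ?c = "\<lambda>S\<in>cech_index n p. mfrac M (indet_prod S) (e S) k"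
  let ?L = "cech_loc M T"
  note s = indet_prod_nonzero[OF T] indet_prod_mpolys[OF T]
  interpret L: abelian_group ?L unfolding cech_loc_def by (rule loc_abelian_group[OF s])
  have tm: "csign T j * (indet j ^ k * e (T - {j})) \<in> I" "indet j ^ k * e (T - {j}) \<in> I" if j: "j \<in> T" for j
  proof -
    have "e (T - {j}) \<in> I" using e cech_index_remove[OF T j] by (simp add: numerators_def)
    then show "indet j ^ k * e (T - {j}) \<in> I"
      using j cech_index_subset[OF T] by (intro mpideal_mult[OF I] forms_mpolys[OF indet_power_forms]) auto
    then show "csign T j * (indet j ^ k * e (T - {j})) \<in> I"
      by (rule mpideal_mult[OF I _ forms_mpolys[OF csign_forms]])
  qed
  have "(if even (card {i \<in> T. i < j}) then cech_map M T j (?c (T - {j}))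
         else \<ominus>\<^bsub>?L\<^esub> cech_map M T j (?c (T - {j})))
      = mfrac M (indet_prod T) (csign T j * (indet j ^ k * e (T - {j}))) k" if j: "j \<in> T" for j
  proof -
    have S: "T - {j} \<in> cech_index n p" by (rule cech_index_remove[OF T j])
    have "e (T - {j}) \<in> I" using e S by (simp add: numerators_def)
    then have "cech_map M T j (?c (T - {j})) = mfrac M (indet_prod T) (indet j ^ k * e (T - {j})) k"
      using S cech_map_mfrac[OF T j] by simp
    then show ?thesis
      using loc_uminus[OF s tm(2)[OF j]] by (simp add: csign_def cech_loc_def)
  qed
  then have "(\<Oplus>\<^bsub>?L\<^esub>j\<in>T. (if even (card {i \<in> T. i < j}) then cech_map M T j (?c (T - {j}))
         else \<ominus>\<^bsub>?L\<^esub> cech_map M T j (?c (T - {j}))))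
      = (\<Oplus>\<^bsub>?L\<^esub>j\<in>T. mfrac M (indet_prod T) (csign T j * (indet j ^ k * e (T - {j}))) k)"
    using tm(1) by (intro L.finsum_cong') (auto simp: cech_loc_def localization_def)
  also have "\<dots> = mfrac M (indet_prod T) (kdiff k e T) k"
    unfolding cech_loc_def kdiff_def using tm(1) by (intro loc_finsum[OF s] cech_index_finite[OF T])
  finally show "(\<Oplus>\<^bsub>?L\<^esub>j\<in>T. (if even (card {i \<in> T. i < j}) then cech_map M T j (?c (T - {j}))
         else \<ominus>\<^bsub>?L\<^esub> cech_map M T j (?c (T - {j})))) = mfrac M (indet_prod T) (kdiff k e T) k" .
qed

lemma cocycle_vec_iff:
  assumes e: "numerators p e"
  shows "cech_vec p k e \<in> cocycles n M p \<longleftrightarrow> (\<forall>T\<in>cech_index n (Suc p). kdiff k e T = 0)"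
proof -
  have "cech_vec p k e \<in> carrier (cech n M p)" using e by (auto simp: cech_carrier)
  then have "cech_vec p k e \<in> cocycles n M p \<longleftrightarrow>
      cech_vec (Suc p) k (kdiff k e) = cech_vec (Suc p) k (\<lambda>S. 0)"
    by (simp add: cocycles_def cech_diff_vec[OF e] cech_zero[of "Suc p" k])
  also have "\<dots> \<longleftrightarrow> (\<forall>T\<in>cech_index n (Suc p). kdiff k e T = 0)"
    by (subst cech_vec_eq_iff[OF numerators_kdiff[OF e] numerators_zero]) (auto simp: indet_prod_nonzero)
  finally show ?thesis .
qed

text \<open>For p = 0 the right-hand side is the zero cochain, since
  \<open>kdiff k f {} = 0\<close>; both cases of \<open>coboundaries\<close> thereby get one
  form.\<close>

lemma coboundaries_iff:
  "c \<in> coboundaries n M p \<longleftrightarrow> (\<exists>k f. (\<forall>q. p = Suc q \<longrightarrow> numerators q f) \<and> c = cech_vec p k (kdiff k f))"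
proof (cases p)
  case 0
  have "cech_vec 0 k (kdiff k f) = cech_vec 0 k (\<lambda>S. 0)" for k f
    unfolding cech_vec_def by (rule restrict_ext) simp
  then show ?thesis
    using 0 cech_zero[of 0] by (auto simp: coboundaries_def)
next
  case (Suc q)
  have "c \<in> coboundaries n M p \<longleftrightarrow> (\<exists>b. b \<in> carrier (cech n M q) \<and> c = cech_diff n M q b)"
    using Suc by (auto simp: coboundaries_def)
  also have "\<dots> \<longleftrightarrow> (\<exists>k f. numerators q f \<and> c = cech_vec p k (kdiff k f))"
    unfolding cech_carrier using cech_diff_vec Suc by metis
  finally show ?thesis using Suc by auto
qed

lemma numerators_coboundary: "(\<forall>q. p = Suc q \<longrightarrow> numerators q f) \<Longrightarrow> numerators p (kdiff k f)"
proof (cases p)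
  case 0
  then show ?thesis by (simp add: numerators_def mpideal_zero[OF I])
qed (auto intro: numerators_kdiff)

text \<open>Primitives in \<open>coboundaries\<close> may be inhomogeneous. The differential
  respects degrees, so after clearing denominators a primitive can be replaced by its part in the
  right degree.\<close>

lemma coboundary_vec_iff:
  assumes I': "graded_ideal n I" and e: "cochain n I p r k e"
  shows "cech_vec p k e \<in> coboundaries n M p \<longleftrightarrow>
    (\<exists>m f. (\<forall>q. p = Suc q \<longrightarrow> cochain n I q r (k + m) f) \<and>
       (\<forall>S\<in>cech_index n p. indet_prod S ^ m * e S = kdiff (k + m) f S))"
proof
  assume "cech_vec p k e \<in> coboundaries n M p"
  then obtain l g where g: "\<forall>q. p = Suc q \<longrightarrow> numerators q g" "cech_vec p k e = cech_vec p l (kdiff l g)"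
    unfolding coboundaries_iff by blast
  have eq: "\<And>S. S \<in> cech_index n p \<Longrightarrow> indet_prod S ^ l * e S = indet_prod S ^ k * kdiff l g S"
    using g(2) cech_vec_eq_iff[OF cochain_numerators[OF e] numerators_coboundary[OF g(1)]] by blast
  define K where "K = k + l"
  \<comment> \<open>Primitives live on sets with p - 1 elements, each of whose variables contributes
    K to the degree.\<close>
  define f where "f U = hpart (r + int K * (int p - 1)) (indet_prod U ^ k * g U)" for U
  have "cochain n I q r K f" if q: "p = Suc q" for q
    unfolding cochain_def
  proof
    fix U assume U: "U \<in> cech_index n q"
    have "indet_prod U ^ k * g U \<in> I"
      using numerators_scale[of q g k] g(1) q U by (simp add: numerators_def)
    then show "f U \<in> I \<inter> forms n (r + int K * int q)"
      unfolding f_def using graded_ideal_hpart[OF I'] hpart_forms[OF mpideal_mpolys[OF I]] q by simp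
  qed
  moreover have "indet_prod S ^ l * e S = kdiff K f S" if S: "S \<in> cech_index n p" for S
  proof -
    have fS: "finite S" by (rule cech_index_finite[OF S])
    have es: "indet_prod S ^ l * e S \<in> forms n (r + int K * int p)"
      using cochainD(2)[OF cochain_scale[OF I e, of l] S] by (simp add: K_def)
    have "indet_prod S ^ l * e S = kdiff K (\<lambda>U. indet_prod U ^ k * g U) S"
      using eq[OF S] kdiff_scale[OF fS, of l k g] by (simp add: K_def add.commute)
    then have "indet_prod S ^ l * e S = hpart (r + int K * int p) (kdiff K (\<lambda>U. indet_prod U ^ k * g U) S)"
      using hpart_eq_self[OF es] by metis
    also have "\<dots> = kdiff K f S"
      unfolding kdiff_def part_sum
    proof (rule sum.cong)
      fix j assume "j \<in> S"
      then have "indet j ^ K \<in> forms n (int K)"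
        using cech_index_subset[OF S] by (intro indet_power_forms) auto
      then have "csign S j * indet j ^ K \<in> forms n (int K)"
        using forms_mult[OF csign_forms] by fastforce
      then show "hpart (r + int K * int p) (csign S j * (indet j ^ K * (indet_prod (S - {j}) ^ k * g (S - {j}))))
          = csign S j * (indet j ^ K * f (S - {j}))"
        using hpart_mult[of "csign S j * indet j ^ K" n "int K" "r + int K * int p" "indet_prod (S - {j}) ^ k * g (S - {j})"]
        by (simp add: mult.assoc f_def algebra_simps)
    qed simp
    finally show ?thesis .
  qed
  ultimately show "\<exists>m f. (\<forall>q. p = Suc q \<longrightarrow> cochain n I q r (k + m) f) \<and>
       (\<forall>S\<in>cech_index n p. indet_prod S ^ m * e S = kdiff (k + m) f S)"
    unfolding K_def by blast
next
  assume "\<exists>m f. (\<forall>q. p = Suc q \<longrightarrow> cochain n I q r (k + m) f) \<and>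
       (\<forall>S\<in>cech_index n p. indet_prod S ^ m * e S = kdiff (k + m) f S)"
  then obtain m f where f: "\<forall>q. p = Suc q \<longrightarrow> cochain n I q r (k + m) f"
    "\<And>S. S \<in> cech_index n p \<Longrightarrow> indet_prod S ^ m * e S = kdiff (k + m) f S" by blast
  have "cech_vec p k e = cech_vec p (k + m) (\<lambda>S. indet_prod S ^ m * e S)"
    by (rule cech_vec_scale[OF cochain_numerators[OF e], symmetric])
  also have "\<dots> = cech_vec p (k + m) (kdiff (k + m) f)"
    unfolding cech_vec_def using f(2) by (intro restrict_ext) simp
  finally show "cech_vec p k e \<in> coboundaries n M p"
    unfolding coboundaries_iff using f(1) cochain_numerators
    by (intro exI[of _ "k + m"] exI[of _ f]) auto
qed

lemma coboundaries_common_denominator: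
  assumes "b \<in> coboundaries n M p" "c \<in> coboundaries n M p"
  obtains k f g where "\<forall>q. p = Suc q \<longrightarrow> numerators q f" "\<forall>q. p = Suc q \<longrightarrow> numerators q g"
    "b = cech_vec p k (kdiff k f)" "c = cech_vec p k (kdiff k g)"
proof -
  obtain k f where f: "\<forall>q. p = Suc q \<longrightarrow> numerators q f" "b = cech_vec p k (kdiff k f)"
    using assms(1) unfolding coboundaries_iff by blast
  obtain l g where g: "\<forall>q. p = Suc q \<longrightarrow> numerators q g" "c = cech_vec p l (kdiff l g)"
    using assms(2) unfolding coboundaries_iff by blast
  have sc: "cech_vec p (a + m) (kdiff (a + m) (\<lambda>U. indet_prod U ^ m * h U)) = cech_vec p a (kdiff a h)"
    if "\<forall>q. p = Suc q \<longrightarrow> numerators q h" for a m h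
  proof -
    have "cech_vec p (a + m) (kdiff (a + m) (\<lambda>U. indet_prod U ^ m * h U))
        = cech_vec p (a + m) (\<lambda>S. indet_prod S ^ m * kdiff a h S)"
      unfolding cech_vec_def by (intro restrict_ext) (simp add: kdiff_scale cech_index_finite)
    also have "\<dots> = cech_vec p a (kdiff a h)"
      by (rule cech_vec_scale[OF numerators_coboundary[OF that]])
    finally show ?thesis .
  qed
  show thesis
  proof (rule that[of "\<lambda>U. indet_prod U ^ l * f U" "\<lambda>U. indet_prod U ^ k * g U" "k + l"])
    show "b = cech_vec p (k + l) (kdiff (k + l) (\<lambda>U. indet_prod U ^ l * f U))"
      using sc[OF f(1), of k l] f(2) by simp
    show "c = cech_vec p (k + l) (kdiff (k + l) (\<lambda>U. indet_prod U ^ k * g U))"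
      using sc[OF g(1), of l k] g(2) by (simp add: add.commute)
  qed (use f(1) g(1) numerators_scale in auto)
qed

text \<open>Coboundaries contain 0 and are closed under sums and differences, as seen over a common
  denominator.\<close>

lemma coboundaries_coset_iff:
  assumes e: "numerators p e"
  shows "coboundaries n M p +>\<^bsub>submod (cech n M p) H\<^esub> cech_vec p k e = coboundaries n M p
    \<longleftrightarrow> cech_vec p k e \<in> coboundaries n M p"
proof -
  let ?B = "coboundaries n M p"
  let ?c = "cech_vec p k e"
  have coset: "?B +>\<^bsub>submod (cech n M p) H\<^esub> ?c = (\<lambda>b. b \<oplus>\<^bsub>cech n M p\<^esub> ?c) ` ?B"
    by (auto simp: a_r_coset_def r_coset_def submod_def)
  have zero: "cech_vec p l (\<lambda>S. 0) \<in> ?B" for l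
  proof -
    have "kdiff l (\<lambda>S. 0 :: 'k mpoly) = (\<lambda>S. 0)" by (auto simp: kdiff_def fun_eq_iff)
    then show ?thesis unfolding coboundaries_iff using numerators_zero by metis
  qed
  show ?thesis
  proof
    assume "?B +>\<^bsub>submod (cech n M p) H\<^esub> ?c = ?B"
    moreover have "?c = cech_vec p k (\<lambda>S. 0) \<oplus>\<^bsub>cech n M p\<^esub> ?c"
      by (simp add: cech_add[OF numerators_zero e])
    ultimately show "?c \<in> ?B" unfolding coset using zero[of k] by blast
  next
    assume c: "?c \<in> ?B"
    show "?B +>\<^bsub>submod (cech n M p) H\<^esub> ?c = ?B"
      unfolding coset
    proof (intro equalityI subsetI)
      fix x assume "x \<in> (\<lambda>b. b \<oplus>\<^bsub>cech n M p\<^esub> ?c) ` ?B"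
      then obtain b where b: "b \<in> ?B" "x = b \<oplus>\<^bsub>cech n M p\<^esub> ?c" by blast
      obtain l f g where *: "\<forall>q. p = Suc q \<longrightarrow> numerators q f" "\<forall>q. p = Suc q \<longrightarrow> numerators q g"
        "b = cech_vec p l (kdiff l f)" "?c = cech_vec p l (kdiff l g)"
        by (rule coboundaries_common_denominator[OF b(1) c])
      have "x = cech_vec p l (kdiff l (\<lambda>U. f U + g U))"
        unfolding b(2) *(3,4) cech_add[OF numerators_coboundary[OF *(1)] numerators_coboundary[OF *(2)]]
        by (simp add: kdiff_add[symmetric])
      then show "x \<in> ?B" unfolding coboundaries_iff using *(1,2) numerators_add by blast
    next
      fix x assume x: "x \<in> ?B"
      obtain l f g where *: "\<forall>q. p = Suc q \<longrightarrow> numerators q f" "\<forall>q. p = Suc q \<longrightarrow> numerators q g"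
        "x = cech_vec p l (kdiff l f)" "?c = cech_vec p l (kdiff l g)"
        by (rule coboundaries_common_denominator[OF x c])
      have d: "\<forall>q. p = Suc q \<longrightarrow> numerators q (\<lambda>U. f U - g U)" using *(1,2) numerators_diff by blast
      then have "cech_vec p l (kdiff l (\<lambda>U. f U - g U)) \<in> ?B" unfolding coboundaries_iff by blast
      moreover have "x = cech_vec p l (kdiff l (\<lambda>U. f U - g U)) \<oplus>\<^bsub>cech n M p\<^esub> ?c"
        unfolding *(3,4) cech_add[OF numerators_coboundary[OF d] numerators_coboundary[OF *(2)]]
        by (simp add: kdiff_add[symmetric])
      ultimately show "x \<in> (\<lambda>b. b \<oplus>\<^bsub>cech n M p\<^esub> ?c) ` ?B" by blast
    qed
  qed
qed

lemma local_cohomology_component_iff: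
  assumes I': "graded_ideal n I"
  shows "component (local_cohomology n p M) r = {\<zero>\<^bsub>local_cohomology n p M\<^esub>} \<longleftrightarrow> lc_vanish n I {0} p r"
proof -
  let ?B = "coboundaries n M p"
  let ?Z = "cocycles n M p"
  let ?S = "submod (cech n M p) ?Z"
  have comp: "component (local_cohomology n p M) r = (\<lambda>c. ?B +>\<^bsub>?S\<^esub> c) ` (?Z \<inter> component (cech n M p) r)"
    by (simp add: local_cohomology_def quotmod_def submod_def)
  have zero: "\<zero>\<^bsub>local_cohomology n p M\<^esub> = ?B" by (simp add: local_cohomology_def quotmod_def)
  \<comment> \<open>The zero cochain is a cocycle of every degree, so the component is nonempty and
    is zero exactly when every coset in it is trivial.\<close>
  have "cochain n I p r 0 (\<lambda>S. 0)" by (simp add: cochain_def mpideal_zero[OF I])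
  then have "cech_vec p 0 (\<lambda>S. 0) \<in> component (cech n M p) r" unfolding cech_component by blast
  moreover have "cech_vec p 0 (\<lambda>S. 0) \<in> ?Z"
    unfolding cocycle_vec_iff[OF numerators_zero] by (simp add: kdiff_def)
  ultimately have "cech_vec p 0 (\<lambda>S. 0) \<in> ?Z \<inter> component (cech n M p) r" by simp
  then have "component (local_cohomology n p M) r = {\<zero>\<^bsub>local_cohomology n p M\<^esub>} \<longleftrightarrow>
      (\<forall>c\<in>?Z \<inter> component (cech n M p) r. ?B +>\<^bsub>?S\<^esub> c = ?B)"
    unfolding comp zero by blast
  also have "\<dots> \<longleftrightarrow> (\<forall>k e. cochain n I p r k e \<longrightarrow> cech_vec p k e \<in> ?Z \<longrightarrow> ?B +>\<^bsub>?S\<^esub> cech_vec p k e = ?B)"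
    unfolding Int_iff Ball_def cech_component by blast
  also have "\<dots> \<longleftrightarrow> lc_vanish n I {0} p r"
    unfolding lc_vanish_def
    by (intro all_cong1 imp_cong refl)
      (simp_all add: cocycle_vec_iff[OF cochain_numerators] coboundaries_coset_iff[OF cochain_numerators]
        coboundary_vec_iff[OF I'])
  finally show ?thesis .
qed

end


section \<open>Comparison of the invariants\<close>

text \<open>Integer bounds determine the supremum: a real bound of a set of integers can be lowered
  to its floor. Empty and unbounded sets are included.\<close>

lemma Sup_ereal_of_int_eqI:
  fixes D D' :: "int set"
  assumes "\<And>\<rho>. (\<forall>d\<in>D. d \<le> \<rho>) \<longleftrightarrow> (\<forall>d\<in>D'. d \<le> \<rho>)"
  shows "Sup ((\<lambda>d. ereal (of_int d)) ` D) = Sup ((\<lambda>d. ereal (of_int d)) ` D')"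
proof -
  have le: "Sup ((\<lambda>d. ereal (of_int d)) ` D) \<le> Sup ((\<lambda>d. ereal (of_int d)) ` D')"
    if imp: "\<And>\<rho>. \<forall>d\<in>D'. d \<le> \<rho> \<Longrightarrow> \<forall>d\<in>D. d \<le> \<rho>" for D D' :: "int set"
  proof (rule ereal_le_real)
    fix x assume "Sup ((\<lambda>d. ereal (of_int d)) ` D') \<le> ereal x"
    then have "\<forall>d\<in>D'. d \<le> \<lfloor>x\<rfloor>" by (auto simp: SUP_le_iff le_floor_iff)
    then have "\<forall>d\<in>D. d \<le> \<lfloor>x\<rfloor>" by (rule imp)
    then show "Sup ((\<lambda>d. ereal (of_int d)) ` D) \<le> ereal x" by (auto simp: SUP_le_iff le_floor_iff)
  qed
  show ?thesis using assms by (intro antisym le) blast+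
qed

text \<open>The maximum becomes one supremum over all pairs (p, r) with nonvanishing cohomology, so
  that only upper bounds of this set need to be compared.\<close>

lemma Max_a_invariant_eq:
  fixes c :: int
  assumes gr: "graded_ideal n I"
  shows "Max ((\<lambda>i. a_invariant n i (ideal_module n I) + ereal (of_int (c * int i))) ` {0..t})
    = Sup ((\<lambda>d. ereal (of_int d)) ` {r + c * int p | p r. p \<le> t \<and> \<not> lc_vanish n I {0} p r})"
proof -
  interpret ideal_fractions n I by unfold_locales (rule graded_ideal_mpideal[OF gr])
  let ?f = "\<lambda>d. ereal (of_int d)"
  have "a_invariant n i M + ?f (c * int i) = Sup (?f ` {r + c * int i | r. \<not> lc_vanish n I {0} i r})" for i
  proof -
    have "a_invariant n i M = (SUP r\<in>{r. \<not> lc_vanish n I {0} i r}. ?f r)"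
      unfolding a_invariant_def local_cohomology_component_iff[OF gr] by (simp add: setcompr_eq_image)
    also have "\<dots> + ?f (c * int i) = (SUP r\<in>{r. \<not> lc_vanish n I {0} i r}. ?f r + ?f (c * int i))"
    \<comment> \<open>If the cohomology vanishes in all degrees, both sides are -\<infinity>; the
      rule for adding a constant under a supremum asks for a nonempty set.\<close>
    proof (cases "{r. \<not> lc_vanish n I {0} i r} = {}")
      case False
      then show ?thesis by (subst SUP_ereal_add_left) auto
    qed (simp add: bot_ereal_def)
    also have "\<dots> = Sup (?f ` {r + c * int i | r. \<not> lc_vanish n I {0} i r})"
      by (simp add: setcompr_eq_image image_image)
    finally show ?thesis .
  qed
  then have "Max ((\<lambda>i. a_invariant n i M + ?f (c * int i)) ` {0..t})
      = (SUP i\<in>{0..t}. Sup (?f ` {r + c * int i | r. \<not> lc_vanish n I {0} i r}))"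
    by (simp add: Max_Sup)
  also have "\<dots> = Sup (?f ` (\<Union>i\<in>{0..t}. {r + c * int i | r. \<not> lc_vanish n I {0} i r}))"
    by (simp add: SUP_UNION)
  also have "(\<Union>i\<in>{0..t}. {r + c * int i | r. \<not> lc_vanish n I {0} i r})
      = {r + c * int p | p r. p \<le> t \<and> \<not> lc_vanish n I {0} p r}"
    by auto blast
  finally show ?thesis .
qed

text \<open>H^0(I) = 0 removes p = 0, and p = q + 1 turns into R/I at q; writing c (q + 1) as c q +
  c gives the threshold \<open>\<rho> - c\<close>.\<close>

lemma lc_bound_iff_colon_stable:
  fixes c \<rho> :: int
  assumes I: "graded_ideal n I" and c: "0 \<le> c" "c \<le> 1" and t: "t < n"
    and st: "\<And>i. i < t \<Longrightarrow> \<exists>r0. \<forall>r\<ge>r0. colon_stable n (add_vars n I i) (n - i) r"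
  shows "(\<forall>d\<in>{r + c * int p | p r. p \<le> t \<and> \<not> lc_vanish n I {0} p r}. d \<le> \<rho>) \<longleftrightarrow>
    (\<forall>i<t. \<forall>r. \<rho> - c < r - (1 - c) * int i \<longrightarrow> colon_stable n (add_vars n I i) (n - i) r)"
proof -
  have I': "mpideal n I" by (rule graded_ideal_mpideal[OF I])
  have "(\<forall>d\<in>{r + c * int p | p r. p \<le> t \<and> \<not> lc_vanish n I {0} p r}. d \<le> \<rho>) \<longleftrightarrow>
    (\<forall>p\<le>t. \<forall>r. \<not> lc_vanish n I {0} p r \<longrightarrow> r + c * int p \<le> \<rho>)"
    by blast
  also have "\<dots> \<longleftrightarrow> (\<forall>p<Suc t. \<forall>r. \<rho> < r + c * int p \<longrightarrow> lc_vanish n I {0} p r)"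
    unfolding less_Suc_eq_le by (meson not_le)
  also have "\<dots> \<longleftrightarrow> (\<forall>q<t. \<forall>r. \<rho> < r + c * int (Suc q) \<longrightarrow> lc_vanish n I {0} (Suc q) r)"
    unfolding All_less_Suc2 using t by (simp add: lc_vanish_ideal_zero)
  also have "\<dots> \<longleftrightarrow> (\<forall>q<t. \<forall>r. \<rho> - c < r + c * int q \<longrightarrow> lc_vanish n (mpolys n) (add_vars n I 0) q r)"
    using t by (auto simp: lc_vanish_ideal_Suc_iff[OF I'] add_vars_zero[OF I'] algebra_simps)
  also have "\<dots> \<longleftrightarrow> (\<forall>i<t. \<forall>r. \<rho> - c < r - (1 - c) * int i \<longrightarrow> colon_stable n (add_vars n I i) (n - i) r)"
    using lc_vanish_iff_colon_stable[OF I c, of 0 t "\<rho> - c"] st t by simp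
  finally show ?thesis .
qed

theorem theorem6p2:
  fixes n t :: nat and I :: "'k::field mpoly set"
  assumes "homogeneous_ideal n I"
    and "t < n"
    and "filter_regular n (quotmod (poly_ring n) (initial_ideal n I))
           (map (\<lambda>i. indet (n - i)) [0..<Suc t])"
  shows "reg_upto n t (ideal_module n I) = reg_upto n t (ideal_module n (initial_ideal n I))
       \<and> a_star n t (ideal_module n I) = a_star n t (ideal_module n (initial_ideal n I))"
proof -
  have I: "graded_ideal n I" by (rule homogeneous_ideal_imp_graded[OF assms(1)])
  have in_I: "graded_ideal n (initial_ideal n I)"
    by (rule graded_initial_ideal[OF graded_ideal_mpideal[OF I]])
  have iff: "colon_stable n (add_vars n I i) (n - i) r
      \<longleftrightarrow> colon_stable n (add_vars n (initial_ideal n I) i) (n - i) r" if "i < t" for i r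
    using that assms(2) colon_stable_imp_initial[OF I] initial_imp_colon_stable[OF I] by auto
  have st': "\<exists>r0. \<forall>r\<ge>r0. colon_stable n (add_vars n (initial_ideal n I) i) (n - i) r" if "i < t" for i
    using that by (intro filter_regular_imp_colon_stable[OF graded_ideal_mpideal[OF in_I] assms(2) _ assms(3)]) simp
  \<comment> \<open>Stability agrees degree by degree, so filter-regularity passes from in(I) to
    I.\<close>
  have st: "\<exists>r0. \<forall>r\<ge>r0. colon_stable n (add_vars n I i) (n - i) r" if "i < t" for i
    using st'[OF that] by (simp add: iff[OF that])
  have "Max ((\<lambda>i. a_invariant n i (ideal_module n I) + ereal (of_int (c * int i))) ` {0..t})
      = Max ((\<lambda>i. a_invariant n i (ideal_module n (initial_ideal n I)) + ereal (of_int (c * int i))) ` {0..t})"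
    if c: "0 \<le> c" "c \<le> 1" for c
    unfolding Max_a_invariant_eq[OF I] Max_a_invariant_eq[OF in_I]
  proof (rule Sup_ereal_of_int_eqI)
    fix \<rho>
    show "(\<forall>d\<in>{r + c * int p | p r. p \<le> t \<and> \<not> lc_vanish n I {0} p r}. d \<le> \<rho>) \<longleftrightarrow>
      (\<forall>d\<in>{r + c * int p | p r. p \<le> t \<and> \<not> lc_vanish n (initial_ideal n I) {0} p r}. d \<le> \<rho>)"
      using lc_bound_iff_colon_stable[OF I c assms(2) st] lc_bound_iff_colon_stable[OF in_I c assms(2) st']
      by (simp add: iff)
  qed
  \<comment> \<open>Slope 1 gives the regularity, slope 0 the maximum of the a-invariants.\<close>
  from this[of 1] this[of 0] show ?thesis
    by (simp add: reg_upto_def a_star_def)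
qed


end
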